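(* Let $M$ be a smooth paracompact manifold of dimension $n\ge 3$, $\Gamma$ a spray on $T^\circ M$ for whose projective class the path space $\pi:T^\circ M\to P_{\mathcal{D}}$ exists as a smooth manifold, $\gamma:\mathbb{R}\to M$ a geodesic of $\Gamma$, and $p\in P_{\mathcal{D}}$ the image under $\pi$ of the leaf $\mathfrak{L}_\gamma$ of $\mathcal{D}$ containing $t\mapsto(\gamma(t),\dot\gamma(t))$. Let $j:\mathfrak{J}_\gamma\to T_pP_{\mathcal{D}}$ be the linear map $j(\zeta)=\pi_*Z$, where $Z$ is the vector field on $\mathfrak{L}_\gamma$ with $\mathcal{L}_\Delta Z=\mathcal{L}_\Gamma Z=0$ determined by the Jacobi field $\zeta$. Then $j$ induces a linear map $j:\mathfrak{J}^0_\gamma\to T_pP_{\mathcal{D}}$, and this is an isomorphism.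
   Context: $\tau:T^\circ M\to M$ is the tangent bundle with the zero section removed, with coordinates $(x^i,y^i)$; $\Delta=y^i\partial/\partial y^i$. A spray is a vector field $\Gamma=y^i\frac{\partial}{\partial x^i}-2\Gamma^i\frac{\partial}{\partial y^i}$ on $T^\circ M$ with $[\Delta,\Gamma]=\Gamma$; $\mathcal{D}$ is the involutive distribution spanned by $\Delta$ and $\Gamma$ (it depends only on the projective class $\{\Gamma-2P\Delta:\Delta(P)=P\}$). Path space: a $(2n-2)$-dimensional manifold $P_{\mathcal{D}}$ with a fibration $\pi:T^\circ M\to P_{\mathcal{D}}$ whose fibres are the leaves of $\mathcal{D}$. A geodesic of $\Gamma$ is a base integral curve $\gamma$; $\bar\gamma(t)=(\gamma(t),\dot\gamma(t))$ is the corresponding integral curve. Lie derivatives of vector fields along $\bar\gamma$ (or over a leaf) are taken with respect to the flow: $(\mathcal{L}_\Gamma Z)(t)=\frac{d}{d\epsilon}\big|_{0}(\Phi_{-\epsilon})_*Z(t+\epsilon)$ with $\Phi$ the flow of $\Gamma$. A Jacobi field along $\gamma$ is a vector field $\zeta=\tau_*Z$ along $\gamma$ where $Z$ is a vector field along $\bar\gamma$ (i.e. $Z(t)\in T_{\bar\gamma(t)}T^\circ M$) with $\mathcal{L}_\Gamma Z=0$; $\zeta\leftrightarrow Z$ is a bijection (equivalently $\nabla^2\zeta^i+R^i_j\zeta^j=0$, with $\nabla$ the dynamical covariant derivative and $R^i_j$ the Jacobi endomorphism of $\Gamma$). $\mathfrak{J}_\gamma$ is the $2n$-dimensional real vector space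 of Jacobi fields along $\gamma$, and $\mathfrak{J}^0_\gamma$ its quotient by the two-dimensional subspace spanned by $\dot\gamma$ and $t\dot\gamma(t)$. The leaf $\mathfrak{L}_\gamma$ consists of the points $\varphi(s,t)=(\gamma(t),e^s\dot\gamma(t))$, $(s,t)\in\mathbb{R}^2$. Given $\zeta\in\mathfrak{J}_\gamma$ with corresponding $Z(t)$ along $\bar\gamma$, there is a unique vector field $Z(s,t)\in T_{\varphi(s,t)}T^\circ M$ over $\mathfrak{L}_\gamma$ (not necessarily tangent to it) with $\mathcal{L}_\Delta Z=\mathcal{L}_\Gamma Z=0$ and $Z(0,t)=Z(t)$ (where $\Delta=\partial/\partial s$ and $\Gamma=e^s\partial/\partial t$ on $\mathfrak{L}_\gamma$); its projection $\pi_*Z$ is a well-defined element of $T_pP_{\mathcal{D}}$. *)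

theory Defs
  imports
    "HOL-Analysis.Analysis"
    "HOL-Library.Function_Algebras"
    "HOL-Library.Set_Algebras"
begin

instantiation "fun" :: (type, real_vector) real_vector
begin

definition scaleR_fun :: "real \<Rightarrow> ('a \<Rightarrow> 'b) \<Rightarrow> 'a \<Rightarrow> 'b"
  where "scaleR_fun r f = (\<lambda>x. r *\<^sub>R f x)"

instance
  by standard (auto simp: scaleR_fun_def fun_eq_iff algebra_simps)

end

definition linear_map_on ::
  "'a::real_vector set \<Rightarrow> 'b::real_vector set \<Rightarrow> ('a \<Rightarrow> 'b) \<Rightarrow> bool"
  where "linear_map_on V W f \<longleftrightarrow>
    subspace V \<and> subspace W \<and> f \<in> V \<rightarrow> W \<and>
    (\<forall>x\<in>V. \<forall>y\<in>V. f (x + y) = f x + f y) \<and>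
    (\<forall>r. \<forall>x\<in>V. f (r *\<^sub>R x) = r *\<^sub>R f x)"

definition coset :: "'a::real_vector set \<Rightarrow> 'a \<Rightarrow> 'a set"
  where "coset K x = {x + k | k. k \<in> K}"

definition quotient_space :: "'a::real_vector set \<Rightarrow> 'a set \<Rightarrow> 'a set set"
  where "quotient_space V K = coset K ` V"

text \<open>
  Addition in the quotient is addition of sets. A scalar multiple is the image under scaling, plus
  \<open>K\<close>; the last summand matters only for the scalar \<open>0\<close>.
\<close>

definition linear_map_on_quotient ::
  "'a::real_vector set \<Rightarrow> 'a set \<Rightarrow> 'b::real_vector set \<Rightarrow> ('a set \<Rightarrow> 'b) \<Rightarrow> bool"
  where "linear_map_on_quotient V K W f \<longleftrightarrow>
    subspace V \<and> subspace K \<and> K \<subseteq> V \<and> subspace W \<and>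
    f \<in> quotient_space V K \<rightarrow> W \<and>
    (\<forall>A\<in>quotient_space V K. \<forall>B\<in>quotient_space V K. f (A + B) = f A + f B) \<and>
    (\<forall>r. \<forall>A\<in>quotient_space V K. f ((\<lambda>x. r *\<^sub>R x) ` A + K) = r *\<^sub>R f A)"

primrec Ck_on ::
  "nat \<Rightarrow> 'a::euclidean_space set \<Rightarrow> ('a \<Rightarrow> 'b::euclidean_space) \<Rightarrow> bool"
  where
    "Ck_on 0 S f \<longleftrightarrow> continuous_on S f"
  | "Ck_on (Suc k) S f \<longleftrightarrow>
      (\<forall>x\<in>S. f differentiable (at x)) \<and>
      (\<forall>v. Ck_on k S (\<lambda>x. frechet_derivative f (at x) v))"

definition smooth_on :: "'a::euclidean_space set \<Rightarrow> ('a \<Rightarrow> 'b::euclidean_space) \<Rightarrow> bool"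
  where "smooth_on S f \<longleftrightarrow> (\<forall>k. Ck_on k S f)"

text \<open>
  A manifold is given by an atlas; the dimension is that of the model space \<open>'e\<close>. The underlying set
  is the union of the chart domains, and the topology is the one determined by the charts. The
  values of a chart map outside the chart domain are irrelevant.
\<close>

datatype ('m, 'e) chart = Chart (chart_dom: "'m set") (chart_map: "'m \<Rightarrow> 'e")

type_synonym ('m, 'e) atlas = "('m, 'e) chart set"

definition chart_inv :: "('m, 'e) chart \<Rightarrow> 'e \<Rightarrow> 'm"
  where "chart_inv \<phi> = inv_into (chart_dom \<phi>) (chart_map \<phi>)"

definition carrier_of :: "('m, 'e) atlas \<Rightarrow> 'm set"
  where "carrier_of A = (\<Union>\<phi>\<in>A. chart_dom \<phi>)"

definition smooth_atlas :: "('m, 'e::euclidean_space) atlas \<Rightarrow> bool"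
  where "smooth_atlas A \<longleftrightarrow>
    (\<forall>\<phi>\<in>A. inj_on (chart_map \<phi>) (chart_dom \<phi>)) \<and>
    (\<forall>\<phi>\<in>A. \<forall>\<psi>\<in>A.
      open (chart_map \<phi> ` (chart_dom \<phi> \<inter> chart_dom \<psi>)) \<and>
      smooth_on (chart_map \<phi> ` (chart_dom \<phi> \<inter> chart_dom \<psi>)) (chart_map \<psi> \<circ> chart_inv \<phi>))"

definition atlas_topology :: "('m, 'e::euclidean_space) atlas \<Rightarrow> 'm topology"
  where "atlas_topology A =
    topology (\<lambda>V. V \<subseteq> carrier_of A \<and> (\<forall>\<phi>\<in>A. open (chart_map \<phi> ` (chart_dom \<phi> \<inter> V))))"

lemma openin_atlas_topology:
  assumes "smooth_atlas A"
  shows "openin (atlas_topology A) V \<longleftrightarrow>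
    V \<subseteq> carrier_of A \<and> (\<forall>\<phi>\<in>A. open (chart_map \<phi> ` (chart_dom \<phi> \<inter> V)))"
proof -
  let ?P = "\<lambda>V. V \<subseteq> carrier_of A \<and> (\<forall>\<phi>\<in>A. open (chart_map \<phi> ` (chart_dom \<phi> \<inter> V)))"
  have "istopology ?P"
    unfolding istopology_def
  proof (intro conjI allI impI)
    fix S T assume S: "?P S" and T: "?P T"
    show "S \<inter> T \<subseteq> carrier_of A"
      using S by blast
    show "\<forall>\<phi>\<in>A. open (chart_map \<phi> ` (chart_dom \<phi> \<inter> (S \<inter> T)))"
    proof
      fix \<phi> assume \<phi>: "\<phi> \<in> A"
      have "inj_on (chart_map \<phi>) (chart_dom \<phi>)"
        using assms \<phi> by (auto simp: smooth_atlas_def)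
      then have "chart_map \<phi> ` (chart_dom \<phi> \<inter> (S \<inter> T)) =
          chart_map \<phi> ` (chart_dom \<phi> \<inter> S) \<inter> chart_map \<phi> ` (chart_dom \<phi> \<inter> T)"
        unfolding inj_on_def by blast
      then show "open (chart_map \<phi> ` (chart_dom \<phi> \<inter> (S \<inter> T)))"
        using S T \<phi> by (simp add: open_Int)
    qed
  next
    fix \<K> assume K: "\<forall>K\<in>\<K>. ?P K"
    then show "\<Union>\<K> \<subseteq> carrier_of A"
      by blast
    show "\<forall>\<phi>\<in>A. open (chart_map \<phi> ` (chart_dom \<phi> \<inter> \<Union>\<K>))"
    proof
      fix \<phi> assume \<phi>: "\<phi> \<in> A"
      have "chart_map \<phi> ` (chart_dom \<phi> \<inter> \<Union>\<K>) = (\<Union>K\<in>\<K>. chart_map \<phi> ` (chart_dom \<phi> \<inter> K))"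
        by blast
      then show "open (chart_map \<phi> ` (chart_dom \<phi> \<inter> \<Union>\<K>))"
        using K \<phi> by auto
    qed
  qed
  then show ?thesis
    unfolding atlas_topology_def by (simp add: topology_inverse')
qed

definition smooth_manifold :: "('m, 'e::euclidean_space) atlas \<Rightarrow> bool"
  where "smooth_manifold A \<longleftrightarrow> smooth_atlas A \<and> Hausdorff_space (atlas_topology A)"

definition paracompact_space :: "'a topology \<Rightarrow> bool"
  where "paracompact_space X \<longleftrightarrow>
    (\<forall>\<U>. (\<forall>U\<in>\<U>. openin X U) \<and> \<Union>\<U> = topspace X \<longrightarrow>
      (\<exists>\<V>. (\<forall>V\<in>\<V>. openin X V) \<and> \<Union>\<V> = topspace X \<and>
        (\<forall>V\<in>\<V>. \<exists>U\<in>\<U>. V \<subseteq> U) \<and> locally_finite_in X \<V>))"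

definition smooth_map ::
  "('m, 'e::euclidean_space) atlas \<Rightarrow> ('n, 'f::euclidean_space) atlas \<Rightarrow> ('m \<Rightarrow> 'n) \<Rightarrow> bool"
  where "smooth_map A B f \<longleftrightarrow>
    continuous_map (atlas_topology A) (atlas_topology B) f \<and>
    (\<forall>\<phi>\<in>A. \<forall>\<psi>\<in>B. smooth_on (chart_map \<phi> ` (chart_dom \<phi> \<inter> f -` chart_dom \<psi>))
      (chart_map \<psi> \<circ> f \<circ> chart_inv \<phi>))"

text \<open>
  A tangent vector at \<open>p\<close> is the family of its coordinate representations in the charts of the
  atlas around \<open>p\<close>, related by the differentials of the transition maps and extended by \<open>0\<close> to all
  other charts.
\<close>

type_synonym ('m, 'e) tangent = "('m, 'e) chart \<Rightarrow> 'e"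

definition tangent_space ::
  "('m, 'e::euclidean_space) atlas \<Rightarrow> 'm \<Rightarrow> ('m, 'e) tangent set"
  where "tangent_space A p = {v.
    (\<forall>\<phi>. \<phi> \<notin> A \<or> p \<notin> chart_dom \<phi> \<longrightarrow> v \<phi> = 0) \<and>
    (\<forall>\<phi>\<in>A. \<forall>\<psi>\<in>A. p \<in> chart_dom \<phi> \<inter> chart_dom \<psi> \<longrightarrow>
      v \<psi> = frechet_derivative (chart_map \<psi> \<circ> chart_inv \<phi>) (at (chart_map \<phi> p)) (v \<phi>))}"

text \<open>\<open>tangent_map A B f p\<close> is the differential of \<open>f\<close> at \<open>p\<close>; any chart around \<open>p\<close> gives the same value.\<close>

definition tangent_map ::
  "('m, 'e::euclidean_space) atlas \<Rightarrow> ('n, 'f::euclidean_space) atlas \<Rightarrow> ('m \<Rightarrow> 'n) \<Rightarrow>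
    'm \<Rightarrow> ('m, 'e) tangent \<Rightarrow> ('n, 'f) tangent"
  where "tangent_map A B f p v = (\<lambda>\<psi>.
    if \<psi> \<in> B \<and> f p \<in> chart_dom \<psi> then
      let \<phi> = (SOME \<phi>. \<phi> \<in> A \<and> p \<in> chart_dom \<phi>)
      in frechet_derivative (chart_map \<psi> \<circ> f \<circ> chart_inv \<phi>) (at (chart_map \<phi> p)) (v \<phi>)
    else 0)"

definition velocity ::
  "('m, 'e::euclidean_space) atlas \<Rightarrow> (real \<Rightarrow> 'm) \<Rightarrow> real \<Rightarrow> ('m, 'e) tangent"
  where "velocity A c t = (\<lambda>\<phi>.
    if \<phi> \<in> A \<and> c t \<in> chart_dom \<phi> then vector_derivative (chart_map \<phi> \<circ> c) (at t) else 0)"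

definition smooth_vector_field ::
  "('m, 'e::euclidean_space) atlas \<Rightarrow> ('m \<Rightarrow> ('m, 'e) tangent) \<Rightarrow> bool"
  where "smooth_vector_field A X \<longleftrightarrow>
    (\<forall>p\<in>carrier_of A. X p \<in> tangent_space A p) \<and>
    (\<forall>\<phi>\<in>A. smooth_on (chart_map \<phi> ` chart_dom \<phi>) (\<lambda>x. X (chart_inv \<phi> x) \<phi>))"

text \<open>In every chart, \<open>[X, Y] = DY(X) - DX(Y)\<close>.\<close>

definition lie_bracket ::
  "('m, 'e::euclidean_space) atlas \<Rightarrow> ('m \<Rightarrow> ('m, 'e) tangent) \<Rightarrow> ('m \<Rightarrow> ('m, 'e) tangent) \<Rightarrow>
    'm \<Rightarrow> ('m, 'e) tangent"
  where "lie_bracket A X Y p = (\<lambda>\<phi>.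
    if \<phi> \<in> A \<and> p \<in> chart_dom \<phi> then
      frechet_derivative (\<lambda>x. Y (chart_inv \<phi> x) \<phi>) (at (chart_map \<phi> p)) (X p \<phi>) -
      frechet_derivative (\<lambda>x. X (chart_inv \<phi> x) \<phi>) (at (chart_map \<phi> p)) (Y p \<phi>)
    else 0)"

definition integral_curve ::
  "('m, 'e::euclidean_space) atlas \<Rightarrow> ('m \<Rightarrow> ('m, 'e) tangent) \<Rightarrow> real set \<Rightarrow> (real \<Rightarrow> 'm) \<Rightarrow> bool"
  where "integral_curve A X I c \<longleftrightarrow>
    open I \<and> is_interval I \<and>
    continuous_map (top_of_set I) (atlas_topology A) c \<and>
    (\<forall>t\<in>I. \<forall>\<phi>\<in>A. c t \<in> chart_dom \<phi> \<longrightarrow>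
      ((chart_map \<phi> \<circ> c) has_vector_derivative X (c t) \<phi>) (at t))"

text \<open>
  The local flow of \<open>X\<close>: \<open>flow A X \<epsilon> x\<close> is meaningful exactly if the maximal integral curve starting
  at \<open>x\<close> is defined at time \<open>\<epsilon>\<close>.
\<close>

definition flow ::
  "('m, 'e::euclidean_space) atlas \<Rightarrow> ('m \<Rightarrow> ('m, 'e) tangent) \<Rightarrow> real \<Rightarrow> 'm \<Rightarrow> 'm"
  where "flow A X \<epsilon> x =
    (THE y. \<exists>I c. integral_curve A X I c \<and> 0 \<in> I \<and> \<epsilon> \<in> I \<and> c 0 = x \<and> c \<epsilon> = y)"

text \<open>
  \<open>Z\<close> is a vector field along the integral curve \<open>c\<close> of \<open>X\<close>, and its Lie derivative at time \<open>t\<close> is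
  the derivative at \<open>\<epsilon> = 0\<close> of the curve \<open>\<epsilon> \<mapsto> (\<Phi>\<^bsub>-\<epsilon>\<^esub>)\<^sub>* Z(t + \<epsilon>)\<close> in the tangent space at \<open>c t\<close>. The
  derivative of that curve is taken in the coordinates of the charts around \<open>c t\<close>.
\<close>

definition has_lie_derivative ::
  "('m, 'e::euclidean_space) atlas \<Rightarrow> ('m \<Rightarrow> ('m, 'e) tangent) \<Rightarrow> (real \<Rightarrow> 'm) \<Rightarrow>
    (real \<Rightarrow> ('m, 'e) tangent) \<Rightarrow> real \<Rightarrow> ('m, 'e) tangent \<Rightarrow> bool"
  where "has_lie_derivative A X c Z t W \<longleftrightarrow>
    W \<in> tangent_space A (c t) \<and>
    (\<forall>\<phi>\<in>A. c t \<in> chart_dom \<phi> \<longrightarrow>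
      ((\<lambda>\<epsilon>. tangent_map A A (flow A X (- \<epsilon>)) (c (t + \<epsilon>)) (Z (t + \<epsilon>)) \<phi>)
        has_vector_derivative W \<phi>) (at 0))"

text \<open>The charts of the slit tangent bundle are the induced coordinates \<open>(x\<^sup>i, y\<^sup>i)\<close>.\<close>

definition slit_chart ::
  "('m, 'e::euclidean_space) atlas \<Rightarrow> ('m, 'e) chart \<Rightarrow> ('m \<times> ('m, 'e) tangent, 'e \<times> 'e) chart"
  where "slit_chart A \<phi> = Chart
    {(p, v). p \<in> chart_dom \<phi> \<and> v \<in> tangent_space A p \<and> v \<noteq> 0}
    (\<lambda>(p, v). (chart_map \<phi> p, v \<phi>))"

definition slit_tangent_bundle ::
  "('m, 'e::euclidean_space) atlas \<Rightarrow> ('m \<times> ('m, 'e) tangent, 'e \<times> 'e) atlas"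
  where "slit_tangent_bundle A = slit_chart A ` A"

type_synonym ('m, 'e) slit_tangent =
  "('m \<times> ('m, 'e) tangent, 'e \<times> 'e) tangent"

text \<open>\<open>\<Delta> = y\<^sup>i \<partial>/\<partial>y\<^sup>i\<close>; in a chart \<open>\<psi>\<close> of the slit tangent bundle, \<open>snd (chart_map \<psi> u)\<close> is \<open>y\<close>.\<close>

definition liouville_field ::
  "('m, 'e::euclidean_space) atlas \<Rightarrow> 'm \<times> ('m, 'e) tangent \<Rightarrow> ('m, 'e) slit_tangent"
  where "liouville_field A u = (\<lambda>\<psi>.
    if \<psi> \<in> slit_tangent_bundle A \<and> u \<in> chart_dom \<psi> then (0, snd (chart_map \<psi> u)) else 0)"

text \<open>
  The third condition is the coordinate form \<open>\<Gamma> = y\<^sup>i \<partial>/\<partial>x\<^sup>i - 2\<Gamma>\<^sup>i \<partial>/\<partial>y\<^sup>i\<close>; the fourth is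
  \<open>[\<Delta>, \<Gamma>] = \<Gamma>\<close>.
\<close>

definition spray ::
  "('m, 'e::euclidean_space) atlas \<Rightarrow> ('m \<times> ('m, 'e) tangent \<Rightarrow> ('m, 'e) slit_tangent) \<Rightarrow> bool"
  where "spray A \<Gamma> \<longleftrightarrow>
    smooth_vector_field (slit_tangent_bundle A) \<Gamma> \<and>
    (\<forall>\<psi>\<in>slit_tangent_bundle A. \<forall>u\<in>chart_dom \<psi>. fst (\<Gamma> u \<psi>) = snd (chart_map \<psi> u)) \<and>
    (\<forall>u\<in>carrier_of (slit_tangent_bundle A).
      lie_bracket (slit_tangent_bundle A) (liouville_field A) \<Gamma> u = \<Gamma> u)"

definition spray_distribution ::
  "('m, 'e::euclidean_space) atlas \<Rightarrow> ('m \<times> ('m, 'e) tangent \<Rightarrow> ('m, 'e) slit_tangent) \<Rightarrow>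
    'm \<times> ('m, 'e) tangent \<Rightarrow> ('m, 'e) slit_tangent set"
  where "spray_distribution A \<Gamma> u = span {liouville_field A u, \<Gamma> u}"

text \<open>
  Connected immersed integral manifolds of a distribution of rank two. The manifold structure \<open>B\<close>
  carries its own topology, in general finer than the subspace topology.
\<close>

definition connected_integral_manifold ::
  "('m, 'e::euclidean_space) atlas \<Rightarrow> ('m \<Rightarrow> ('m, 'e) tangent set) \<Rightarrow>
    ('m, real \<times> real) atlas \<Rightarrow> bool"
  where "connected_integral_manifold A D B \<longleftrightarrow>
    smooth_manifold B \<and> carrier_of B \<noteq> {} \<and> connected_space (atlas_topology B) \<and>
    smooth_map B A (\<lambda>u. u) \<and>
    (\<forall>u\<in>carrier_of B.
      bij_betw (tangent_map B A (\<lambda>u. u) u) (tangent_space B u) (D u))"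

definition leaf ::
  "('m, 'e::euclidean_space) atlas \<Rightarrow> ('m \<Rightarrow> ('m, 'e) tangent set) \<Rightarrow> 'm set \<Rightarrow> bool"
  where "leaf A D L \<longleftrightarrow>
    (\<exists>B. connected_integral_manifold A D B \<and> carrier_of B = L) \<and>
    (\<forall>B. connected_integral_manifold A D B \<and> L \<subseteq> carrier_of B \<longrightarrow> carrier_of B = L)"

definition path_space ::
  "('m, 'e::euclidean_space) atlas \<Rightarrow> ('m \<times> ('m, 'e) tangent \<Rightarrow> ('m, 'e) slit_tangent) \<Rightarrow>
    ('p, 'q::euclidean_space) atlas \<Rightarrow> ('m \<times> ('m, 'e) tangent \<Rightarrow> 'p) \<Rightarrow> bool"
  where "path_space A \<Gamma> P \<pi> \<longleftrightarrow>
    smooth_manifold P \<and> DIM('q) = 2 * DIM('e) - 2 \<and>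
    smooth_map (slit_tangent_bundle A) P \<pi> \<and>
    \<pi> ` carrier_of (slit_tangent_bundle A) = carrier_of P \<and>
    (\<forall>u\<in>carrier_of (slit_tangent_bundle A).
      tangent_map (slit_tangent_bundle A) P \<pi> u ` tangent_space (slit_tangent_bundle A) u
        = tangent_space P (\<pi> u)) \<and>
    {{u \<in> carrier_of (slit_tangent_bundle A). \<pi> u = q} | q. q \<in> carrier_of P}
      = {L. leaf (slit_tangent_bundle A) (spray_distribution A \<Gamma>) L}"

definition geodesic ::
  "('m, 'e::euclidean_space) atlas \<Rightarrow> ('m \<times> ('m, 'e) tangent \<Rightarrow> ('m, 'e) slit_tangent) \<Rightarrow>
    (real \<Rightarrow> 'm) \<Rightarrow> bool"
  where "geodesic A \<Gamma> \<gamma> \<longleftrightarrow>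
    (\<exists>c. integral_curve (slit_tangent_bundle A) \<Gamma> UNIV c \<and> \<gamma> = fst \<circ> c)"

definition natural_lift ::
  "('m, 'e::euclidean_space) atlas \<Rightarrow> (real \<Rightarrow> 'm) \<Rightarrow> real \<Rightarrow> 'm \<times> ('m, 'e) tangent"
  where "natural_lift A \<gamma> t = (\<gamma> t, velocity A \<gamma> t)"

definition lie_transported ::
  "('m, 'e::euclidean_space) atlas \<Rightarrow> ('m \<times> ('m, 'e) tangent \<Rightarrow> ('m, 'e) slit_tangent) \<Rightarrow>
    (real \<Rightarrow> 'm) \<Rightarrow> (real \<Rightarrow> ('m, 'e) slit_tangent) \<Rightarrow> bool"
  where "lie_transported A \<Gamma> \<gamma> Z \<longleftrightarrow>
    (\<forall>t. Z t \<in> tangent_space (slit_tangent_bundle A) (natural_lift A \<gamma> t)) \<and>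
    (\<forall>t. has_lie_derivative (slit_tangent_bundle A) \<Gamma> (natural_lift A \<gamma>) Z t 0)"

definition base_projection ::
  "('m, 'e::euclidean_space) atlas \<Rightarrow> (real \<Rightarrow> 'm) \<Rightarrow> (real \<Rightarrow> ('m, 'e) slit_tangent) \<Rightarrow>
    real \<Rightarrow> ('m, 'e) tangent"
  where "base_projection A \<gamma> Z =
    (\<lambda>t. tangent_map (slit_tangent_bundle A) A fst (natural_lift A \<gamma> t) (Z t))"

definition jacobi_fields ::
  "('m, 'e::euclidean_space) atlas \<Rightarrow> ('m \<times> ('m, 'e) tangent \<Rightarrow> ('m, 'e) slit_tangent) \<Rightarrow>
    (real \<Rightarrow> 'm) \<Rightarrow> (real \<Rightarrow> ('m, 'e) tangent) set"
  where "jacobi_fields A \<Gamma> \<gamma> = {base_projection A \<gamma> Z | Z. lie_transported A \<Gamma> \<gamma> Z}"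

definition tangential_jacobi_fields ::
  "('m, 'e::euclidean_space) atlas \<Rightarrow> (real \<Rightarrow> 'm) \<Rightarrow> (real \<Rightarrow> ('m, 'e) tangent) set"
  where "tangential_jacobi_fields A \<gamma> =
    span {velocity A \<gamma>, \<lambda>t. t *\<^sub>R velocity A \<gamma> t}"

definition leaf_point ::
  "('m, 'e::euclidean_space) atlas \<Rightarrow> (real \<Rightarrow> 'm) \<Rightarrow> real \<Rightarrow> real \<Rightarrow> 'm \<times> ('m, 'e) tangent"
  where "leaf_point A \<gamma> s t = (\<gamma> t, exp s *\<^sub>R velocity A \<gamma> t)"

text \<open>
  In the parameters \<open>(s, t)\<close> of the leaf, \<open>\<Delta> = \<partial>/\<partial>s\<close> and \<open>\<Gamma> = e\<^sup>s \<partial>/\<partial>t\<close>. Hence the integral curves of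
  \<open>\<Delta>\<close> on the leaf are the curves of constant \<open>t\<close>, and those of \<open>\<Gamma>\<close> are the curves of constant \<open>s\<close>
  with \<open>t = e\<^sup>s \<tau>\<close>, where \<open>\<tau>\<close> is the parameter of the integral curve. The field \<open>Y\<close> depends on the
  parameters and not only on the point of the leaf, since the parametrization need not be injective.
\<close>

definition leaf_extension ::
  "('m, 'e::euclidean_space) atlas \<Rightarrow> ('m \<times> ('m, 'e) tangent \<Rightarrow> ('m, 'e) slit_tangent) \<Rightarrow>
    (real \<Rightarrow> 'm) \<Rightarrow> (real \<Rightarrow> ('m, 'e) slit_tangent) \<Rightarrow>
    (real \<Rightarrow> real \<Rightarrow> ('m, 'e) slit_tangent) \<Rightarrow> bool"
  where "leaf_extension A \<Gamma> \<gamma> Z Y \<longleftrightarrow>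
    (\<forall>s t. Y s t \<in> tangent_space (slit_tangent_bundle A) (leaf_point A \<gamma> s t)) \<and>
    (\<forall>s t. has_lie_derivative (slit_tangent_bundle A) (liouville_field A)
      (\<lambda>\<sigma>. leaf_point A \<gamma> \<sigma> t) (\<lambda>\<sigma>. Y \<sigma> t) s 0) \<and>
    (\<forall>s \<tau>. has_lie_derivative (slit_tangent_bundle A) \<Gamma>
      (\<lambda>\<tau>. leaf_point A \<gamma> s (exp s * \<tau>)) (\<lambda>\<tau>. Y s (exp s * \<tau>)) \<tau> 0) \<and>
    (\<forall>t. Y 0 t = Z t)"

definition jacobi_to_path_space ::
  "('m, 'e::euclidean_space) atlas \<Rightarrow> ('m \<times> ('m, 'e) tangent \<Rightarrow> ('m, 'e) slit_tangent) \<Rightarrow>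
    ('p, 'q::euclidean_space) atlas \<Rightarrow> ('m \<times> ('m, 'e) tangent \<Rightarrow> 'p) \<Rightarrow>
    (real \<Rightarrow> 'm) \<Rightarrow> (real \<Rightarrow> ('m, 'e) tangent) \<Rightarrow> ('p, 'q) tangent"
  where "jacobi_to_path_space A \<Gamma> P \<pi> \<gamma> \<zeta> =
    (THE w. \<exists>Z Y. lie_transported A \<Gamma> \<gamma> Z \<and> base_projection A \<gamma> Z = \<zeta> \<and>
      leaf_extension A \<Gamma> \<gamma> Z Y \<and>
      (\<forall>s t. tangent_map (slit_tangent_bundle A) P \<pi> (leaf_point A \<gamma> s t) (Y s t) = w))"

end

theory Submission
  imports Defs
begin

text \<open>
  In a chart, the condition \<open>\<L>\<^sub>\<Gamma> Z = 0\<close> is the linearization of the equation of the integral curves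
  of \<open>\<Gamma>\<close>, because the differential \<open>W\<close> of the local flow with respect to the initial point solves the
  linearized equation. So \<open>Z\<close> exists globally and is determined by \<open>Z(0)\<close>; since \<open>\<Gamma> = y\<^sup>i \<partial>/\<partial>x\<^sup>i + \<dots>\<close>,
  the fibre part of \<open>Z\<close> is the time derivative of its base part, and \<open>Z\<close> is determined by its Jacobi
  field. The fibres of \<open>\<pi>\<close> are leaves, so \<open>\<pi>\<close> is a first integral of \<open>\<Gamma>\<close> and of \<open>\<Delta>\<close>, and \<open>\<pi>\<^sub>* Z\<close> is constant
  on the leaf. Hence \<open>j(\<zeta>) = \<pi>\<^sub>* Z(0)\<close>. It is onto because \<open>\<pi>\<close> is a submersion, and by
  counting dimensions its kernel is given by \<open>Z(0) \<in> span {\<Delta>, \<Gamma>}\<close>, that is by the span of the transported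
  fields \<open>\<Gamma>\<close> and \<open>\<Delta> + t\<Gamma>\<close>, whose Jacobi fields are the velocity and \<open>t\<close> times the velocity.
\<close>

subsection \<open>Local flows in Euclidean space\<close>

text \<open>The Lie derivative is defined by differentiating the local flow in its initial point, so
  it turns into a linear equation only once the flow is known to be differentiable there, with a
  formula for the derivative. Hence the quantitative flow boxes: time is so short that errors are
  absorbed, and a locally Lipschitz derivative makes the remainder of the flow quadratic. The
  linearized equation refers to a chart. Its invariance is drawn from the Lie derivative itself: the
  pulled-back vectors lie in one fixed tangent space, where a change of chart is a fixed linear map.
  No second derivatives of transition maps of the slit tangent bundle enter. On the leaf everything
  rests on dilations, the flow of \<Delta>. The bracket condition integrates to homogeneity, so
  dilations map integral curves of \<Gamma> to integral curves up to a rescaling of time, and their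
  differentials extend a transported field over the leaf. The field \<Delta> alone is not
  transported because [\<Gamma>, \<Delta>] = -\<Gamma>; the summand t\<Gamma> repairs this and
  vanishes at t = 0, which is why the initial values to be matched are just \<Delta> and
  \<Gamma>.\<close>

lemma has_vector_derivative_bound:
  fixes u :: "real \<Rightarrow> 'a::real_normed_vector"
  assumes "\<And>t. t \<in> {p..q} \<Longrightarrow> (u has_vector_derivative u' t) (at t within {p..q})"
    and "\<And>t. t \<in> {p..q} \<Longrightarrow> norm (u' t) \<le> B"
    and "s \<in> {p..q}" "t \<in> {p..q}"
  shows "norm (u t - u s) \<le> B * \<bar>t - s\<bar>"
proof -
  have "onorm (\<lambda>h. h *\<^sub>R u' x) \<le> B" if "x \<in> {p..q}" for x
    using mult_right_mono[OF assms(2)[OF that] abs_ge_zero] by (intro onorm_le) (simp add: mult.commute)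
  then have "norm (u t - u s) \<le> B * norm (t - s)"
    using assms by (intro differentiable_bound[where S = "{p..q}" and f' = "\<lambda>x h. h *\<^sub>R u' x"])
      (auto simp: has_vector_derivative_def)
  then show ?thesis by simp
qed

text \<open>Gronwall's inequality without exponentials: where \<open>norm (u t)\<close> is maximal,
  the mean value inequality bounds it by its value at \<open>s\<close>, the inhomogeneity and half
  of itself, which is absorbed. The base time \<open>s\<close> may lie anywhere in the interval, so
  the estimate also runs backwards in time.\<close>

lemma short_time_gronwall:
  fixes u :: "real \<Rightarrow> 'a::real_normed_vector"
  assumes der: "\<And>t. t \<in> {p..q} \<Longrightarrow> (u has_vector_derivative u' t) (at t within {p..q})"
    and bound: "\<And>t. t \<in> {p..q} \<Longrightarrow> norm (u' t) \<le> L * norm (u t) + e"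
    and "0 \<le> L" "0 \<le> e" "(q - p) * L \<le> 1 / 2"
    and s: "s \<in> {p..q}" and t: "t \<in> {p..q}"
  shows "norm (u t) \<le> 2 * (norm (u s) + (q - p) * e)"
proof -
  have "continuous_on {p..q} u"
    using der by (rule continuous_on_vector_derivative)
  then have "continuous_on {p..q} (\<lambda>t. norm (u t))"
    by (intro continuous_intros)
  then obtain m where m: "m \<in> {p..q}" and max: "\<And>t. t \<in> {p..q} \<Longrightarrow> norm (u t) \<le> norm (u m)"
    using continuous_attains_sup[of "{p..q}" "\<lambda>t. norm (u t)"] s by (auto simp: ex_in_conv)
  have "norm (u' t) \<le> L * norm (u m) + e" if "t \<in> {p..q}" for t
    using bound[OF that] max[OF that] \<open>0 \<le> L\<close> by (smt (verit) mult_left_mono)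
  then have "norm (u m - u s) \<le> (L * norm (u m) + e) * \<bar>m - s\<bar>"
    using has_vector_derivative_bound[OF der _ s m] by blast
  also have "\<dots> \<le> (L * norm (u m) + e) * (q - p)"
    using s m assms(3,4) by (intro mult_left_mono) auto
  also have "\<dots> = ((q - p) * L) * norm (u m) + (q - p) * e"
    by (simp add: algebra_simps)
  also have "\<dots> \<le> 1 / 2 * norm (u m) + (q - p) * e"
    using assms(5) by (intro add_right_mono mult_right_mono) auto
  finally have "norm (u m - u s) \<le> 1 / 2 * norm (u m) + (q - p) * e" .
  moreover have "norm (u m) \<le> norm (u s) + norm (u m - u s)"
    by (metis add.commute diff_add_cancel norm_triangle_ineq)
  ultimately show ?thesis using max[OF t] by argo
qed

text \<open>The contraction principle for the integral operator. The interval is two-sided because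
  the pullback in a Lie derivative runs against the flow.\<close>

theorem picard_lindeloef:
  fixes f :: "'a::euclidean_space \<Rightarrow> 'a"
  assumes lip: "\<And>y z. y \<in> cball x r \<Longrightarrow> z \<in> cball x r \<Longrightarrow> norm (f y - f z) \<le> L * norm (y - z)"
    and bound: "\<And>y. y \<in> cball x r \<Longrightarrow> norm (f y) \<le> B"
    and "0 \<le> L" "0 \<le> B" "0 \<le> r" "0 < a" "a * B \<le> r" "a * L \<le> 1 / 2"
  obtains u where "u 0 = x"
    and "\<And>t. t \<in> {-a..a} \<Longrightarrow> u t \<in> cball x r"
    and "\<And>t. t \<in> {-a..a} \<Longrightarrow> (u has_vector_derivative f (u t)) (at t within {-a..a})"
proof -
  \<comment> \<open>Clamping the time makes every iterate a bounded continuous function on the whole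
    line, so the contraction acts in the complete space
    \<open>real \<Rightarrow>\<^sub>C 'a\<close>.\<close>
  define cl where "cl t = max (-a) (min a t)" for t :: real
  have cl: "cl t \<in> {-a..a}" for t
    using \<open>0 < a\<close> by (auto simp: cl_def)
  have cl_id: "cl t = t" if "t \<in> {-a..a}" for t
    using that by (auto simp: cl_def)
  have fcont: "continuous_on (cball x r) f"
    by (rule lipschitz_on_continuous_on[of L], rule lipschitz_onI)
      (use lip \<open>0 \<le> L\<close> in \<open>auto simp: dist_norm\<close>)
  define S :: "(real \<Rightarrow>\<^sub>C 'a) set" where "S = PiC UNIV (\<lambda>_. cball x r)"
  have S_iff: "v \<in> S \<longleftrightarrow> (\<forall>t. apply_bcontfun v t \<in> cball x r)" for v
    by (auto simp: S_def mem_PiC_iff)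
  \<comment> \<open>The integral starts at \<open>-a\<close>, so that \<open>H v t - H v 0\<close>
    is the oriented integral from 0 for negative \<open>t\<close> as well.\<close>
  define H where "H v t = integral {-a..t} (\<lambda>s. f (apply_bcontfun v s))" for v :: "real \<Rightarrow>\<^sub>C 'a" and t
  have Hder: "(H v has_vector_derivative f (apply_bcontfun v t)) (at t within {-a..a})"
    if "v \<in> S" "t \<in> {-a..a}" for v t
  proof -
    have "continuous_on {-a..a} (\<lambda>s. f (apply_bcontfun v s))"
      using that(1) by (intro continuous_on_compose2[OF fcont]) (auto simp: S_iff)
    then show ?thesis
      unfolding H_def by (rule integral_has_vector_derivative) (use that in auto)
  qed
  define G where "G v t = x + (H v (cl t) - H v 0)" for v t
  have G_in: "G v t \<in> cball x r" if "v \<in> S" for v t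
  proof -
    have "norm (H v (cl t) - H v 0) \<le> B * \<bar>cl t - 0\<bar>"
      using that cl \<open>0 < a\<close>
      by (intro has_vector_derivative_bound[OF Hder[OF that]]) (auto simp: S_iff intro!: bound)
    also have "\<dots> \<le> B * a"
      using cl[of t] \<open>0 \<le> B\<close> by (intro mult_left_mono) auto
    finally have "norm (H v (cl t) - H v 0) \<le> r" using \<open>a * B \<le> r\<close> by (simp add: mult.commute)
    then show ?thesis by (simp add: G_def dist_norm norm_minus_commute)
  qed
  have G_cont: "continuous_on UNIV (G v)" if "v \<in> S" for v
  proof -
    have "continuous_on {-a..a} (H v)"
      using Hder[OF that] by (rule continuous_on_vector_derivative)
    moreover have "continuous_on UNIV cl"
      unfolding cl_def by (intro continuous_intros)
    ultimately have "continuous_on UNIV (\<lambda>t. H v (cl t))"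
      by (rule continuous_on_compose2) (use cl in auto)
    then show ?thesis
      unfolding G_def by (intro continuous_intros)
  qed
  have G_bc: "G v \<in> bcontfun" if "v \<in> S" for v
  proof -
    have "range (G v) \<subseteq> cball x r" using G_in[OF that] by blast
    then have "bounded (range (G v))" by (rule bounded_subset[OF bounded_cball])
    with G_cont[OF that] show ?thesis by (simp add: bcontfun_def)
  qed
  define T where "T v = Bcontfun (G v)" for v
  have T: "apply_bcontfun (T v) = G v" if "v \<in> S" for v
    using G_bc[OF that] by (simp add: T_def Bcontfun_inverse)
  have "\<exists>!v. v \<in> S \<and> T v = v"
  proof (rule Banach_fix[where c = "1 / 2"])
    show "complete S"
      unfolding S_def by (simp add: complete_eq_closed closed_PiC)
    have "const_bcontfun x \<in> S" using \<open>0 \<le> r\<close> by (simp add: S_iff const_bcontfun.rep_eq)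
    then show "S \<noteq> {}" by blast
    show "T ` S \<subseteq> S" using T G_in by (auto simp: S_iff)
    fix v w assume vw: "v \<in> S" "w \<in> S"
    show "dist (T v) (T w) \<le> 1 / 2 * dist v w"
    proof (rule dist_bound)
      fix t
      have "norm ((H v (cl t) - H w (cl t)) - (H v 0 - H w 0)) \<le> (L * dist v w) * \<bar>cl t - 0\<bar>"
      proof (rule has_vector_derivative_bound[where p = "-a" and q = a])
        show "((\<lambda>t. H v t - H w t) has_vector_derivative f (apply_bcontfun v t) - f (apply_bcontfun w t))
            (at t within {-a..a})" if "t \<in> {-a..a}" for t
          using Hder vw that by (intro derivative_intros) auto
        show "norm (f (apply_bcontfun v t) - f (apply_bcontfun w t)) \<le> L * dist v w" for t
        proof -
          have "norm (f (apply_bcontfun v t) - f (apply_bcontfun w t))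
              \<le> L * norm (apply_bcontfun v t - apply_bcontfun w t)"
            using vw by (intro lip) (auto simp: S_iff)
          also have "\<dots> \<le> L * dist v w"
            using \<open>0 \<le> L\<close> dist_bounded[of v t w] by (intro mult_left_mono) (auto simp: dist_norm)
          finally show ?thesis .
        qed
      qed (use cl \<open>0 < a\<close> in auto)
      also have "\<dots> \<le> (L * dist v w) * a"
        using cl[of t] \<open>0 \<le> L\<close> by (intro mult_left_mono) auto
      also have "\<dots> = (a * L) * dist v w" by simp
      also have "\<dots> \<le> 1 / 2 * dist v w" using assms(8) by (intro mult_right_mono) auto
      finally show "dist (apply_bcontfun (T v) t) (apply_bcontfun (T w) t) \<le> 1 / 2 * dist v w"
        using vw by (simp add: T G_def dist_norm algebra_simps)
    qed
  qed auto
  then obtain v where v: "v \<in> S" "T v = v" by blast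
  have eq: "apply_bcontfun v t = x + (H v (cl t) - H v 0)" for t
    using T[OF v(1)] v(2) by (simp add: G_def)
  show ?thesis
  proof
    show "apply_bcontfun v 0 = x" using eq[of 0] \<open>0 < a\<close> by (simp add: cl_id)
    show "apply_bcontfun v t \<in> cball x r" for t using v(1) S_iff by blast
    fix t assume t: "t \<in> {-a..a}"
    have "((\<lambda>t. x + (H v t - H v 0)) has_vector_derivative f (apply_bcontfun v t)) (at t within {-a..a})"
      using Hder[OF v(1) t] by (auto intro!: derivative_eq_intros)
    then show "(apply_bcontfun v has_vector_derivative f (apply_bcontfun v t)) (at t within {-a..a})"
      by (rule has_vector_derivative_transform[OF t, rotated]) (simp add: eq cl_id)
  qed
qed

section \<open>Flow boxes: solutions, linearization and dependence on the initial value\<close>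

text \<open>The bounds on \<open>a\<close> make the Picard map of the equation together with its linearization a
  contraction, and allow \<open>short_time_gronwall\<close> on \<open>{-a..a}\<close>.\<close>

locale flow_box =
  fixes f :: "'a::euclidean_space \<Rightarrow> 'a" and f' :: "'a \<Rightarrow> 'a \<Rightarrow> 'a"
    and x0 :: 'a and r a L N B :: real
  assumes r_pos: "0 < r" and a_pos: "0 < a" and L_nonneg: "0 \<le> L" and N_nonneg: "0 \<le> N" and B_nonneg: "0 \<le> B"
    and f_deriv: "\<And>x. x \<in> cball x0 (2 * r) \<Longrightarrow> (f has_derivative f' x) (at x)"
    and f_bound: "\<And>x. x \<in> cball x0 (2 * r) \<Longrightarrow> norm (f x) \<le> B"
    and f'_bound: "\<And>x w. x \<in> cball x0 (2 * r) \<Longrightarrow> norm (f' x w) \<le> L * norm w"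
    and f'_lipschitz: "\<And>x y w. x \<in> cball x0 (2 * r) \<Longrightarrow> y \<in> cball x0 (2 * r) \<Longrightarrow>
      norm (f' x w - f' y w) \<le> N * norm (x - y) * norm w"
    and a_le: "a * (B + 2 * L) \<le> r" "a * (B + 2 * L) \<le> 1" "a * (L + N) \<le> 1 / 4"
begin

lemma a_L: "2 * a * L \<le> 1 / 2"
proof -
  have "a * L \<le> a * (L + N)"
    using a_pos N_nonneg by (intro mult_left_mono) auto
  then show ?thesis using a_le(3) by linarith
qed

lemma f'_linear: "x \<in> cball x0 (2 * r) \<Longrightarrow> linear (f' x)"
  using f_deriv has_derivative_linear by blast

lemma f_lipschitz:
  assumes "x \<in> cball x0 (2 * r)" "y \<in> cball x0 (2 * r)"
  shows "norm (f x - f y) \<le> L * norm (x - y)"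
proof (rule differentiable_bound[OF convex_cball _ _ assms])
  fix x assume x: "x \<in> cball x0 (2 * r)"
  show "(f has_derivative f' x) (at x within cball x0 (2 * r))"
    using f_deriv[OF x] has_derivative_at_withinI by blast
  show "onorm (f' x) \<le> L"
    using f'_bound[OF x] by (rule onorm_le)
qed

text \<open>On the segment from \<open>x\<close> to \<open>y\<close> the derivative deviates from
  \<open>f' x\<close> by at most \<open>N * norm (y - x)\<close>. This quadratic remainder is the
  source term in \<open>u_linearization\<close>.\<close>

lemma taylor_bound:
  assumes x: "x \<in> cball x0 (2 * r)" and y: "y \<in> cball x0 (2 * r)"
  shows "norm (f y - f x - f' x (y - x)) \<le> N * (norm (y - x))\<^sup>2"
proof -
  let ?S = "closed_segment x y"
  have S: "?S \<subseteq> cball x0 (2 * r)"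
    using x y by (intro closed_segment_subset convex_cball)
  have "norm (f y - f x - f' x (y - x)) \<le> norm (y - x) * (N * norm (y - x))"
  proof (rule differentiable_bound_linearization[where S = ?S and f = f and f' = f' and ?x0.0 = x])
    show "x + t *\<^sub>R (y - x) \<in> ?S" if "t \<in> {0..1}" for t
      using that unfolding closed_segment_def by (auto intro!: exI[of _ t] simp: algebra_simps)
    show "(f has_derivative f' z) (at z within ?S)" if "z \<in> ?S" for z
      using f_deriv S that has_derivative_at_withinI by blast
    show "onorm (f' z - f' x) \<le> N * norm (y - x)" if "z \<in> ?S" for z
    proof (rule onorm_le)
      fix w
      have "norm (f' z w - f' x w) \<le> N * norm (z - x) * norm w"
        using S that x by (intro f'_lipschitz) auto
      also have "\<dots> \<le> N * norm (y - x) * norm w"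
        using that segment_bound(1)[of z x y] N_nonneg
        by (intro mult_right_mono mult_left_mono) auto
      finally show "norm ((f' z - f' x) w) \<le> N * norm (y - x) * norm w" by simp
    qed
  qed simp
  then show ?thesis by (simp add: power2_eq_square algebra_simps)
qed

text \<open>Gronwall for the difference of two solutions, without inhomogeneity. It gives Lipschitz
  dependence on the initial value, and uniqueness when the right-hand side vanishes.\<close>

lemma solution_dependence:
  assumes "\<And>t. t \<in> {p..q} \<Longrightarrow> (y has_vector_derivative f (y t)) (at t within {p..q})"
    and "\<And>t. t \<in> {p..q} \<Longrightarrow> (z has_vector_derivative f (z t)) (at t within {p..q})"
    and "\<And>t. t \<in> {p..q} \<Longrightarrow> y t \<in> cball x0 (2 * r)"
    and "\<And>t. t \<in> {p..q} \<Longrightarrow> z t \<in> cball x0 (2 * r)"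
    and "q - p \<le> 2 * a" "s \<in> {p..q}" "t \<in> {p..q}"
  shows "norm (y t - z t) \<le> 2 * norm (y s - z s)"
proof -
  have "norm (y t - z t) \<le> 2 * (norm (y s - z s) + (q - p) * 0)"
  proof (rule short_time_gronwall[where L = L and u' = "\<lambda>t. f (y t) - f (z t)"])
    show "(q - p) * L \<le> 1 / 2"
      using assms(5) L_nonneg a_L by (smt (verit) mult_right_mono)
    show "((\<lambda>t. y t - z t) has_vector_derivative f (y t) - f (z t)) (at t within {p..q})"
      if "t \<in> {p..q}" for t
      using assms(1,2) that by (intro derivative_intros)
    show "norm (f (y t) - f (z t)) \<le> L * norm (y t - z t) + 0" if "t \<in> {p..q}" for t
      using f_lipschitz assms(3,4) that by simp
  qed (use L_nonneg assms(6,7) in auto)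
  then show ?thesis by simp
qed

lemma linearized_solution_bound:
  assumes "\<And>t. t \<in> {p..q} \<Longrightarrow> (v has_vector_derivative f' (y t) (v t)) (at t within {p..q})"
    and "\<And>t. t \<in> {p..q} \<Longrightarrow> y t \<in> cball x0 (2 * r)"
    and "q - p \<le> 2 * a" "s \<in> {p..q}" "t \<in> {p..q}"
  shows "norm (v t) \<le> 2 * norm (v s)"
proof -
  have "norm (v t) \<le> 2 * (norm (v s) + (q - p) * 0)"
  proof (rule short_time_gronwall[where L = L, OF assms(1)])
    show "(q - p) * L \<le> 1 / 2"
      using assms(3) L_nonneg a_L by (smt (verit) mult_right_mono)
    show "norm (f' (y t) (v t)) \<le> L * norm (v t) + 0" if "t \<in> {p..q}" for t
      using f'_bound assms(2) that by simp
  qed (use L_nonneg assms(4,5) in auto)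
  then show ?thesis by simp
qed

lemma linearized_solution_unique:
  assumes "\<And>t. t \<in> {p..q} \<Longrightarrow> (v has_vector_derivative f' (y t) (v t)) (at t within {p..q})"
    and "\<And>t. t \<in> {p..q} \<Longrightarrow> (w has_vector_derivative f' (y t) (w t)) (at t within {p..q})"
    and "\<And>t. t \<in> {p..q} \<Longrightarrow> y t \<in> cball x0 (2 * r)"
    and "q - p \<le> 2 * a" "s \<in> {p..q}" "t \<in> {p..q}" "v s = w s"
  shows "v t = w t"
proof -
  have "norm (v t - w t) \<le> 2 * norm (v s - w s)"
  proof (rule linearized_solution_bound[where v = "\<lambda>t. v t - w t", OF _ assms(3-6)])
    show "((\<lambda>t. v t - w t) has_vector_derivative f' (y t) (v t - w t)) (at t within {p..q})"
      if "t \<in> {p..q}" for t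
      using assms(1)[OF that] assms(2)[OF that] linear_diff[OF f'_linear[OF assms(3)[OF that]]]
      by (auto intro: derivative_eq_intros)
  qed
  with assms(7) show ?thesis by simp
qed

text \<open>Derivatives in the initial value are obtained by solving the system that consists of the
  equation and its linearization.\<close>

lemma extended_solution_exists:
  assumes x: "x \<in> cball x0 r" and w: "norm w \<le> 1"
  obtains y v where "y 0 = x" "v 0 = w"
    and "\<And>t. t \<in> {-a..a} \<Longrightarrow> y t \<in> cball x0 (2 * r)"
    and "\<And>t. t \<in> {-a..a} \<Longrightarrow> (y has_vector_derivative f (y t)) (at t within {-a..a})"
    and "\<And>t. t \<in> {-a..a} \<Longrightarrow> (v has_vector_derivative f' (y t) (v t)) (at t within {-a..a})"
proof -
  \<comment> \<open>Radius at most \<open>r\<close> keeps the first component in the ball where the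
    bounds hold; radius at most 1 keeps the second component at norm at most 2, the origin of the
    factor 2 in \<open>a_le\<close>.\<close>
  define \<rho> where "\<rho> = min r 1"
  define F where "F = (\<lambda>(x, w). (f x, f' x w))"
  have box: "fst p \<in> cball x0 (2 * r) \<and> norm (snd p) \<le> 2" if "p \<in> cball (x, w) \<rho>" for p
  proof -
    have "dist x (fst p) \<le> dist (x, w) p" "dist w (snd p) \<le> dist (x, w) p"
      by (metis dist_fst_le fst_conv, metis dist_snd_le snd_conv)
    then have d: "dist x (fst p) \<le> r" "dist w (snd p) \<le> 1"
      using that by (auto simp: \<rho>_def)
    have "dist x0 (fst p) \<le> dist x0 x + dist x (fst p)" by (rule dist_triangle)
    moreover have "norm (snd p) \<le> norm w + dist w (snd p)"
      by (metis dist_norm norm_minus_commute norm_triangle_sub)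
    ultimately show ?thesis using d x w by auto
  qed
  obtain U where U: "U 0 = (x, w)" "\<And>t. t \<in> {-a..a} \<Longrightarrow> U t \<in> cball (x, w) \<rho>"
    "\<And>t. t \<in> {-a..a} \<Longrightarrow> (U has_vector_derivative F (U t)) (at t within {-a..a})"
  \<comment> \<open>The component \<open>f\<close> contributes the Lipschitz constant
    \<open>L\<close>, and the linearization contributes \<open>L + 2 * N\<close> on vectors of norm
    at most 2. By \<open>a_le\<close> the product of the sum with \<open>a\<close> is at most
    1/2.\<close>
  proof (rule picard_lindeloef[where f = F and x = "(x, w)" and r = \<rho> and L = "2 * (L + N)" and B = "B + 2 * L" and a = a])
    fix p q assume p: "p \<in> cball (x, w) \<rho>" and q: "q \<in> cball (x, w) \<rho>"
    obtain p1 p2 q1 q2 where pq: "p = (p1, p2)" "q = (q1, q2)" by fastforce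
    have bp: "p1 \<in> cball x0 (2 * r)" "norm p2 \<le> 2" and bq: "q1 \<in> cball x0 (2 * r)" "norm q2 \<le> 2"
      using box[OF p] box[OF q] by (auto simp: pq)
    have n1: "norm (p1 - q1) \<le> norm (p - q)" and n2: "norm (p2 - q2) \<le> norm (p - q)"
      using norm_fst_le[of "p1 - q1" "p2 - q2"] norm_snd_le[of "p2 - q2" "p1 - q1"] by (auto simp: pq)
    have "norm (f' p1 p2 - f' q1 q2) \<le> norm (f' p1 p2 - f' p1 q2) + norm (f' p1 q2 - f' q1 q2)"
      by (metis add_diff_cancel_right' diff_add_cancel group_cancel.add1 norm_triangle_ineq add_diff_eq)
    also have "f' p1 p2 - f' p1 q2 = f' p1 (p2 - q2)"
      using f'_linear[OF bp(1)] by (simp add: linear_diff)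
    also have "norm (f' p1 (p2 - q2)) + norm (f' p1 q2 - f' q1 q2) \<le> L * norm (p2 - q2) + N * norm (p1 - q1) * norm q2"
      using f'_bound f'_lipschitz bp bq by (intro add_mono) auto
    also have "\<dots> \<le> L * norm (p - q) + N * norm (p - q) * 2"
      using n1 n2 bq L_nonneg N_nonneg by (intro add_mono mult_mono) auto
    finally have "norm (f' p1 p2 - f' q1 q2) \<le> L * norm (p - q) + N * norm (p - q) * 2" .
    moreover have "norm (f p1 - f q1) \<le> L * norm (p - q)"
      using f_lipschitz[OF bp(1) bq(1)] n1 L_nonneg by (smt (verit) mult_left_mono)
    moreover have "norm (F p - F q) \<le> norm (f p1 - f q1) + norm (f' p1 p2 - f' q1 q2)"
      by (simp add: F_def pq norm_Pair_le)
    ultimately show "norm (F p - F q) \<le> 2 * (L + N) * norm (p - q)"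
      by (simp add: algebra_simps)
  next
    fix p assume p: "p \<in> cball (x, w) \<rho>"
    have "norm (F p) \<le> norm (f (fst p)) + norm (f' (fst p) (snd p))"
      by (simp add: F_def case_prod_beta norm_Pair_le)
    also have "\<dots> \<le> B + L * norm (snd p)"
      using box[OF p] f_bound f'_bound by (intro add_mono) auto
    also have "\<dots> \<le> B + L * 2"
      using box[OF p] L_nonneg by (intro add_left_mono mult_left_mono) auto
    finally show "norm (F p) \<le> B + 2 * L" by simp
  qed (use L_nonneg N_nonneg B_nonneg a_pos r_pos a_le in \<open>auto simp: \<rho>_def algebra_simps\<close>)
  have fst_der: "((\<lambda>t. fst (U t)) has_vector_derivative f (fst (U t))) (at t within {-a..a})"
    and snd_der: "((\<lambda>t. snd (U t)) has_vector_derivative f' (fst (U t)) (snd (U t))) (at t within {-a..a})"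
    if "t \<in> {-a..a}" for t
    using bounded_linear.has_vector_derivative[OF bounded_linear_fst U(3)[OF that]]
      bounded_linear.has_vector_derivative[OF bounded_linear_snd U(3)[OF that]]
    by (simp_all add: F_def case_prod_beta)
  show thesis
    by (rule that[of "\<lambda>t. fst (U t)" "\<lambda>t. snd (U t)"]) (use U(1) box[OF U(2)] fst_der snd_der in auto)
qed

text \<open>The local flow. Solutions start in the ball of radius \<open>r\<close> and stay in the
  ball of radius \<open>2 * r\<close>, on which all bounds of the locale hold.\<close>

definition u :: "'a \<Rightarrow> real \<Rightarrow> 'a" where
  "u x = (SOME y. y 0 = x \<and> (\<forall>t\<in>{-a..a}. y t \<in> cball x0 (2 * r) \<and>
    (y has_vector_derivative f (y t)) (at t within {-a..a})))"

lemma u: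
  assumes "x \<in> cball x0 r"
  shows u_0: "u x 0 = x"
    and u_in: "t \<in> {-a..a} \<Longrightarrow> u x t \<in> cball x0 (2 * r)"
    and u_deriv: "t \<in> {-a..a} \<Longrightarrow> (u x has_vector_derivative f (u x t)) (at t within {-a..a})"
proof -
  have "\<exists>y. y 0 = x \<and> (\<forall>t\<in>{-a..a}. y t \<in> cball x0 (2 * r) \<and>
      (y has_vector_derivative f (y t)) (at t within {-a..a}))"
    by (rule extended_solution_exists[OF assms, of 0]) auto
  from someI_ex[OF this, folded u_def]
  show "u x 0 = x" "t \<in> {-a..a} \<Longrightarrow> u x t \<in> cball x0 (2 * r)"
    "t \<in> {-a..a} \<Longrightarrow> (u x has_vector_derivative f (u x t)) (at t within {-a..a})"
    by auto
qed

lemma u_dependence: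
  assumes "x \<in> cball x0 r" "y \<in> cball x0 r" "t \<in> {-a..a}"
  shows "norm (u y t - u x t) \<le> 2 * norm (y - x)"
  using solution_dependence[of "-a" a "u y" "u x" 0 t] u[OF assms(1)] u[OF assms(2)] assms(3) a_pos
  by simp

text \<open>Compares a solution with the time-shifted flow line through its value at
  \<open>s\<close>. For \<open>s\<close> other than 0 this is a form of the group law, from which
  \<open>u_inverse\<close> follows.\<close>

lemma u_unique:
  assumes "\<And>t. t \<in> {p..q} \<Longrightarrow> (y has_vector_derivative f (y t)) (at t within {p..q})"
    and "\<And>t. t \<in> {p..q} \<Longrightarrow> y t \<in> cball x0 (2 * r)"
    and "y s \<in> cball x0 r" "s \<in> {p..q}" "t \<in> {p..q}"
    and "s - a \<le> p" "q \<le> s + a"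
  shows "y t = u (y s) (t - s)"
proof -
  have d: "((\<lambda>t. u (y s) (t - s)) has_vector_derivative f (u (y s) (t - s))) (at t within {p..q})"
    if "t \<in> {p..q}" for t
  proof -
    have "(\<lambda>t. t - s) ` {p..q} \<subseteq> {-a..a}" using assms(6,7) by auto
    then have "(u (y s) has_vector_derivative f (u (y s) (t - s))) (at (t - s) within (\<lambda>t. t - s) ` {p..q})"
      using u_deriv[OF assms(3), of "t - s"] that has_vector_derivative_within_subset by fastforce
    moreover have "((\<lambda>t. t - s) has_vector_derivative 1) (at t within {p..q})"
      by (auto intro!: derivative_eq_intros)
    ultimately show ?thesis
      using vector_diff_chain_within[of "\<lambda>t. t - s" 1 t "{p..q}" "u (y s)"] by (simp add: o_def)
  qed
  have "norm (y t - u (y s) (t - s)) \<le> 2 * norm (y s - u (y s) (s - s))"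
    by (rule solution_dependence[OF assms(1) d assms(2)])
      (use assms u_in[OF assms(3)] in auto)
  then show ?thesis using u_0[OF assms(3)] by simp
qed

lemma u_inverse:
  assumes x: "x \<in> cball x0 r" and t: "t \<in> {-a..a}" and y: "u x t \<in> cball x0 r"
  shows "u (u x t) (- t) = x"
proof -
  \<comment> \<open>Only the interval between 0 and \<open>t\<close> is used:
    \<open>u_unique\<close> asks for times within \<open>a\<close> of the base time, which is now
    \<open>t\<close>.\<close>
  define p q where "p = min 0 t" and "q = max 0 t"
  have sub: "{p..q} \<subseteq> {-a..a}" using t a_pos by (auto simp: p_def q_def)
  have "u x 0 = u (u x t) (0 - t)"
  proof (rule u_unique[where p = p and q = q])
    show "(u x has_vector_derivative f (u x s)) (at s within {p..q})" if "s \<in> {p..q}" for s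
      using u_deriv[OF x] sub that has_vector_derivative_within_subset by (metis subsetD)
    show "u x s \<in> cball x0 (2 * r)" if "s \<in> {p..q}" for s
      using u_in[OF x] sub that by blast
  qed (use y t in \<open>auto simp: p_def q_def\<close>)
  then show ?thesis using u_0[OF x] by simp
qed

text \<open>The resolvent of the linearized equation along \<open>u x\<close>; by
  \<open>u_has_derivative\<close> it is the derivative of the flow in the initial value.\<close>

definition W :: "'a \<Rightarrow> real \<Rightarrow> 'a \<Rightarrow> 'a" where
  "W x t w = (SOME v. v 0 = w \<and>
    (\<forall>t\<in>{-a..a}. (v has_vector_derivative f' (u x t) (v t)) (at t within {-a..a}))) t"

lemma W:
  assumes x: "x \<in> cball x0 r"
  shows W_0: "W x 0 w = w"
    and W_deriv: "t \<in> {-a..a} \<Longrightarrow>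
      ((\<lambda>t. W x t w) has_vector_derivative f' (u x t) (W x t w)) (at t within {-a..a})"
proof -
  \<comment> \<open>Solutions are available for initial vectors of norm at most 1, so
    \<open>w\<close> is scaled down and the solution scaled up again; the summand 1 covers
    \<open>w = 0\<close>.\<close>
  define c where "c = norm w + 1"
  have c: "c > 0" by (simp add: c_def add_nonneg_pos)
  have "norm ((1 / c) *\<^sub>R w) \<le> 1"
    using c by (simp add: c_def)
  from extended_solution_exists[OF x this] obtain y v where yv: "y 0 = x" "v 0 = (1 / c) *\<^sub>R w"
    "\<And>t. t \<in> {-a..a} \<Longrightarrow> y t \<in> cball x0 (2 * r)"
    "\<And>t. t \<in> {-a..a} \<Longrightarrow> (y has_vector_derivative f (y t)) (at t within {-a..a})"
    "\<And>t. t \<in> {-a..a} \<Longrightarrow> (v has_vector_derivative f' (y t) (v t)) (at t within {-a..a})"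
    by blast
  have y: "y t = u x t" if "t \<in> {-a..a}" for t
    using u_unique[of "-a" a y 0 t] yv(1,3,4) that x a_pos by auto
  have "((\<lambda>t. c *\<^sub>R v t) has_vector_derivative f' (u x t) (c *\<^sub>R v t)) (at t within {-a..a})"
    if t: "t \<in> {-a..a}" for t
    using bounded_linear.has_vector_derivative[OF bounded_linear_scaleR_right yv(5)[OF t], of c]
      linear_scale[OF f'_linear[OF u_in[OF x t]]] y[OF t] by simp
  then have "\<exists>v. v 0 = w \<and> (\<forall>t\<in>{-a..a}. (v has_vector_derivative f' (u x t) (v t)) (at t within {-a..a}))"
    using yv(2) c by (intro exI[of _ "\<lambda>t. c *\<^sub>R v t"]) auto
  from someI_ex[OF this, folded W_def]
  show "W x 0 w = w"
    "t \<in> {-a..a} \<Longrightarrow> ((\<lambda>t. W x t w) has_vector_derivative f' (u x t) (W x t w)) (at t within {-a..a})"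
    unfolding W_def by auto
qed

lemma W_bound:
  assumes "x \<in> cball x0 r" "t \<in> {-a..a}"
  shows "norm (W x t w) \<le> 2 * norm w"
  using linearized_solution_bound[of "-a" a "\<lambda>t. W x t w" "u x" 0 t] W[OF assms(1)] u_in[OF assms(1)] assms(2) a_pos
  by simp

lemma W_unique:
  assumes "x \<in> cball x0 r"
    and "\<And>t. t \<in> {-a..a} \<Longrightarrow> (v has_vector_derivative f' (u x t) (v t)) (at t within {-a..a})"
    and "t \<in> {-a..a}"
  shows "v t = W x t (v 0)"
  using linearized_solution_unique[of "-a" a v "u x" "\<lambda>t. W x t (v 0)" 0 t]
    W[OF assms(1)] u_in[OF assms(1)] assms(2,3) a_pos by simp

text \<open>\<open>SOME\<close> chooses a solution for each \<open>w\<close> separately, so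
  linearity has to come from uniqueness: both sides solve the linearized equation with the same
  initial value.\<close>

lemma W_linear:
  assumes x: "x \<in> cball x0 r" and t: "t \<in> {-a..a}"
  shows "bounded_linear (W x t)"
proof (rule bounded_linear_intro)
  fix v w and c :: real
  have "((\<lambda>t. W x t v + W x t w) has_vector_derivative f' (u x s) (W x s v + W x s w)) (at s within {-a..a})"
    if "s \<in> {-a..a}" for s
    using W_deriv[OF x that] linear_add[OF f'_linear[OF u_in[OF x that]]] by (auto intro!: derivative_eq_intros)
  from W_unique[OF x this t] show "W x t (v + w) = W x t v + W x t w" by (simp add: W_0[OF x])
  have "((\<lambda>t. c *\<^sub>R W x t w) has_vector_derivative f' (u x s) (c *\<^sub>R W x s w)) (at s within {-a..a})"
    if "s \<in> {-a..a}" for s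
    using bounded_linear.has_vector_derivative[OF bounded_linear_scaleR_right W_deriv[OF x that], of c]
      linear_scale[OF f'_linear[OF u_in[OF x that]]] by simp
  from W_unique[OF x this t] show "W x t (c *\<^sub>R w) = c *\<^sub>R W x t w" by (simp add: W_0[OF x])
  show "norm (W x t w) \<le> norm w * 2" using W_bound[OF x t, of w] by simp
qed

text \<open>The error vanishes at time 0 and solves the linearized equation up to the Taylor
  remainder, which \<open>u_dependence\<close> bounds by
  \<open>4 * N * (norm (y - x))\<^sup>2\<close>. Gronwall on an interval of length
  \<open>2 * a\<close> multiplies this by \<open>4 * a\<close>.\<close>

lemma u_linearization:
  assumes x: "x \<in> cball x0 r" and y: "y \<in> cball x0 r" and t: "t \<in> {-a..a}"
  shows "norm (u y t - u x t - W x t (y - x)) \<le> 16 * a * N * (norm (y - x))\<^sup>2"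
proof -
  let ?e = "4 * N * (norm (y - x))\<^sup>2"
  let ?d = "\<lambda>t. f (u y t) - f (u x t) - f' (u x t) (W x t (y - x))"
  have "norm (u y t - u x t - W x t (y - x)) \<le> 2 * (norm (u y 0 - u x 0 - W x 0 (y - x)) + (a - - a) * ?e)"
  proof (rule short_time_gronwall[where L = L and u' = ?d])
    fix s assume s: "s \<in> {-a..a}"
    show "((\<lambda>t. u y t - u x t - W x t (y - x)) has_vector_derivative ?d s) (at s within {-a..a})"
      using s u_deriv[OF x] u_deriv[OF y] W_deriv[OF x] by (intro derivative_intros) auto
    have "?d s = (f (u y s) - f (u x s) - f' (u x s) (u y s - u x s)) + f' (u x s) (u y s - u x s - W x s (y - x))"
      using linear_diff[OF f'_linear[OF u_in[OF x s]]] by simp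
    then have "norm (?d s) \<le> norm (f (u y s) - f (u x s) - f' (u x s) (u y s - u x s))
        + norm (f' (u x s) (u y s - u x s - W x s (y - x)))"
      by (metis norm_triangle_ineq)
    also have "\<dots> \<le> N * (norm (u y s - u x s))\<^sup>2 + L * norm (u y s - u x s - W x s (y - x))"
      using u_in[OF x s] u_in[OF y s] by (intro add_mono taylor_bound f'_bound)
    also have "(norm (u y s - u x s))\<^sup>2 \<le> (2 * norm (y - x))\<^sup>2"
      using u_dependence[OF x y s] by (intro power_mono) auto
    finally show "norm (?d s) \<le> L * norm (u y s - u x s - W x s (y - x)) + ?e"
      using N_nonneg by (simp add: power_mult_distrib mult_left_mono)
  qed (use L_nonneg N_nonneg a_L a_pos t in \<open>auto simp: algebra_simps\<close>)
  then show ?thesis using u_0[OF x] u_0[OF y] W_0[OF x] by (simp add: algebra_simps)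
qed

lemma u_has_derivative:
  assumes x: "x \<in> ball x0 r" and t: "t \<in> {-a..a}"
  shows "((\<lambda>x. u x t) has_derivative W x t) (at x)"
proof -
  from x obtain e where e: "e > 0" "ball x e \<subseteq> ball x0 r"
    using open_ball open_contains_ball by blast
  have xc: "x \<in> cball x0 r" using x by simp
  show ?thesis
  proof (rule has_derivativeI_sandwich[where H = "\<lambda>y. 16 * a * N * norm (y - x)", OF e(1) W_linear[OF xc t]])
    fix y assume y: "y \<noteq> x" "dist y x < e"
    then have yc: "y \<in> cball x0 r" using e(2) by (auto simp: dist_commute subset_iff)
    show "norm ((u y t - u x t) - W x t (y - x)) / norm (y - x) \<le> 16 * a * N * norm (y - x)"
      using u_linearization[OF xc yc t] y(1) by (simp add: divide_simps power2_eq_square)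
  next
    show "((\<lambda>y. 16 * a * N * norm (y - x)) \<longlongrightarrow> 0) (at x)"
      by (auto intro!: tendsto_eq_intros)
  qed
qed

end

section \<open>Fields with locally Lipschitz derivative and existence of flow boxes\<close>

text \<open>The bound is uniform in the direction \<open>w\<close>: it is local Lipschitz continuity
  of the derivative in operator norm.\<close>

definition C11_on :: "'a::euclidean_space set \<Rightarrow> ('a \<Rightarrow> 'a) \<Rightarrow> ('a \<Rightarrow> 'a \<Rightarrow> 'a) \<Rightarrow> bool" where
  "C11_on S f f' \<longleftrightarrow>
    (\<forall>x\<in>S. (f has_derivative f' x) (at x)) \<and>
    (\<forall>x\<in>S. \<exists>e>0. \<exists>N\<ge>0. cball x e \<subseteq> S \<and>
      (\<forall>y\<in>cball x e. \<forall>z\<in>cball x e. \<forall>w. norm (f' y w - f' z w) \<le> N * norm (y - z) * norm w))"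

lemma flow_box_exists:
  assumes C11: "C11_on S f f'" and U: "open U" "U \<subseteq> S" "x0 \<in> U"
  obtains r a L N B where "flow_box f f' x0 r a L N B" "cball x0 (2 * r) \<subseteq> U"
proof -
  obtain e N where e: "e > 0" "N \<ge> 0" and N: "\<And>y z w. y \<in> cball x0 e \<Longrightarrow> z \<in> cball x0 e \<Longrightarrow>
      norm (f' y w - f' z w) \<le> N * norm (y - z) * norm w"
    using C11 U(2,3) unfolding C11_on_def by (metis subsetD)
  obtain e' where e': "e' > 0" "cball x0 e' \<subseteq> U"
    using U open_contains_cball by blast
  define r where "r = min e e' / 2"
  have r: "r > 0" "2 * r \<le> e" "2 * r \<le> e'" using e e' by (auto simp: r_def)
  have sub: "cball x0 (2 * r) \<subseteq> cball x0 e" "cball x0 (2 * r) \<subseteq> U"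
    using r e'(2) by (auto simp: subset_iff)
  have der: "(f has_derivative f' x) (at x)" if "x \<in> cball x0 (2 * r)" for x
    using C11 sub U(2) that unfolding C11_on_def by blast
  \<comment> \<open>The norm of the derivative at the centre plus its possible variation over the
    ball of radius \<open>2 * r\<close>.\<close>
  define L where "L = onorm (f' x0) + N * (2 * r)"
  have bl: "bounded_linear (f' x0)"
    using der[of x0] r has_derivative_bounded_linear by (metis centre_in_cball less_imp_le mult_pos_pos zero_less_numeral)
  have L: "0 \<le> L" using onorm_pos_le[OF bl] e r by (simp add: L_def)
  have f': "norm (f' x w) \<le> L * norm w" if x: "x \<in> cball x0 (2 * r)" for x w
  proof -
    have "norm (f' x w) \<le> norm (f' x0 w) + norm (f' x w - f' x0 w)"
      by (metis add.commute diff_add_cancel norm_triangle_ineq)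
    also have "\<dots> \<le> onorm (f' x0) * norm w + N * norm (x - x0) * norm w"
      using x sub r e by (intro add_mono onorm[OF bl] N) auto
    also have "\<dots> \<le> onorm (f' x0) * norm w + N * (2 * r) * norm w"
      using x e by (intro add_left_mono mult_right_mono mult_left_mono) (auto simp: dist_norm norm_minus_commute)
    finally show ?thesis by (simp add: L_def algebra_simps)
  qed
  have "continuous_on (cball x0 (2 * r)) f"
    using der by (meson continuous_at_imp_continuous_on has_derivative_continuous)
  then have "bounded (f ` cball x0 (2 * r))"
    by (intro compact_imp_bounded compact_continuous_image compact_cball)
  then obtain B where B: "0 < B" "\<And>x. x \<in> cball x0 (2 * r) \<Longrightarrow> norm (f x) \<le> B"
    unfolding bounded_pos by blast
  \<comment> \<open>One denominator dominates all quantities to be controlled, so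
    \<open>a * D = min r 1\<close> yields every condition in \<open>a_le\<close>; the factor 4
    produces the bound 1/4.\<close>
  define D where "D = B + 2 * L + 4 * (L + N) + 1"
  define a where "a = min r 1 / D"
  have D: "D > 0" "B + 2 * L \<le> D" "4 * (L + N) \<le> D" using B L e by (auto simp: D_def)
  have a: "a > 0" "a * D = min r 1" using r D by (auto simp: a_def)
  have aB: "a * (B + 2 * L) \<le> min r 1"
    using D(2) a by (metis less_imp_le mult_left_mono)
  have "a * (4 * (L + N)) \<le> min r 1"
    using D(3) a by (metis less_imp_le mult_left_mono)
  then have "a * (L + N) \<le> 1 / 4" by (simp add: algebra_simps)
  then have "flow_box f f' x0 r a L N B"
    using r a L e B aB der f' N sub by unfold_locales auto
  then show ?thesis using sub(2) that by blast
qed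

lemma linear_norm_le_sum_Basis:
  fixes h :: "'a::euclidean_space \<Rightarrow> 'b::real_normed_vector"
  assumes "linear h"
  shows "norm (h v) \<le> (\<Sum>b\<in>Basis. norm (h b)) * norm v"
proof -
  have "h v = (\<Sum>b\<in>Basis. (v \<bullet> b) *\<^sub>R h b)"
    using linear_sum[OF assms, of "\<lambda>b. (v \<bullet> b) *\<^sub>R b" Basis] linear_scale[OF assms]
    by (simp add: euclidean_representation)
  also have "norm \<dots> \<le> (\<Sum>b\<in>Basis. norm (h b) * norm v)"
    by (intro sum_norm_le) (simp add: Basis_le_norm mult_right_mono mult.commute[of "norm (h _)"])
  finally show ?thesis by (simp add: sum_distrib_right)
qed

text \<open>\<open>Ck_on\<close> gives continuity of the second derivative only for fixed pairs of
  directions. Compactness of a ball bounds it for each pair, and summation over pairs of basis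
  vectors gives a Lipschitz constant in operator norm.\<close>

lemma C11_on_if_Ck_on_2:
  fixes f :: "'a::euclidean_space \<Rightarrow> 'a"
  assumes S: "open S" and f: "Ck_on (Suc (Suc 0)) S f"
  shows "C11_on S f (\<lambda>x. frechet_derivative f (at x))"
proof -
  let ?f' = "\<lambda>x. frechet_derivative f (at x)"
  let ?g' = "\<lambda>b x. frechet_derivative (\<lambda>x. ?f' x b) (at x)"
  have df: "(f has_derivative ?f' x) (at x)" if "x \<in> S" for x
    using f that frechet_derivative_works by auto
  have dg: "((\<lambda>x. ?f' x b) has_derivative ?g' b x) (at x)" if "x \<in> S" for x b
    using f that frechet_derivative_works[of "\<lambda>x. ?f' x b"] by auto
  have cg: "continuous_on S (\<lambda>x. ?g' b x v)" for b v
    using f by auto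
  have "\<exists>N\<ge>0. \<forall>y\<in>cball x e. \<forall>z\<in>cball x e. \<forall>w. norm (?f' y w - ?f' z w) \<le> N * norm (y - z) * norm w"
    if sub: "cball x e \<subseteq> S" for x e
  proof -
    have "bounded ((\<lambda>x. ?g' b x v) ` cball x e)" for b v
      using continuous_on_subset[OF cg sub]
      by (intro compact_imp_bounded compact_continuous_image compact_cball)
    then have "\<exists>K>0. \<forall>y\<in>cball x e. norm (?g' b y v) \<le> K" for b v
      unfolding bounded_pos by blast
    then obtain K where K: "\<And>b v. K b v > 0" "\<And>b v y. y \<in> cball x e \<Longrightarrow> norm (?g' b y v) \<le> K b v"
      by metis
    define N where "N = (\<Sum>b\<in>(Basis :: 'a set). \<Sum>v\<in>(Basis :: 'a set). K b v)"
    have lip: "norm (?f' y b - ?f' z b) \<le> (\<Sum>v\<in>Basis. K b v) * norm (y - z)"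
      if yz: "y \<in> cball x e" "z \<in> cball x e" for b y z
    proof (rule differentiable_bound[OF convex_cball _ _ yz])
      fix p assume p: "p \<in> cball x e"
      show "((\<lambda>x. ?f' x b) has_derivative ?g' b p) (at p within cball x e)"
        using dg p sub has_derivative_at_withinI by blast
      have "linear (?g' b p)"
        using dg p sub has_derivative_linear by blast
      then have "norm (?g' b p v) \<le> (\<Sum>v\<in>Basis. norm (?g' b p v)) * norm v" for v
        by (rule linear_norm_le_sum_Basis)
      also have "\<dots> v \<le> (\<Sum>v\<in>Basis. K b v) * norm v" for v
        using K(2) p by (intro mult_right_mono sum_mono) auto
      finally show "onorm (?g' b p) \<le> (\<Sum>v\<in>Basis. K b v)"
        by (rule onorm_le)
    qed
    have "norm (?f' y w - ?f' z w) \<le> N * norm (y - z) * norm w"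
      if yz: "y \<in> cball x e" "z \<in> cball x e" for y z w
    proof -
      have "linear (\<lambda>w. ?f' y w - ?f' z w)"
        using df yz sub has_derivative_linear by (intro linear_compose_sub) blast+
      then have "norm (?f' y w - ?f' z w) \<le> (\<Sum>b\<in>Basis. norm (?f' y b - ?f' z b)) * norm w"
        by (rule linear_norm_le_sum_Basis)
      also have "\<dots> \<le> (\<Sum>b\<in>Basis. (\<Sum>v\<in>Basis. K b v) * norm (y - z)) * norm w"
        using lip[OF yz] by (intro mult_right_mono sum_mono) auto
      finally show ?thesis by (simp add: N_def sum_distrib_right)
    qed
    moreover have "N \<ge> 0"
      unfolding N_def using K(1) less_imp_le by (intro sum_nonneg) blast
    ultimately show ?thesis by blast
  qed
  then show ?thesis
    unfolding C11_on_def using df S open_contains_cball by metis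
qed

section \<open>Pullbacks and first integrals in a flow box\<close>

text \<open>Carries o(s - t) over from \<open>g\<close> to \<open>h\<close>. When two curves
  dominate each other, their conditions of vanishing derivative are equivalent.\<close>

lemma has_vector_derivative_zero_dominated:
  fixes g :: "real \<Rightarrow> 'a::real_normed_vector" and h :: "real \<Rightarrow> 'b::real_normed_vector"
  assumes g: "(g has_vector_derivative 0) (at t)"
    and bound: "\<forall>\<^sub>F s in nhds t. norm (h s - h t) \<le> K * norm (g s - g t)"
  shows "(h has_vector_derivative 0) (at t)"
proof -
  have lim: "((\<lambda>s. norm (g s - g t) / \<bar>s - t\<bar>) \<longlongrightarrow> 0) (at t)"
    using g by (simp add: has_vector_derivative_def has_derivative_iff_norm)
  have "\<forall>\<^sub>F s in at t. norm (h s - h t) \<le> K * norm (g s - g t)"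
    using bound by (simp add: eventually_at_filter eventually_mono)
  then have "\<forall>\<^sub>F s in at t. norm (norm (h s - h t) / \<bar>s - t\<bar>) \<le> K * (norm (g s - g t) / \<bar>s - t\<bar>)"
    by (rule eventually_mono) (simp add: divide_right_mono)
  from Lim_null_comparison[OF this] tendsto_mult_right_zero[OF lim, of K]
  show ?thesis
    by (simp add: has_vector_derivative_def has_derivative_iff_norm)
qed

context flow_box
begin

lemma u_continuous_0: "((\<lambda>t. u x t) \<longlongrightarrow> x) (nhds 0)" if "x \<in> cball x0 r"
proof -
  have "(u x has_vector_derivative f (u x 0)) (at 0 within {-a..a})"
    using u_deriv[OF that, of 0] a_pos by simp
  then have "(u x has_vector_derivative f (u x 0)) (at 0)"
    using a_pos by (simp add: at_within_Icc_at)
  then have "isCont (u x) 0" by (rule has_vector_derivative_continuous)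
  then show ?thesis by (simp add: u_0[OF that] continuous_at tendsto_nhds_iff)
qed

lemma u_eventually_in_ball:
  assumes "x \<in> ball x0 r"
  shows "\<forall>\<^sub>F t in nhds 0. t \<in> {-a<..<a} \<and> u x t \<in> ball x0 r"
proof -
  have "\<forall>\<^sub>F t in nhds 0. u x t \<in> ball x0 r"
    using u_continuous_0[of x] assms topological_tendstoD[of "u x" x "nhds 0" "ball x0 r"] by auto
  moreover have "\<forall>\<^sub>F t in nhds (0::real). t \<in> {-a<..<a}"
    using a_pos by (intro eventually_nhds_in_open) auto
  ultimately show ?thesis by eventually_elim simp
qed

text \<open>The chain rule for \<open>u (u x t) (- t) = x\<close>. This identity can be
  differentiated because it holds on a neighbourhood of \<open>x\<close>, by continuity of the flow
  in the initial value.\<close>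

lemma W_inverse:
  assumes x: "x \<in> ball x0 r" and t: "t \<in> {-a..a}" and y: "u x t \<in> ball x0 r"
  shows "W (u x t) (- t) (W x t w) = w"
proof -
  have cont: "isCont (\<lambda>x. u x t) x"
    using u_has_derivative[OF x t] by (rule has_derivative_continuous)
  then have "((\<lambda>x. u x t) \<longlongrightarrow> u x t) (nhds x)"
    by (simp add: continuous_at tendsto_nhds_iff)
  then have "\<forall>\<^sub>F z in nhds x. u z t \<in> ball x0 r"
    using y by (intro topological_tendstoD) auto
  then have "\<forall>\<^sub>F z in nhds x. z \<in> ball x0 r \<and> u z t \<in> ball x0 r"
    using eventually_nhds_in_open[OF open_ball x] by eventually_elim simp
  then obtain S where S: "open S" "x \<in> S" "\<And>z. z \<in> S \<Longrightarrow> z \<in> ball x0 r \<and> u z t \<in> ball x0 r"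
    unfolding eventually_nhds by blast
  have "((\<lambda>y. u y (- t)) \<circ> (\<lambda>x. u x t) has_derivative W (u x t) (- t) \<circ> W x t) (at x)"
    using u_has_derivative[OF x t] u_has_derivative[OF y, of "- t"] t by (intro diff_chain_at) auto
  moreover have "((\<lambda>y. u y (- t)) \<circ> (\<lambda>x. u x t) has_derivative (\<lambda>w. w)) (at x)"
  proof (rule has_derivative_transform_within_open[OF has_derivative_ident S(1,2)])
    show "z = ((\<lambda>y. u y (- t)) \<circ> (\<lambda>x. u x t)) z" if "z \<in> S" for z
      using u_inverse[of z t] S(3)[OF that] t by simp
  qed
  ultimately have "W (u x t) (- t) \<circ> W x t = (\<lambda>w. w)"
    by (rule has_derivative_unique)
  then show ?thesis by (metis comp_apply)
qed

lemma W_inverse':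
  assumes x: "x \<in> ball x0 r" and t: "t \<in> {-a..a}" and y: "u x t \<in> ball x0 r"
  shows "W x t (W (u x t) (- t) w) = w"
  using W_inverse[of "u x t" "- t" w] u_inverse[of x t] assms by simp

text \<open>Both conditions say that \<open>z \<epsilon>\<close> differs from \<open>W x \<epsilon> (z 0)\<close> by \<open>o(\<epsilon>)\<close>.\<close>

lemma pullback_derivative_zero_iff:
  assumes x: "x \<in> ball x0 r"
  shows "((\<lambda>t. W (u x t) (- t) (z t)) has_vector_derivative 0) (at 0) \<longleftrightarrow>
    (z has_vector_derivative f' x (z 0)) (at 0)"
proof -
  have xc: "x \<in> cball x0 r" using x by simp
  define g where "g t = W (u x t) (- t) (z t)" for t
  define d where "d t = z t - W x t (z 0)" for t
  have g0: "g 0 = z 0" and d0: "d 0 = 0" by (simp_all add: g_def d_def u_0[OF xc] W_0[OF xc])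
  \<comment> \<open>Here \<open>d t = W x t (g t - z 0)\<close>, and both this map and its inverse
    have norm at most 2, so \<open>d\<close> and \<open>g - z 0\<close> are of the same
    order.\<close>
  have ev: "\<forall>\<^sub>F t in nhds 0. norm (d t) \<le> 2 * norm (g t - z 0) \<and> norm (g t - z 0) \<le> 2 * norm (d t)"
    using u_eventually_in_ball[OF x]
  proof eventually_elim
    case (elim t)
    then have t: "t \<in> {-a..a}" "- t \<in> {-a..a}" and y: "u x t \<in> ball x0 r" "u x t \<in> cball x0 r" by auto
    have "d t = W x t (g t) - W x t (z 0)"
      using W_inverse'[OF x t(1) y(1)] by (simp add: d_def g_def)
    also have "\<dots> = W x t (g t - z 0)"
      using bounded_linear.linear[OF W_linear[OF xc t(1)]] by (simp add: linear_diff)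
    finally have 1: "d t = W x t (g t - z 0)" .
    have "g t - z 0 = W (u x t) (- t) (d t)"
      using W_inverse[OF x t(1) y(1)] unfolding 1 by simp
    then show ?case
      using 1 W_bound[OF xc t(1)] W_bound[OF y(2) t(2)] by metis
  qed
  have "((\<lambda>t. W x t (z 0)) has_vector_derivative f' x (z 0)) (at 0)"
    using W_deriv[OF xc, of 0 "z 0"] a_pos by (simp add: at_within_Icc_at W_0[OF xc] u_0[OF xc])
  then have "(z has_vector_derivative f' x (z 0)) (at 0) \<longleftrightarrow> (d has_vector_derivative 0) (at 0)"
    using has_vector_derivative_diff[of z "f' x (z 0)" "at 0" "\<lambda>t. W x t (z 0)" "f' x (z 0)"]
      has_vector_derivative_add[of d 0 "at 0" "\<lambda>t. W x t (z 0)" "f' x (z 0)"]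
    by (auto simp: d_def[abs_def])
  also have "\<dots> \<longleftrightarrow> (g has_vector_derivative 0) (at 0)"
    using has_vector_derivative_zero_dominated[of g 0 d 2] has_vector_derivative_zero_dominated[of d 0 g 2] ev
    by (auto simp: g0 d0 eventually_conj_iff)
  finally show ?thesis by (auto simp: g_def[abs_def])
qed

lemma first_integral:
  assumes F: "\<And>x. x \<in> cball x0 (2 * r) \<Longrightarrow> (F has_derivative F' x) (at x)"
    and zero: "\<And>x. x \<in> cball x0 (2 * r) \<Longrightarrow> F' x (f x) = 0"
    and x: "x \<in> cball x0 r" and t: "t \<in> {-a..a}"
  shows "F (u x t) = F x"
proof -
  have "norm (F (u x t) - F (u x 0)) \<le> 0 * \<bar>t - 0\<bar>"
  proof (rule has_vector_derivative_bound[where p = "-a" and q = a and u = "\<lambda>t. F (u x t)" and u' = "\<lambda>_. 0"])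
    fix s assume s: "s \<in> {-a..a}"
    have "(F has_derivative F' (u x s)) (at (u x s) within (u x ` {-a..a}))"
      using F[OF u_in[OF x s]] has_derivative_at_withinI by blast
    from vector_derivative_diff_chain_within[OF u_deriv[OF x s] this]
    show "((\<lambda>t. F (u x t)) has_vector_derivative 0) (at s within {-a..a})"
      using zero[OF u_in[OF x s]] by (simp add: o_def)
  qed (use t a_pos in auto)
  then show ?thesis using u_0[OF x] by simp
qed

text \<open>Differentiates \<open>F (u x t) = F x\<close> in the initial value \<open>x\<close>; the
  derivative of the flow is \<open>W\<close>.\<close>

lemma first_integral_derivative:
  assumes F: "\<And>x. x \<in> cball x0 (2 * r) \<Longrightarrow> (F has_derivative F' x) (at x)"
    and zero: "\<And>x. x \<in> cball x0 (2 * r) \<Longrightarrow> F' x (f x) = 0"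
    and x: "x \<in> ball x0 r" and t: "t \<in> {-a..a}"
  shows "F' (u x t) (W x t w) = F' x w"
proof -
  have xc: "x \<in> cball x0 r" using x by simp
  have "(F \<circ> (\<lambda>x. u x t) has_derivative F' (u x t) \<circ> W x t) (at x)"
    using u_has_derivative[OF x t] F[OF u_in[OF xc t]] by (rule diff_chain_at)
  moreover have "(F \<circ> (\<lambda>x. u x t) has_derivative F' x) (at x)"
  proof (rule has_derivative_transform_within_open[OF _ open_ball x])
    show "(F has_derivative F' x) (at x)" using xc r_pos by (intro F) auto
    show "F z = (F \<circ> (\<lambda>x. u x t)) z" if "z \<in> ball x0 r" for z
      using first_integral[OF F zero _ t, of z] that by simp
  qed
  ultimately have "F' (u x t) \<circ> W x t = F' x" by (rule has_derivative_unique)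
  then show ?thesis by (metis comp_apply)
qed

end

subsection \<open>Atlases, tangent spaces and vector fields\<close>

abbreviation chart_range :: "('m, 'e) chart \<Rightarrow> 'e set" where
  "chart_range \<phi> \<equiv> chart_map \<phi> ` chart_dom \<phi>"

abbreviation local_rep :: "('m, 'e) chart \<Rightarrow> ('n, 'f) chart \<Rightarrow> ('m \<Rightarrow> 'n) \<Rightarrow> 'e \<Rightarrow> 'f" where
  "local_rep \<phi> \<psi> f \<equiv> chart_map \<psi> \<circ> f \<circ> chart_inv \<phi>"

abbreviation transition :: "('m, 'e) chart \<Rightarrow> ('m, 'e) chart \<Rightarrow> 'e \<Rightarrow> 'e" where
  "transition \<phi> \<psi> \<equiv> chart_map \<psi> \<circ> chart_inv \<phi>"

abbreviation transition_deriv :: "('m, 'e::euclidean_space) chart \<Rightarrow> ('m, 'e) chart \<Rightarrow> 'e \<Rightarrow> 'e \<Rightarrow> 'e" where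
  "transition_deriv \<phi> \<psi> x \<equiv> frechet_derivative (transition \<phi> \<psi>) (at x)"

lemma scaleR_fun_apply: "(r *\<^sub>R f) x = r *\<^sub>R f x"
  by (simp add: scaleR_fun_def)

text \<open>The calculus of tangent vectors involves only first derivatives of transition maps. With
  just these as assumption it covers \<open>M\<close>, \<open>P\<close> and the leaves, and also the
  slit tangent bundle, whose transition maps contain a derivative of those of
  \<open>M\<close>.\<close>

locale differentiable_atlas =
  fixes A :: "('m, 'e::euclidean_space) atlas"
  assumes chart_inj: "\<phi> \<in> A \<Longrightarrow> inj_on (chart_map \<phi>) (chart_dom \<phi>)"
    and overlap_open: "\<phi> \<in> A \<Longrightarrow> \<psi> \<in> A \<Longrightarrow> open (chart_map \<phi> ` (chart_dom \<phi> \<inter> chart_dom \<psi>))"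
    and transition_differentiable: "\<phi> \<in> A \<Longrightarrow> \<psi> \<in> A \<Longrightarrow> p \<in> chart_dom \<phi> \<Longrightarrow> p \<in> chart_dom \<psi> \<Longrightarrow>
      (transition \<phi> \<psi>) differentiable (at (chart_map \<phi> p))"

lemma smooth_atlas_differentiable_atlas:
  assumes "smooth_atlas A"
  shows "differentiable_atlas A"
proof
  fix \<phi> \<psi> p assume "\<phi> \<in> A" "\<psi> \<in> A" "p \<in> chart_dom \<phi>" "p \<in> chart_dom \<psi>"
  then have "Ck_on (Suc 0) (chart_map \<phi> ` (chart_dom \<phi> \<inter> chart_dom \<psi>)) (transition \<phi> \<psi>)"
    using assms unfolding smooth_atlas_def smooth_on_def by blast
  then show "(transition \<phi> \<psi>) differentiable (at (chart_map \<phi> p))"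
    using \<open>p \<in> chart_dom \<phi>\<close> \<open>p \<in> chart_dom \<psi>\<close> by auto
qed (use assms in \<open>auto simp: smooth_atlas_def\<close>)

lemma chart_map_chart_inv:
  assumes "x \<in> chart_map \<phi> ` S" "S \<subseteq> chart_dom \<phi>"
  shows "chart_map \<phi> (chart_inv \<phi> x) = x" "chart_inv \<phi> x \<in> chart_dom \<phi>"
  using assms f_inv_into_f[of x "chart_map \<phi>" "chart_dom \<phi>"] inv_into_into[of x "chart_map \<phi>" "chart_dom \<phi>"]
  unfolding chart_inv_def by blast+

context differentiable_atlas
begin

lemma chart_inv_chart_map: "\<phi> \<in> A \<Longrightarrow> p \<in> chart_dom \<phi> \<Longrightarrow> chart_inv \<phi> (chart_map \<phi> p) = p"
  unfolding chart_inv_def by (rule inv_into_f_f[OF chart_inj])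

lemma chart_inv_in:
  assumes "\<phi> \<in> A" "x \<in> chart_map \<phi> ` S" "S \<subseteq> chart_dom \<phi>"
  shows "chart_inv \<phi> x \<in> S"
proof -
  obtain p where "p \<in> S" "x = chart_map \<phi> p" using assms(2) by blast
  then show ?thesis using assms(1,3) chart_inv_chart_map[of \<phi> p] by auto
qed

lemma chart_image_Int:
  assumes "\<phi> \<in> A"
  shows "chart_map \<phi> ` (chart_dom \<phi> \<inter> (S \<inter> T)) =
    chart_map \<phi> ` (chart_dom \<phi> \<inter> S) \<inter> chart_map \<phi> ` (chart_dom \<phi> \<inter> T)"
  using chart_inj[OF assms] unfolding inj_on_def by blast

lemma openin_iff:
  "openin (atlas_topology A) V \<longleftrightarrow>
    V \<subseteq> carrier_of A \<and> (\<forall>\<phi>\<in>A. open (chart_map \<phi> ` (chart_dom \<phi> \<inter> V)))"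
proof -
  have "chart_map \<phi> ` (chart_dom \<phi> \<inter> \<Union>\<K>) = (\<Union>K\<in>\<K>. chart_map \<phi> ` (chart_dom \<phi> \<inter> K))" for \<phi> :: "('m, 'e) chart" and \<K>
    by blast
  then have "istopology (\<lambda>V. V \<subseteq> carrier_of A \<and> (\<forall>\<phi>\<in>A. open (chart_map \<phi> ` (chart_dom \<phi> \<inter> V))))"
    unfolding istopology_def by (auto simp: chart_image_Int open_Int)
  then show ?thesis
    unfolding atlas_topology_def by (simp add: topology_inverse')
qed

lemma chart_image_open: "\<phi> \<in> A \<Longrightarrow> open (chart_range \<phi>)"
  using overlap_open[of \<phi> \<phi>] by simp

lemma topspace_atlas [simp]: "topspace (atlas_topology A) = carrier_of A"
proof (rule antisym)
  have "openin (atlas_topology A) (carrier_of A)"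
    unfolding openin_iff
  proof (intro conjI ballI)
    fix \<phi> assume "\<phi> \<in> A"
    then have "chart_dom \<phi> \<inter> carrier_of A = chart_dom \<phi>" by (auto simp: carrier_of_def)
    then show "open (chart_map \<phi> ` (chart_dom \<phi> \<inter> carrier_of A))"
      using chart_image_open[OF \<open>\<phi> \<in> A\<close>] by simp
  qed simp
  then show "carrier_of A \<subseteq> topspace (atlas_topology A)" by (rule openin_subset)
  show "topspace (atlas_topology A) \<subseteq> carrier_of A"
    using openin_iff[of "topspace (atlas_topology A)"] by simp
qed

lemma transition_has_derivative:
  assumes "\<phi> \<in> A" "\<psi> \<in> A" "p \<in> chart_dom \<phi>" "p \<in> chart_dom \<psi>"
  shows "(transition \<phi> \<psi> has_derivative
    transition_deriv \<phi> \<psi> (chart_map \<phi> p)) (at (chart_map \<phi> p))"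
  using transition_differentiable[OF assms] frechet_derivative_works by blast

text \<open>Serves twice: with a chart map as \<open>h\<close> it gives the cocycle rule for
  transition maps, and with a map followed by a chart it shows that \<open>tangent_map\<close> is
  independent of the chart.\<close>

lemma has_derivative_change_source_chart:
  assumes \<phi>: "\<phi> \<in> A" "p \<in> chart_dom \<phi>" and \<phi>': "\<phi>' \<in> A" "p \<in> chart_dom \<phi>'"
    and h: "((h \<circ> chart_inv \<phi>) has_derivative h') (at (chart_map \<phi> p))"
  shows "((h \<circ> chart_inv \<phi>') has_derivative
    h' \<circ> transition_deriv \<phi>' \<phi> (chart_map \<phi>' p)) (at (chart_map \<phi>' p))"
proof -
  let ?S = "chart_map \<phi>' ` (chart_dom \<phi>' \<inter> chart_dom \<phi>)"
  have "((h \<circ> chart_inv \<phi>) has_derivative h') (at ((transition \<phi>' \<phi>) (chart_map \<phi>' p)))"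
    using h \<phi>' by (simp add: chart_inv_chart_map)
  from diff_chain_at[OF transition_has_derivative[OF \<phi>'(1) \<phi>(1) \<phi>'(2) \<phi>(2)] this]
  show ?thesis
  proof (rule has_derivative_transform_within_open)
    show "open ?S" using overlap_open \<phi> \<phi>' by blast
    show "chart_map \<phi>' p \<in> ?S" using \<phi> \<phi>' by blast
    show "((h \<circ> chart_inv \<phi>) \<circ> (transition \<phi>' \<phi>)) x = (h \<circ> chart_inv \<phi>') x" if "x \<in> ?S" for x
      using chart_inv_in[OF \<phi>'(1) that] chart_inv_chart_map[OF \<phi>(1)] by simp
  qed
qed

lemma transition_derivative_comp:
  assumes \<phi>: "\<phi> \<in> A" "p \<in> chart_dom \<phi>" and \<psi>: "\<psi> \<in> A" "p \<in> chart_dom \<psi>" and \<theta>: "\<theta> \<in> A" "p \<in> chart_dom \<theta>"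
  shows "transition_deriv \<psi> \<theta> (chart_map \<psi> p)
    (transition_deriv \<phi> \<psi> (chart_map \<phi> p) x) =
    transition_deriv \<phi> \<theta> (chart_map \<phi> p) x"
  using frechet_derivative_at[OF has_derivative_change_source_chart[OF \<psi> \<phi>
        transition_has_derivative[OF \<psi>(1) \<theta>(1) \<psi>(2) \<theta>(2)]]]
  by (metis comp_apply)

lemma transition_derivative_self:
  assumes \<phi>: "\<phi> \<in> A" "p \<in> chart_dom \<phi>"
  shows "transition_deriv \<phi> \<phi> (chart_map \<phi> p) = (\<lambda>x. x)"
proof -
  have "(transition \<phi> \<phi> has_derivative (\<lambda>x. x)) (at (chart_map \<phi> p))"
  proof (rule has_derivative_transform_within_open[OF has_derivative_ident])
    show "open (chart_range \<phi>)" by (rule chart_image_open[OF \<phi>(1)])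
    show "chart_map \<phi> p \<in> chart_range \<phi>" using \<phi> by blast
    show "x = (transition \<phi> \<phi>) x" if "x \<in> chart_range \<phi>" for x
      using chart_map_chart_inv(1)[OF that] by simp
  qed
  then show ?thesis by (rule frechet_derivative_at[symmetric])
qed

text \<open>Inverse to evaluation in the chart \<open>\<phi>\<close>. Together with
  \<open>tangent_vector_eqI\<close> it identifies the tangent space with the model space.\<close>

definition tangent_vector :: "('m, 'e) chart \<Rightarrow> 'm \<Rightarrow> 'e \<Rightarrow> ('m, 'e) tangent" where
  "tangent_vector \<phi> p x = (\<lambda>\<psi>. if \<psi> \<in> A \<and> p \<in> chart_dom \<psi>
    then transition_deriv \<phi> \<psi> (chart_map \<phi> p) x else 0)"

lemma tangent_spaceI:
  assumes "\<And>\<phi>. \<not> (\<phi> \<in> A \<and> p \<in> chart_dom \<phi>) \<Longrightarrow> v \<phi> = 0"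
    and "\<And>\<phi> \<psi>. \<phi> \<in> A \<Longrightarrow> p \<in> chart_dom \<phi> \<Longrightarrow> \<psi> \<in> A \<Longrightarrow> p \<in> chart_dom \<psi> \<Longrightarrow>
      v \<psi> = transition_deriv \<phi> \<psi> (chart_map \<phi> p) (v \<phi>)"
  shows "v \<in> tangent_space A p"
  using assms unfolding tangent_space_def by blast

lemma tangent_vector_in:
  assumes "\<phi> \<in> A" "p \<in> chart_dom \<phi>"
  shows "tangent_vector \<phi> p x \<in> tangent_space A p"
  by (rule tangent_spaceI) (use assms in \<open>auto simp: tangent_vector_def transition_derivative_comp\<close>)

lemma tangent_vector_chart:
  assumes "\<phi> \<in> A" "p \<in> chart_dom \<phi>"
  shows "tangent_vector \<phi> p x \<phi> = x"
  using assms by (simp add: tangent_vector_def transition_derivative_self)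

lemma tangent_space_chart_change:
  assumes "v \<in> tangent_space A p" "\<phi> \<in> A" "p \<in> chart_dom \<phi>" "\<psi> \<in> A" "p \<in> chart_dom \<psi>"
  shows "v \<psi> = transition_deriv \<phi> \<psi> (chart_map \<phi> p) (v \<phi>)"
  using assms unfolding tangent_space_def by blast

lemma tangent_space_outside:
  assumes "v \<in> tangent_space A p" "\<not> (\<phi> \<in> A \<and> p \<in> chart_dom \<phi>)"
  shows "v \<phi> = 0"
  using assms unfolding tangent_space_def by blast

lemma tangent_vector_eqI:
  assumes v: "v \<in> tangent_space A p" and w: "w \<in> tangent_space A p"
    and "\<phi> \<in> A" "p \<in> chart_dom \<phi>" "v \<phi> = w \<phi>"
  shows "v = w"
proof
  fix \<psi>
  show "v \<psi> = w \<psi>"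
  proof (cases "\<psi> \<in> A \<and> p \<in> chart_dom \<psi>")
    case True
    then show ?thesis
      using tangent_space_chart_change[OF v, of \<phi> \<psi>] tangent_space_chart_change[OF w, of \<phi> \<psi>] assms by simp
  next
    case False
    then show ?thesis using tangent_space_outside[OF v] tangent_space_outside[OF w] by simp
  qed
qed

lemma subspace_tangent_space: "subspace (tangent_space A p)"
proof -
  have lin: "linear (transition_deriv \<phi> \<psi> (chart_map \<phi> p))"
    if "\<phi> \<in> A" "\<psi> \<in> A" "p \<in> chart_dom \<phi>" "p \<in> chart_dom \<psi>" for \<phi> \<psi>
    using transition_has_derivative[OF that] by (rule has_derivative_linear)
  show ?thesis
  proof (rule subspaceI)
    show "0 \<in> tangent_space A p"
      by (rule tangent_spaceI) (simp_all add: linear_0[OF lin])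
    fix v assume v: "v \<in> tangent_space A p"
    show "r *\<^sub>R v \<in> tangent_space A p" for r
    proof (rule tangent_spaceI)
      fix \<phi> \<psi> assume *: "\<phi> \<in> A" "p \<in> chart_dom \<phi>" "\<psi> \<in> A" "p \<in> chart_dom \<psi>"
      show "(r *\<^sub>R v) \<psi> = transition_deriv \<phi> \<psi> (chart_map \<phi> p) ((r *\<^sub>R v) \<phi>)"
        unfolding scaleR_fun_def linear_scale[OF lin[OF *(1,3,2,4)]] tangent_space_chart_change[OF v *] ..
    qed (simp add: scaleR_fun_def tangent_space_outside[OF v])
    fix w assume w: "w \<in> tangent_space A p"
    show "v + w \<in> tangent_space A p"
    proof (rule tangent_spaceI)
      fix \<phi> \<psi> assume *: "\<phi> \<in> A" "p \<in> chart_dom \<phi>" "\<psi> \<in> A" "p \<in> chart_dom \<psi>"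
      show "(v + w) \<psi> = transition_deriv \<phi> \<psi> (chart_map \<phi> p) ((v + w) \<phi>)"
        unfolding plus_fun_apply linear_add[OF lin[OF *(1,3,2,4)]]
          tangent_space_chart_change[OF v *] tangent_space_chart_change[OF w *] ..
    qed (simp add: tangent_space_outside[OF v] tangent_space_outside[OF w])
  qed
qed

text \<open>\<open>tangent_map\<close> selects its source chart with \<open>SOME\<close>; the chain
  rule and the transformation law of \<open>v\<close> cancel the effect of that choice.\<close>

lemma tangent_map_chart:
  assumes \<phi>: "\<phi> \<in> A" "p \<in> chart_dom \<phi>" and \<psi>: "\<psi> \<in> B" "f p \<in> chart_dom \<psi>"
    and der: "(local_rep \<phi> \<psi> f has_derivative g) (at (chart_map \<phi> p))"
    and v: "v \<in> tangent_space A p"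
  shows "tangent_map A B f p v \<psi> = g (v \<phi>)"
proof -
  define \<phi>' where "\<phi>' = (SOME \<phi>. \<phi> \<in> A \<and> p \<in> chart_dom \<phi>)"
  have \<phi>': "\<phi>' \<in> A" "p \<in> chart_dom \<phi>'"
    using someI_ex[of "\<lambda>\<phi>. \<phi> \<in> A \<and> p \<in> chart_dom \<phi>"] \<phi> by (auto simp: \<phi>'_def)
  have "tangent_map A B f p v \<psi> = frechet_derivative (local_rep \<phi>' \<psi> f) (at (chart_map \<phi>' p)) (v \<phi>')"
    using \<psi> by (simp add: tangent_map_def \<phi>'_def Let_def)
  also have "\<dots> = g (transition_deriv \<phi>' \<phi> (chart_map \<phi>' p) (v \<phi>'))"
    using frechet_derivative_at[OF has_derivative_change_source_chart[OF \<phi> \<phi>' der]] by (metis comp_apply)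
  also have "\<dots> = g (v \<phi>)"
    using tangent_space_chart_change[OF v \<phi>' \<phi>] by simp
  finally show ?thesis .
qed

lemma tangent_map_outside: "\<not> (\<psi> \<in> B \<and> f p \<in> chart_dom \<psi>) \<Longrightarrow> tangent_map A B f p v \<psi> = 0"
  by (auto simp: tangent_map_def)

end

text \<open>The condition \<open>near\<close> is continuity at \<open>p\<close> in the only form
  required. It fits flow maps, which are under control only close to \<open>p\<close>.\<close>

lemma tangent_map_in_tangent_space:
  assumes A: "differentiable_atlas A" and B: "differentiable_atlas B"
    and \<phi>: "\<phi> \<in> A" "p \<in> chart_dom \<phi>" and \<psi>: "\<psi> \<in> B" "f p \<in> chart_dom \<psi>"
    and der: "(local_rep \<phi> \<psi> f has_derivative g) (at (chart_map \<phi> p))"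
    and near: "\<And>\<psi>'. \<psi>' \<in> B \<Longrightarrow> f p \<in> chart_dom \<psi>' \<Longrightarrow>
      \<forall>\<^sub>F x in nhds (chart_map \<phi> p). f (chart_inv \<phi> x) \<in> chart_dom \<psi> \<inter> chart_dom \<psi>'"
    and v: "v \<in> tangent_space A p"
  shows "tangent_map A B f p v \<in> tangent_space B (f p)"
proof -
  interpret A: differentiable_atlas A by (rule A)
  interpret B: differentiable_atlas B by (rule B)
  have "tangent_map A B f p v = B.tangent_vector \<psi> (f p) (g (v \<phi>))"
  proof
    fix \<psi>'
    show "tangent_map A B f p v \<psi>' = B.tangent_vector \<psi> (f p) (g (v \<phi>)) \<psi>'"
    proof (cases "\<psi>' \<in> B \<and> f p \<in> chart_dom \<psi>'")
      case True
      then have \<psi>': "\<psi>' \<in> B" "f p \<in> chart_dom \<psi>'" by auto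
      obtain S where S: "open S" "chart_map \<phi> p \<in> S"
        "\<And>x. x \<in> S \<Longrightarrow> f (chart_inv \<phi> x) \<in> chart_dom \<psi> \<inter> chart_dom \<psi>'"
        using near[OF \<psi>'] unfolding eventually_nhds by blast
      have "(transition \<psi> \<psi>' has_derivative
          transition_deriv \<psi> \<psi>' (chart_map \<psi> (f p)))
          (at ((local_rep \<phi> \<psi> f) (chart_map \<phi> p)))"
        using B.transition_has_derivative[OF \<psi>(1) \<psi>'(1) \<psi>(2) \<psi>'(2)] \<phi> by (simp add: A.chart_inv_chart_map)
      from diff_chain_at[OF der this]
      have "(local_rep \<phi> \<psi>' f has_derivative
          transition_deriv \<psi> \<psi>' (chart_map \<psi> (f p)) \<circ> g) (at (chart_map \<phi> p))"
        by (rule has_derivative_transform_within_open[OF _ S(1,2)])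
          (use S(3) B.chart_inv_chart_map[OF \<psi>(1)] in auto)
      from A.tangent_map_chart[of \<phi> p, OF \<phi> \<psi>' this v] True show ?thesis
        by (simp add: B.tangent_vector_def)
    next
      case False
      then show ?thesis by (auto simp: B.tangent_vector_def A.tangent_map_outside)
    qed
  qed
  then show ?thesis using B.tangent_vector_in[OF \<psi>] by simp
qed

context differentiable_atlas
begin

lemma openin_chart_preimage:
  assumes \<phi>: "\<phi> \<in> A" and V: "open V"
  shows "openin (atlas_topology A) {p \<in> chart_dom \<phi>. chart_map \<phi> p \<in> V}"
  unfolding openin_iff
proof (intro conjI ballI)
  show "{p \<in> chart_dom \<phi>. chart_map \<phi> p \<in> V} \<subseteq> carrier_of A"
    using \<phi> by (auto simp: carrier_of_def)
  fix \<psi> assume \<psi>: "\<psi> \<in> A"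
  let ?S = "chart_map \<psi> ` (chart_dom \<psi> \<inter> chart_dom \<phi>)"
  have "continuous_on ?S (transition \<psi> \<phi>)"
    using transition_has_derivative[OF \<psi> \<phi>] has_derivative_continuous
    by (intro continuous_at_imp_continuous_on) blast
  then have "open ({x \<in> ?S. (transition \<psi> \<phi>) x \<in> V})"
    using continuous_open_preimage[OF _ overlap_open[OF \<psi> \<phi>] V] by (simp add: vimage_def Int_def)
  also have "{x \<in> ?S. (transition \<psi> \<phi>) x \<in> V} =
      chart_map \<psi> ` (chart_dom \<psi> \<inter> {p \<in> chart_dom \<phi>. chart_map \<phi> p \<in> V})"
    using chart_inv_chart_map[OF \<psi>] by auto
  finally show "open (chart_map \<psi> ` (chart_dom \<psi> \<inter> {p \<in> chart_dom \<phi>. chart_map \<phi> p \<in> V}))" .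
qed

lemma openin_chart_dom: "\<phi> \<in> A \<Longrightarrow> openin (atlas_topology A) (chart_dom \<phi>)"
  using openin_chart_preimage[of \<phi> UNIV] by simp

lemma continuous_curve_eventually:
  assumes c: "continuous_map (top_of_set I) (atlas_topology A) c" and "open I" "t \<in> I"
    and "openin (atlas_topology A) U" "c t \<in> U"
  shows "\<forall>\<^sub>F s in nhds t. s \<in> I \<and> c s \<in> U"
proof -
  have "openin (top_of_set I) {s \<in> topspace (top_of_set I). c s \<in> U}"
    using c assms(4) by (rule openin_continuous_map_preimage)
  then have "open {s \<in> I. c s \<in> U}"
    using \<open>open I\<close> openin_open_eq by auto
  then show ?thesis
    using assms(3,5) unfolding eventually_nhds by blast
qed

lemma continuous_map_in_chartI:
  assumes \<phi>: "\<phi> \<in> A" and dom: "\<And>t. t \<in> I \<Longrightarrow> c t \<in> chart_dom \<phi>"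
    and cont: "continuous_on I (\<lambda>t. chart_map \<phi> (c t))"
  shows "continuous_map (top_of_set I) (atlas_topology A) c"
  unfolding continuous_map_def
proof (intro conjI allI impI)
  show "c \<in> topspace (top_of_set I) \<rightarrow> topspace (atlas_topology A)"
    using dom \<phi> by (auto simp: carrier_of_def)
  fix U assume "openin (atlas_topology A) U"
  then have "open (chart_map \<phi> ` (chart_dom \<phi> \<inter> U))"
    using \<phi> by (simp add: openin_iff)
  then have "openin (top_of_set I) (I \<inter> (\<lambda>t. chart_map \<phi> (c t)) -` (chart_map \<phi> ` (chart_dom \<phi> \<inter> U)))"
    by (rule continuous_openin_preimage_gen[OF cont])
  moreover have "chart_map \<phi> (c t) \<in> chart_map \<phi> ` (chart_dom \<phi> \<inter> U) \<longleftrightarrow> c t \<in> U" if "t \<in> I" for t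
    using inj_on_image_mem_iff[OF chart_inj[OF \<phi>] dom[OF that], of "chart_dom \<phi> \<inter> U"] dom[OF that] by simp
  ultimately show "openin (top_of_set I) {t \<in> topspace (top_of_set I). c t \<in> U}"
    by (simp add: vimage_def Int_def del: image_iff cong: conj_cong)
qed

lemma continuous_map_chart_near:
  assumes f: "continuous_map (atlas_topology A) X f" and \<phi>: "\<phi> \<in> A" "p \<in> chart_dom \<phi>"
    and U: "openin X U" "f p \<in> U"
  obtains V where "open V" "chart_map \<phi> p \<in> V" "V \<subseteq> chart_range \<phi>"
    "\<And>x. x \<in> V \<Longrightarrow> f (chart_inv \<phi> x) \<in> U"
proof -
  have "openin (atlas_topology A) {p \<in> carrier_of A. f p \<in> U}"
    using openin_continuous_map_preimage[OF f U(1)] by simp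
  then have "open (chart_map \<phi> ` (chart_dom \<phi> \<inter> {p \<in> carrier_of A. f p \<in> U}))"
    using \<phi> by (simp add: openin_iff)
  moreover have "p \<in> carrier_of A" using \<phi> by (auto simp: carrier_of_def)
  ultimately show thesis
    using \<phi> U(2) chart_inv_chart_map[OF \<phi>(1)]
    by (intro that[of "chart_map \<phi> ` (chart_dom \<phi> \<inter> {p \<in> carrier_of A. f p \<in> U})"]) auto
qed

lemma tangent_map_smooth:
  assumes f: "smooth_map A B f" and \<phi>: "\<phi> \<in> A" "p \<in> chart_dom \<phi>" and \<psi>: "\<psi> \<in> B" "f p \<in> chart_dom \<psi>"
  shows "(local_rep \<phi> \<psi> f has_derivative
      frechet_derivative (local_rep \<phi> \<psi> f) (at (chart_map \<phi> p))) (at (chart_map \<phi> p))"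
    and "v \<in> tangent_space A p \<Longrightarrow> tangent_map A B f p v \<psi> =
      frechet_derivative (local_rep \<phi> \<psi> f) (at (chart_map \<phi> p)) (v \<phi>)"
proof -
  have "Ck_on (Suc 0) (chart_map \<phi> ` (chart_dom \<phi> \<inter> f -` chart_dom \<psi>)) (local_rep \<phi> \<psi> f)"
    using f \<phi>(1) \<psi>(1) unfolding smooth_map_def smooth_on_def by blast
  then have "(local_rep \<phi> \<psi> f) differentiable (at (chart_map \<phi> p))"
    using \<phi>(2) \<psi>(2) by auto
  then show der: "(local_rep \<phi> \<psi> f has_derivative
      frechet_derivative (local_rep \<phi> \<psi> f) (at (chart_map \<phi> p))) (at (chart_map \<phi> p))"
    using frechet_derivative_works by blast
  show "v \<in> tangent_space A p \<Longrightarrow> tangent_map A B f p v \<psi> =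
      frechet_derivative (local_rep \<phi> \<psi> f) (at (chart_map \<phi> p)) (v \<phi>)"
    by (rule tangent_map_chart[OF \<phi> \<psi> der])
qed

lemma tangent_map_smooth_linear:
  assumes f: "smooth_map A B f" and p: "p \<in> carrier_of A"
    and v: "v \<in> tangent_space A p" and w: "w \<in> tangent_space A p"
  shows "tangent_map A B f p (v + w) = tangent_map A B f p v + tangent_map A B f p w"
    and "tangent_map A B f p (r *\<^sub>R v) = r *\<^sub>R tangent_map A B f p v"
proof -
  obtain \<phi> where \<phi>: "\<phi> \<in> A" "p \<in> chart_dom \<phi>" using p by (auto simp: carrier_of_def)
  have vw: "v + w \<in> tangent_space A p" "r *\<^sub>R v \<in> tangent_space A p"
    using v w subspace_tangent_space by (auto intro: subspace_add subspace_scale)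
  have "tangent_map A B f p (v + w) \<psi> = (tangent_map A B f p v + tangent_map A B f p w) \<psi> \<and>
      tangent_map A B f p (r *\<^sub>R v) \<psi> = (r *\<^sub>R tangent_map A B f p v) \<psi>" for \<psi>
  proof (cases "\<psi> \<in> B \<and> f p \<in> chart_dom \<psi>")
    case True
    then have \<psi>: "\<psi> \<in> B" "f p \<in> chart_dom \<psi>" by auto
    show ?thesis
      using has_derivative_linear[OF tangent_map_smooth(1)[OF f \<phi> \<psi>]]
      by (simp add: tangent_map_smooth(2)[OF f \<phi> \<psi>] v w vw linear_add linear_scale scaleR_fun_apply)
  next
    case False
    then show ?thesis by (simp add: tangent_map_outside scaleR_fun_apply)
  qed
  then show "tangent_map A B f p (v + w) = tangent_map A B f p v + tangent_map A B f p w"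
    "tangent_map A B f p (r *\<^sub>R v) = r *\<^sub>R tangent_map A B f p v"
    by auto
qed

end

section \<open>Vector fields, integral curves and uniqueness\<close>

definition field_rep :: "('m \<Rightarrow> ('m, 'e) tangent) \<Rightarrow> ('m, 'e) chart \<Rightarrow> 'e \<Rightarrow> 'e" where
  "field_rep X \<phi> x = X (chart_inv \<phi> x) \<phi>"

definition field_deriv :: "('m \<Rightarrow> ('m, 'e::euclidean_space) tangent) \<Rightarrow> ('m, 'e) chart \<Rightarrow> 'e \<Rightarrow> 'e \<Rightarrow> 'e" where
  "field_deriv X \<phi> x = frechet_derivative (field_rep X \<phi>) (at x)"

text \<open>The Hausdorff condition enters through uniqueness of integral curves, and
  \<open>X_C11\<close> through existence of flow boxes. The spray and the Liouville field are both
  instances.\<close>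

locale vector_field = differentiable_atlas A
  for A :: "('m, 'e::euclidean_space) atlas" +
  fixes X :: "'m \<Rightarrow> ('m, 'e) tangent"
  assumes hausdorff: "Hausdorff_space (atlas_topology A)"
    and X_tangent: "p \<in> carrier_of A \<Longrightarrow> X p \<in> tangent_space A p"
    and X_C11: "\<phi> \<in> A \<Longrightarrow> C11_on (chart_range \<phi>) (field_rep X \<phi>) (field_deriv X \<phi>)"
begin

lemma X_chart: "\<phi> \<in> A \<Longrightarrow> p \<in> chart_dom \<phi> \<Longrightarrow> field_rep X \<phi> (chart_map \<phi> p) = X p \<phi>"
  by (simp add: field_rep_def chart_inv_chart_map)

lemma X_deriv:
  assumes "\<phi> \<in> A" "x \<in> chart_range \<phi>"
  shows "(field_rep X \<phi> has_derivative field_deriv X \<phi> x) (at x)"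
  using X_C11[OF assms(1)] assms(2) unfolding C11_on_def by blast

lemma integral_curve_carrier:
  assumes "integral_curve A X I c" "t \<in> I"
  shows "c t \<in> carrier_of A"
  using assms by (auto simp: integral_curve_def continuous_map_def)

lemma integral_curve_derivative:
  assumes "integral_curve A X I c" "t \<in> I" "\<phi> \<in> A" "c t \<in> chart_dom \<phi>"
  shows "((\<lambda>t. chart_map \<phi> (c t)) has_vector_derivative field_rep X \<phi> (chart_map \<phi> (c t))) (at t)"
  using assms by (auto simp: integral_curve_def X_chart o_def)

lemma integral_curve_eventually:
  assumes "integral_curve A X I c" "t \<in> I" "openin (atlas_topology A) U" "c t \<in> U"
  shows "\<forall>\<^sub>F s in nhds t. s \<in> I \<and> c s \<in> U"
  using assms by (intro continuous_curve_eventually) (auto simp: integral_curve_def)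

lemma chart_box:
  assumes "\<phi> \<in> A" "p \<in> chart_dom \<phi>" "open V" "chart_map \<phi> p \<in> V" "V \<subseteq> chart_range \<phi>"
  obtains r a L N B where
    "flow_box (field_rep X \<phi>) (field_deriv X \<phi>) (chart_map \<phi> p) r a L N B"
    "cball (chart_map \<phi> p) (2 * r) \<subseteq> V"
  using flow_box_exists[OF X_C11[OF assms(1)] assms(3,5,4)] by blast

text \<open>The truth value of \<open>c t = d t\<close> is locally constant on the connected common
  domain: inequality persists nearby by the Hausdorff property, equality by Gronwall in a flow
  box.\<close>

lemma integral_curve_unique:
  assumes c: "integral_curve A X I c" and d: "integral_curve A X J d"
    and s: "s \<in> I" "s \<in> J" "c s = d s" and t: "t \<in> I" "t \<in> J"
  shows "c t = d t"
proof -
  have "is_interval (I \<inter> J)"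
    using c d by (auto simp: integral_curve_def intro: is_interval_Int)
  have "(c t = d t) = (c s = d s)"
  proof (rule connected_local_const[where f = "\<lambda>t. c t = d t"], rule is_interval_connected[OF \<open>is_interval (I \<inter> J)\<close>])
    show "t \<in> I \<inter> J" "s \<in> I \<inter> J" using s t by auto
    show "\<forall>x\<in>I \<inter> J. \<forall>\<^sub>F y in at x within I \<inter> J. (c x = d x) = (c y = d y)"
    proof
      fix x assume "x \<in> I \<inter> J"
      then have x: "x \<in> I" "x \<in> J" by auto
      show "\<forall>\<^sub>F y in at x within I \<inter> J. (c x = d x) = (c y = d y)"
      proof (cases "c x = d x")
        case False
        then obtain U V where UV: "openin (atlas_topology A) U" "openin (atlas_topology A) V"
          "c x \<in> U" "d x \<in> V" "disjnt U V"
          using hausdorff integral_curve_carrier[OF c x(1)] integral_curve_carrier[OF d x(2)]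
          unfolding Hausdorff_space_def by (metis topspace_atlas)
        have "\<forall>\<^sub>F y in nhds x. (c x = d x) = (c y = d y)"
          using integral_curve_eventually[OF c x(1) UV(1,3)] integral_curve_eventually[OF d x(2) UV(2,4)]
          by eventually_elim (use UV(5) False in \<open>auto simp: disjnt_iff\<close>)
        then show ?thesis by (simp add: eventually_at_filter eventually_mono)
      next
        case True
        obtain \<phi> where \<phi>: "\<phi> \<in> A" "c x \<in> chart_dom \<phi>"
          using integral_curve_carrier[OF c x(1)] by (auto simp: carrier_of_def)
        obtain r a L N B where box: "flow_box (field_rep X \<phi>) (field_deriv X \<phi>) (chart_map \<phi> (c x)) r a L N B"
          and sub: "cball (chart_map \<phi> (c x)) (2 * r) \<subseteq> chart_range \<phi>"
          using chart_box[OF \<phi> chart_image_open[OF \<phi>(1)]] \<phi> by blast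
        interpret flow_box "field_rep X \<phi>" "field_deriv X \<phi>" "chart_map \<phi> (c x)" r a L N B by (rule box)
        let ?V = "{p \<in> chart_dom \<phi>. chart_map \<phi> p \<in> ball (chart_map \<phi> (c x)) (2 * r)}"
        have V: "openin (atlas_topology A) ?V" by (rule openin_chart_preimage[OF \<phi>(1) open_ball])
        have "c x \<in> ?V" "d x \<in> ?V" using \<phi> r_pos True by auto
        then have "\<forall>\<^sub>F s in nhds x. s \<in> I \<and> c s \<in> ?V" "\<forall>\<^sub>F s in nhds x. s \<in> J \<and> d s \<in> ?V"
          using integral_curve_eventually[OF c x(1) V] integral_curve_eventually[OF d x(2) V] by blast+
        then have "\<forall>\<^sub>F s in nhds x. s \<in> I \<and> s \<in> J \<and> c s \<in> ?V \<and> d s \<in> ?V"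
          by eventually_elim auto
        then obtain e where e: "e > 0" "\<And>s. dist s x < e \<Longrightarrow> s \<in> I \<and> s \<in> J \<and> c s \<in> ?V \<and> d s \<in> ?V"
          unfolding eventually_nhds_metric by blast
        \<comment> \<open>\<open>e\<close> keeps both curves in the box, and \<open>a\<close> keeps
          the interval short enough for \<open>solution_dependence\<close>.\<close>
        have "c y = d y" if y: "dist y x < min e a" for y
        proof -
          let ?S = "{min x y..max x y}"
          have near: "z \<in> I" "z \<in> J" "c z \<in> ?V" "d z \<in> ?V" if "z \<in> ?S" for z
            using e(2)[of z] that y by (auto simp: dist_real_def)
          have "norm (chart_map \<phi> (c y) - chart_map \<phi> (d y)) \<le> 2 * norm (chart_map \<phi> (c x) - chart_map \<phi> (d x))"
          proof (rule solution_dependence)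
            fix z assume z: "z \<in> ?S"
            show "((\<lambda>t. chart_map \<phi> (c t)) has_vector_derivative field_rep X \<phi> (chart_map \<phi> (c z))) (at z within ?S)"
              using integral_curve_derivative[OF c _ \<phi>(1)] near[OF z] has_vector_derivative_at_within by blast
            show "((\<lambda>t. chart_map \<phi> (d t)) has_vector_derivative field_rep X \<phi> (chart_map \<phi> (d z))) (at z within ?S)"
              using integral_curve_derivative[OF d _ \<phi>(1)] near[OF z] has_vector_derivative_at_within by blast
            show "chart_map \<phi> (c z) \<in> cball (chart_map \<phi> (c x)) (2 * r)"
              "chart_map \<phi> (d z) \<in> cball (chart_map \<phi> (c x)) (2 * r)"
              using near[OF z] by auto
          qed (use y in \<open>auto simp: dist_real_def\<close>)
          then have "chart_map \<phi> (c y) = chart_map \<phi> (d y)" using True by simp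
          then show "c y = d y" using chart_inj[OF \<phi>(1)] near[of y] by (auto dest: inj_onD)
        qed
        then show ?thesis
          unfolding eventually_at using e(1) a_pos True by (intro exI[of _ "min e a"]) auto
      qed
    qed
  qed
  then show ?thesis using s(3) by simp
qed

lemma flow_eq:
  assumes "integral_curve A X I c" "0 \<in> I" "\<epsilon> \<in> I"
  shows "flow A X \<epsilon> (c 0) = c \<epsilon>"
  unfolding flow_def
proof (rule the_equality)
  show "\<exists>I d. integral_curve A X I d \<and> 0 \<in> I \<and> \<epsilon> \<in> I \<and> d 0 = c 0 \<and> d \<epsilon> = c \<epsilon>"
    using assms by blast
  show "y = c \<epsilon>" if "\<exists>I d. integral_curve A X I d \<and> 0 \<in> I \<and> \<epsilon> \<in> I \<and> d 0 = c 0 \<and> d \<epsilon> = y" for y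
    using that integral_curve_unique[OF assms(1)] assms(2,3) by metis
qed

end

subsection \<open>Lie transport along integral curves\<close>

locale flow_chart = vector_field A X + flow_box "field_rep X \<phi>" "field_deriv X \<phi>" x0 r a L N B
  for A :: "('m, 'e::euclidean_space) atlas" and X and \<phi> and x0 r a L N B +
  assumes \<phi>_in: "\<phi> \<in> A"
    and box_sub: "cball x0 (2 * r) \<subseteq> chart_range \<phi>"
begin

lemma u_chart:
  assumes "x \<in> cball x0 r" "t \<in> {-a..a}"
  shows "chart_inv \<phi> (u x t) \<in> chart_dom \<phi>" "chart_map \<phi> (chart_inv \<phi> (u x t)) = u x t"
  using chart_map_chart_inv[of "u x t" \<phi> "chart_dom \<phi>"] u_in[OF assms] box_sub by auto

lemma u_integral_curve:
  assumes x: "x \<in> cball x0 r"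
  shows "integral_curve A X {-a<..<a} (\<lambda>t. chart_inv \<phi> (u x t))"
  unfolding integral_curve_def
proof (intro conjI ballI impI)
  have der: "(u x has_vector_derivative field_rep X \<phi> (u x t)) (at t)" if "t \<in> {-a<..<a}" for t
    using u_deriv[OF x, of t] that by (simp add: at_within_Icc_at)
  show "continuous_map (top_of_set {-a<..<a}) (atlas_topology A) (\<lambda>t. chart_inv \<phi> (u x t))"
  proof (rule continuous_map_in_chartI[OF \<phi>_in])
    show "chart_inv \<phi> (u x t) \<in> chart_dom \<phi>" if "t \<in> {-a<..<a}" for t
      using u_chart(1)[OF x, of t] that by simp
    have "continuous_on {-a<..<a} (u x)"
      using der by (meson continuous_at_imp_continuous_on has_vector_derivative_continuous)
    then show "continuous_on {-a<..<a} (\<lambda>t. chart_map \<phi> (chart_inv \<phi> (u x t)))"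
      by (rule continuous_on_eq) (use u_chart(2)[OF x] in simp)
  qed
  fix t \<psi> assume t: "t \<in> {-a<..<a}" and \<psi>: "\<psi> \<in> A" "chart_inv \<phi> (u x t) \<in> chart_dom \<psi>"
  let ?p = "chart_inv \<phi> (u x t)"
  have p: "?p \<in> chart_dom \<phi>" "chart_map \<phi> ?p = u x t"
    using u_chart[OF x, of t] t by auto
  have "?p \<in> carrier_of A" using p \<phi>_in by (auto simp: carrier_of_def)
  then have "X ?p \<psi> = transition_deriv \<phi> \<psi> (u x t) (field_rep X \<phi> (u x t))"
    using tangent_space_chart_change[OF X_tangent \<phi>_in p(1) \<psi>] by (simp add: p(2) field_rep_def)
  moreover have "(transition \<phi> \<psi> has_derivative
      transition_deriv \<phi> \<psi> (u x t)) (at (u x t))"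
    using transition_has_derivative[OF \<phi>_in \<psi>(1) p(1) \<psi>(2)] by (simp add: p(2))
  ultimately show "((chart_map \<psi> \<circ> (\<lambda>t. chart_inv \<phi> (u x t))) has_vector_derivative X ?p \<psi>) (at t)"
    using vector_derivative_diff_chain_within[OF der[OF t] has_derivative_at_withinI]
    by (simp add: o_def)
qed (auto simp: is_interval_1)

lemma flow_u:
  assumes "x \<in> cball x0 r" "t \<in> {-a<..<a}"
  shows "flow A X t (chart_inv \<phi> x) = chart_inv \<phi> (u x t)"
  using flow_eq[OF u_integral_curve[OF assms(1)], of t] assms u_0 a_pos by simp

text \<open>In the chart the flow of the manifold is \<open>u\<close>, so its differential is the
  resolvent \<open>W\<close>. This connects the Lie derivative with the linearized equation.\<close>

lemma flow_tangent_map: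
  assumes p: "p \<in> chart_dom \<phi>" "chart_map \<phi> p \<in> ball x0 r" and t: "t \<in> {-a<..<a}"
    and v: "v \<in> tangent_space A p"
  shows "tangent_map A A (flow A X t) p v \<phi> = W (chart_map \<phi> p) t (v \<phi>)"
    and "tangent_map A A (flow A X t) p v \<in> tangent_space A (flow A X t p)"
proof -
  let ?x = "chart_map \<phi> p"
  have t': "t \<in> {-a..a}" using t by auto
  have x: "?x \<in> cball x0 r" using p by simp
  have flow_p: "flow A X t p = chart_inv \<phi> (u ?x t)"
    using flow_u[OF x t] by (simp add: chart_inv_chart_map \<phi>_in p)
  then have in_dom: "flow A X t p \<in> chart_dom \<phi>"
    using u_chart[OF x t'] by simp
  have der: "(local_rep \<phi> \<phi> (flow A X t) has_derivative W ?x t) (at ?x)"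
  proof (rule has_derivative_transform_within_open[OF u_has_derivative[OF p(2) t'] open_ball p(2)])
    show "u y t = (local_rep \<phi> \<phi> (flow A X t)) y" if "y \<in> ball x0 r" for y
      using flow_u[of y t] u_chart[of y t] that t t' by simp
  qed
  show "tangent_map A A (flow A X t) p v \<phi> = W ?x t (v \<phi>)"
    by (rule tangent_map_chart[where f = "flow A X t", OF \<phi>_in p(1) \<phi>_in in_dom der v])
  show "tangent_map A A (flow A X t) p v \<in> tangent_space A (flow A X t p)"
  proof (rule tangent_map_in_tangent_space[where f = "flow A X t", OF differentiable_atlas_axioms differentiable_atlas_axioms
        \<phi>_in p(1) \<phi>_in in_dom der _ v])
    fix \<psi> assume \<psi>: "\<psi> \<in> A" "flow A X t p \<in> chart_dom \<psi>"
    let ?V = "chart_map \<phi> ` (chart_dom \<phi> \<inter> chart_dom \<psi>)"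
    have "u ?x t \<in> ?V"
      using \<psi> in_dom u_chart(2)[OF x t'] unfolding flow_p by (metis IntI imageI)
    moreover have "((\<lambda>y. u y t) \<longlongrightarrow> u ?x t) (nhds ?x)"
      using has_derivative_continuous[OF u_has_derivative[OF p(2) t']] by (simp add: continuous_at tendsto_nhds_iff)
    ultimately have "\<forall>\<^sub>F y in nhds ?x. u y t \<in> ?V"
      using overlap_open[OF \<phi>_in \<psi>(1)] by (intro topological_tendstoD)
    moreover have "\<forall>\<^sub>F y in nhds ?x. y \<in> ball x0 r"
      using p(2) by (intro eventually_nhds_in_open) auto
    ultimately show "\<forall>\<^sub>F y in nhds ?x. flow A X t (chart_inv \<phi> y) \<in> chart_dom \<phi> \<inter> chart_dom \<psi>"
    proof eventually_elim
      case (elim y)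
      then show ?case using flow_u[of y t] t chart_inv_in[OF \<phi>_in elim(1)] by simp
    qed
  qed
qed

end

lemma has_vector_derivative_shift:
  fixes g :: "real \<Rightarrow> 'a::real_normed_vector"
  shows "((\<lambda>s. g (t + s)) has_vector_derivative d) (at r) \<longleftrightarrow> (g has_vector_derivative d) (at (t + r))"
proof
  have "((\<lambda>s. s - t) has_vector_derivative 1) (at (t + r))"
    by (auto intro!: derivative_eq_intros)
  moreover assume "((\<lambda>s. g (t + s)) has_vector_derivative d) (at r)"
  ultimately show "(g has_vector_derivative d) (at (t + r))"
    using vector_diff_chain_at[of "\<lambda>s. s - t" 1 "t + r" "\<lambda>s. g (t + s)" d] by (simp add: o_def)
next
  have "((\<lambda>s. t + s) has_vector_derivative 1) (at r)"
    by (auto intro!: derivative_eq_intros)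
  moreover assume "(g has_vector_derivative d) (at (t + r))"
  ultimately show "((\<lambda>s. g (t + s)) has_vector_derivative d) (at r)"
    using vector_diff_chain_at[of "\<lambda>s. t + s" 1 r g d] by (simp add: o_def)
qed

section \<open>The linearized equation along a complete integral curve\<close>

text \<open>Instances are the lift of the geodesic, its dilated copies, and the dilation orbits; one
  theory of transport thus serves both \<Gamma> and \<Delta>.\<close>

locale complete_curve = vector_field A X
  for A :: "('m, 'e::euclidean_space) atlas" and X +
  fixes c :: "real \<Rightarrow> 'm"
  assumes c: "integral_curve A X UNIV c"
begin

lemma c_shift: "integral_curve A X UNIV (\<lambda>s. c (t + s))"
proof -
  have "continuous_map euclidean (atlas_topology A) (c \<circ> (+) t)"
    using c by (intro continuous_map_compose[of _ euclidean])
      (auto simp: integral_curve_def continuous_map_iff_continuous2 intro!: continuous_intros)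
  then show ?thesis
    using c by (auto simp: integral_curve_def o_def has_vector_derivative_shift[where g = "\<lambda>t. chart_map _ (c t)"])
qed

lemma c_carrier: "c t \<in> carrier_of A"
  using integral_curve_carrier[OF c] by simp

lemma c_chart: obtains \<phi> where "\<phi> \<in> A" "c t \<in> chart_dom \<phi>"
  using c_carrier[of t] by (auto simp: carrier_of_def)

lemma c_eventually: "openin (atlas_topology A) U \<Longrightarrow> c t \<in> U \<Longrightarrow> \<forall>\<^sub>F s in nhds t. c s \<in> U"
  using integral_curve_eventually[OF c] by simp

lemma c_deriv:
  assumes "\<phi> \<in> A" "c t \<in> chart_dom \<phi>"
  shows "((\<lambda>t. chart_map \<phi> (c t)) has_vector_derivative field_rep X \<phi> (chart_map \<phi> (c t))) (at t)"
  using integral_curve_derivative[OF c _ assms] by simp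

lemma flow_c: "flow A X s (c t) = c (t + s)"
  using flow_eq[OF c_shift[of t], of s] by simp

definition linearized_at :: "(real \<Rightarrow> ('m, 'e) tangent) \<Rightarrow> ('m, 'e) chart \<Rightarrow> real \<Rightarrow> bool" where
  "linearized_at Z \<phi> t \<longleftrightarrow>
    ((\<lambda>s. Z s \<phi>) has_vector_derivative field_deriv X \<phi> (chart_map \<phi> (c t)) (Z t \<phi>)) (at t)"

lemma flow_chart_at:
  assumes "\<phi> \<in> A" "c t \<in> chart_dom \<phi>" "open V" "chart_map \<phi> (c t) \<in> V" "V \<subseteq> chart_range \<phi>"
  obtains r a L N B where "flow_chart A X \<phi> (chart_map \<phi> (c t)) r a L N B"
    "cball (chart_map \<phi> (c t)) (2 * r) \<subseteq> V"
proof -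
  obtain r a L N B where "flow_box (field_rep X \<phi>) (field_deriv X \<phi>) (chart_map \<phi> (c t)) r a L N B"
    "cball (chart_map \<phi> (c t)) (2 * r) \<subseteq> V"
    using chart_box[OF assms] by blast
  then show thesis
    using assms vector_field_axioms
    by (intro that) (auto simp: flow_chart_def flow_chart_axioms_def)
qed

text \<open>In the chart the pulled-back vector is \<open>W (u x \<epsilon>) (- \<epsilon>) (Z (t +
  \<epsilon>) \<phi>)\<close> with \<open>x = chart_map \<phi> (c t)\<close>, so
  \<open>pullback_derivative_zero_iff\<close> applies. Both facts concern small
  \<open>\<epsilon>\<close> only, where the curve is still in the box.\<close>

lemma
  assumes Z: "\<And>s. Z s \<in> tangent_space A (c s)" and \<phi>: "\<phi> \<in> A" "c t \<in> chart_dom \<phi>"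
  shows pullback_derivative_zero_iff_linearized:
      "((\<lambda>\<epsilon>. tangent_map A A (flow A X (- \<epsilon>)) (c (t + \<epsilon>)) (Z (t + \<epsilon>)) \<phi>) has_vector_derivative 0) (at 0)
        \<longleftrightarrow> linearized_at Z \<phi> t"
    and pullback_eventually_tangent:
      "\<forall>\<^sub>F \<epsilon> in nhds 0. tangent_map A A (flow A X (- \<epsilon>)) (c (t + \<epsilon>)) (Z (t + \<epsilon>)) \<in> tangent_space A (c t)"
proof -
  let ?x = "chart_map \<phi> (c t)"
  obtain r a L N B where box: "flow_chart A X \<phi> ?x r a L N B"
    and "cball ?x (2 * r) \<subseteq> chart_range \<phi>"
    by (rule flow_chart_at[OF \<phi> chart_image_open[OF \<phi>(1)] imageI[OF \<phi>(2)] order_refl])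
  interpret flow_chart A X \<phi> ?x r a L N B by (rule box)
  have x: "?x \<in> ball ?x r" "?x \<in> cball ?x r" using r_pos by auto
  have *: "tangent_map A A (flow A X (- \<epsilon>)) (c (t + \<epsilon>)) (Z (t + \<epsilon>)) \<phi> = W (u ?x \<epsilon>) (- \<epsilon>) (Z (t + \<epsilon>) \<phi>) \<and>
      tangent_map A A (flow A X (- \<epsilon>)) (c (t + \<epsilon>)) (Z (t + \<epsilon>)) \<in> tangent_space A (c t)"
    if \<epsilon>: "\<epsilon> \<in> {-a<..<a}" "u ?x \<epsilon> \<in> ball ?x r" for \<epsilon>
  proof -
    have eq: "c (t + \<epsilon>) = chart_inv \<phi> (u ?x \<epsilon>)"
      using flow_u[OF x(2) \<epsilon>(1)] flow_c[of \<epsilon> t] by (simp add: chart_inv_chart_map \<phi>)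
    have u: "c (t + \<epsilon>) \<in> chart_dom \<phi>" "chart_map \<phi> (c (t + \<epsilon>)) = u ?x \<epsilon>"
      using u_chart[OF x(2), of \<epsilon>] \<epsilon> by (auto simp: eq)
    show ?thesis
      using flow_tangent_map[of "c (t + \<epsilon>)" "- \<epsilon>" "Z (t + \<epsilon>)"] u \<epsilon> Z flow_c[of "- \<epsilon>" "t + \<epsilon>"] by simp
  qed
  show "\<forall>\<^sub>F \<epsilon> in nhds 0. tangent_map A A (flow A X (- \<epsilon>)) (c (t + \<epsilon>)) (Z (t + \<epsilon>)) \<in> tangent_space A (c t)"
    using u_eventually_in_ball[OF x(1)] by eventually_elim (use * in blast)
  have "((\<lambda>\<epsilon>. tangent_map A A (flow A X (- \<epsilon>)) (c (t + \<epsilon>)) (Z (t + \<epsilon>)) \<phi>) has_vector_derivative 0) (at 0)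
    \<longleftrightarrow> ((\<lambda>\<epsilon>. W (u ?x \<epsilon>) (- \<epsilon>) (Z (t + \<epsilon>) \<phi>)) has_vector_derivative 0) (at 0)"
  proof (rule has_vector_derivative_cong_ev)
    show "\<forall>\<^sub>F \<epsilon> in nhds 0. \<epsilon> \<in> UNIV \<longrightarrow>
        tangent_map A A (flow A X (- \<epsilon>)) (c (t + \<epsilon>)) (Z (t + \<epsilon>)) \<phi> = W (u ?x \<epsilon>) (- \<epsilon>) (Z (t + \<epsilon>) \<phi>)"
      using u_eventually_in_ball[OF x(1)] by eventually_elim (use * in blast)
    show "tangent_map A A (flow A X (- 0)) (c (t + 0)) (Z (t + 0)) \<phi> = W (u ?x 0) (- 0) (Z (t + 0) \<phi>)"
      by (rule *[THEN conjunct1]) (use a_pos x u_0 in auto)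
  qed
  also have "\<dots> \<longleftrightarrow> linearized_at Z \<phi> t"
    using pullback_derivative_zero_iff[OF x(1), of "\<lambda>\<epsilon>. Z (t + \<epsilon>) \<phi>"]
    by (simp add: linearized_at_def has_vector_derivative_shift[where g = "\<lambda>s. Z s \<phi>"])
  finally show "((\<lambda>\<epsilon>. tangent_map A A (flow A X (- \<epsilon>)) (c (t + \<epsilon>)) (Z (t + \<epsilon>)) \<phi>) has_vector_derivative 0) (at 0)
        \<longleftrightarrow> linearized_at Z \<phi> t" .
qed

text \<open>The pulled-back curve runs in the fixed tangent space at \<open>c t\<close>, where the
  change of chart is a fixed linear map. Vanishing of its derivative therefore passes from chart to
  chart, and no transition map is differentiated twice.\<close>

lemma linearized_at_chart_change:
  assumes Z: "\<And>s. Z s \<in> tangent_space A (c s)" and \<phi>: "\<phi> \<in> A" "c t \<in> chart_dom \<phi>"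
    and \<psi>: "\<psi> \<in> A" "c t \<in> chart_dom \<psi>" and lin: "linearized_at Z \<phi> t"
  shows "linearized_at Z \<psi> t"
proof -
  let ?T = "\<lambda>\<epsilon>. tangent_map A A (flow A X (- \<epsilon>)) (c (t + \<epsilon>)) (Z (t + \<epsilon>))"
  let ?D = "transition_deriv \<phi> \<psi> (chart_map \<phi> (c t))"
  have "bounded_linear ?D"
    using transition_has_derivative[OF \<phi>(1) \<psi>(1) \<phi>(2) \<psi>(2)] by (rule has_derivative_bounded_linear)
  moreover have "((\<lambda>\<epsilon>. ?T \<epsilon> \<phi>) has_vector_derivative 0) (at 0)"
    using lin pullback_derivative_zero_iff_linearized[OF Z \<phi>] by simp
  ultimately have "((\<lambda>\<epsilon>. ?D (?T \<epsilon> \<phi>)) has_vector_derivative ?D 0) (at 0)"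
    by (rule bounded_linear.has_vector_derivative)
  moreover have "?D 0 = 0"
    using \<open>bounded_linear ?D\<close> by (simp add: bounded_linear.linear linear_0)
  ultimately have D: "((\<lambda>\<epsilon>. ?D (?T \<epsilon> \<phi>)) has_vector_derivative 0) (at 0)" by simp
  have ev: "\<forall>\<^sub>F \<epsilon> in nhds 0. ?D (?T \<epsilon> \<phi>) = ?T \<epsilon> \<psi>"
    using pullback_eventually_tangent[OF Z \<phi>]
    by eventually_elim (use tangent_space_chart_change[OF _ \<phi> \<psi>] in simp)
  have "((\<lambda>\<epsilon>. ?D (?T \<epsilon> \<phi>)) has_vector_derivative 0) (at 0) \<longleftrightarrow> ((\<lambda>\<epsilon>. ?T \<epsilon> \<psi>) has_vector_derivative 0) (at 0)"
    using ev eventually_nhds_x_imp_x[OF ev] by (intro has_vector_derivative_cong_ev) (auto elim: eventually_mono)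
  with D show ?thesis using pullback_derivative_zero_iff_linearized[OF Z \<psi>] by simp
qed

lemma has_lie_derivative_zero_iff:
  assumes Z: "\<And>s. Z s \<in> tangent_space A (c s)" and \<phi>: "\<phi> \<in> A" "c t \<in> chart_dom \<phi>"
  shows "has_lie_derivative A X c Z t 0 \<longleftrightarrow> linearized_at Z \<phi> t"
  using pullback_derivative_zero_iff_linearized[OF Z] linearized_at_chart_change[OF Z \<phi>] \<phi>
    subspace_0[OF subspace_tangent_space]
  by (auto simp: has_lie_derivative_def)

end

lemma (in flow_chart) integral_curve_u:
  assumes c: "integral_curve A X UNIV c" and s: "c s \<in> chart_dom \<phi>" "chart_map \<phi> (c s) \<in> cball x0 r"
    and t: "t - s \<in> {-a<..<a}"
  shows "c t \<in> chart_dom \<phi>" "chart_map \<phi> (c t) = u (chart_map \<phi> (c s)) (t - s)"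
proof -
  interpret c: complete_curve A X c by unfold_locales (rule c)
  have "c t = chart_inv \<phi> (u (chart_map \<phi> (c s)) (t - s))"
    using flow_u[OF s(2) t] c.flow_c[of "t - s" s] by (simp add: chart_inv_chart_map \<phi>_in s)
  then show "c t \<in> chart_dom \<phi>" "chart_map \<phi> (c t) = u (chart_map \<phi> (c s)) (t - s)"
    using u_chart[OF s(2), of "t - s"] t by auto
qed

lemma tangent_map_smooth_in:
  assumes A: "differentiable_atlas A" and B: "differentiable_atlas B" and f: "smooth_map A B f"
    and p: "p \<in> carrier_of A" and v: "v \<in> tangent_space A p"
  shows "tangent_map A B f p v \<in> tangent_space B (f p)"
proof -
  interpret A: differentiable_atlas A by (rule A)
  interpret B: differentiable_atlas B by (rule B)
  have cont: "continuous_map (atlas_topology A) (atlas_topology B) f"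
    using f by (simp add: smooth_map_def)
  obtain \<phi> where \<phi>: "\<phi> \<in> A" "p \<in> chart_dom \<phi>" using p by (auto simp: carrier_of_def)
  have "f p \<in> carrier_of B" using continuous_map_image_subset_topspace[OF cont] p by auto
  then obtain \<psi> where \<psi>: "\<psi> \<in> B" "f p \<in> chart_dom \<psi>" by (auto simp: carrier_of_def)
  show ?thesis
  proof (rule tangent_map_in_tangent_space[where f = f, OF A B \<phi> \<psi> A.tangent_map_smooth(1)[where f = f, OF f \<phi> \<psi>] _ v])
    fix \<psi>' assume \<psi>': "\<psi>' \<in> B" "f p \<in> chart_dom \<psi>'"
    have "openin (atlas_topology B) (chart_dom \<psi> \<inter> chart_dom \<psi>')"
      using B.openin_chart_dom \<psi> \<psi>' by blast
    then obtain V where "open V" "chart_map \<phi> p \<in> V" "V \<subseteq> chart_range \<phi>"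
      "\<And>x. x \<in> V \<Longrightarrow> f (chart_inv \<phi> x) \<in> chart_dom \<psi> \<inter> chart_dom \<psi>'"
      by (rule A.continuous_map_chart_near[OF cont \<phi>]) (use \<psi> \<psi>' in auto)
    then show "\<forall>\<^sub>F x in nhds (chart_map \<phi> p). f (chart_inv \<phi> x) \<in> chart_dom \<psi> \<inter> chart_dom \<psi>'"
      unfolding eventually_nhds by blast
  qed
qed

section \<open>Global existence and uniqueness of transported fields\<close>

context complete_curve
begin

text \<open>Tangency is asked for at all times and only the equation is restricted to
  \<open>S\<close>. At the endpoints of a closed interval the derivative is still two-sided.\<close>

definition linearized_on :: "(real \<Rightarrow> ('m, 'e) tangent) \<Rightarrow> real set \<Rightarrow> bool" where
  "linearized_on Z S \<longleftrightarrow> (\<forall>t. Z t \<in> tangent_space A (c t)) \<and>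
    (\<forall>t\<in>S. \<forall>\<phi>\<in>A. c t \<in> chart_dom \<phi> \<longrightarrow> linearized_at Z \<phi> t)"

lemma linearized_on_UNIV_iff:
  "linearized_on Z UNIV \<longleftrightarrow> (\<forall>t. Z t \<in> tangent_space A (c t)) \<and> (\<forall>t. has_lie_derivative A X c Z t 0)"
  using has_lie_derivative_zero_iff[of Z] c_chart unfolding linearized_on_def
  by (metis UNIV_I)

lemma linearized_onI:
  assumes "\<And>t. Z t \<in> tangent_space A (c t)"
    and "\<And>t. t \<in> S \<Longrightarrow> \<exists>\<phi>\<in>A. c t \<in> chart_dom \<phi> \<and> linearized_at Z \<phi> t"
  shows "linearized_on Z S"
  using assms linearized_at_chart_change[of Z] unfolding linearized_on_def by blast

lemma linearized_on_subset: "linearized_on Z T \<Longrightarrow> S \<subseteq> T \<Longrightarrow> linearized_on Z S"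
  unfolding linearized_on_def by blast

lemma linearized_at_cong:
  assumes "\<forall>\<^sub>F s in nhds t. Z s = Z' s"
  shows "linearized_at Z \<phi> t \<longleftrightarrow> linearized_at Z' \<phi> t"
  unfolding linearized_at_def using eventually_nhds_x_imp_x[OF assms]
  by (auto intro!: has_vector_derivative_cong_ev intro: eventually_mono[OF assms])

text \<open>With \<open>2 * e \<le> a\<close>, any two times within \<open>e\<close> of
  \<open>x\<close> differ by less than \<open>a\<close>; so a solution may be started at any of them
  and not only at \<open>x\<close>.\<close>

lemma flow_chart_near:
  obtains \<phi> r a L N B e where "flow_chart A X \<phi> (chart_map \<phi> (c x)) r a L N B" "c x \<in> chart_dom \<phi>"
    "e > 0" "2 * e \<le> a"
    "\<forall>s. \<bar>s - x\<bar> < e \<longrightarrow> c s \<in> chart_dom \<phi> \<and> chart_map \<phi> (c s) \<in> ball (chart_map \<phi> (c x)) r"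
proof -
  obtain \<phi> where \<phi>: "\<phi> \<in> A" "c x \<in> chart_dom \<phi>" by (rule c_chart)
  obtain r a L N B where box: "flow_chart A X \<phi> (chart_map \<phi> (c x)) r a L N B"
    and "cball (chart_map \<phi> (c x)) (2 * r) \<subseteq> chart_range \<phi>"
    by (rule flow_chart_at[OF \<phi> chart_image_open[OF \<phi>(1)] imageI[OF \<phi>(2)] order_refl])
  interpret flow_chart A X \<phi> "chart_map \<phi> (c x)" r a L N B by (rule box)
  let ?U = "{p \<in> chart_dom \<phi>. chart_map \<phi> p \<in> ball (chart_map \<phi> (c x)) r}"
  have "\<forall>\<^sub>F s in nhds x. c s \<in> ?U"
    using \<phi> r_pos by (intro c_eventually openin_chart_preimage) auto
  then obtain e where e: "e > 0" "\<And>s. dist s x < e \<Longrightarrow> c s \<in> ?U"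
    unfolding eventually_nhds_metric by blast
  show thesis
    by (rule that[OF box \<phi>(2), of "min e (a / 2)"]) (use e a_pos in \<open>auto simp: dist_real_def\<close>)
qed

text \<open>Agreement of the two fields is locally constant: in a flow box it spreads from
  \<open>x\<close> to nearby times and from each of these back to \<open>x\<close>.\<close>

lemma linearized_on_unique:
  assumes Z1: "linearized_on Z1 {lo..hi}" and Z2: "linearized_on Z2 {lo..hi}"
    and s: "s \<in> {lo..hi}" "Z1 s = Z2 s" and t: "t \<in> {lo..hi}"
  shows "Z1 t = Z2 t"
proof -
  have "(Z1 t = Z2 t) = (Z1 s = Z2 s)"
  proof (rule connected_local_const[where f = "\<lambda>t. Z1 t = Z2 t", OF connected_Icc t s(1)], rule ballI)
    fix x assume x: "x \<in> {lo..hi}"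
    obtain \<phi> r a L N B e where box: "flow_chart A X \<phi> (chart_map \<phi> (c x)) r a L N B" and "c x \<in> chart_dom \<phi>"
      and e: "e > 0" "2 * e \<le> a"
      "\<forall>s. \<bar>s - x\<bar> < e \<longrightarrow> c s \<in> chart_dom \<phi> \<and> chart_map \<phi> (c s) \<in> ball (chart_map \<phi> (c x)) r"
      by (rule flow_chart_near[where x = x])
    interpret flow_chart A X \<phi> "chart_map \<phi> (c x)" r a L N B by (rule box)
    have agree: "Z1 t = Z2 t" if st: "s \<in> {p..q}" "t \<in> {p..q}" "Z1 s = Z2 s"
      and pq: "p \<le> x" "x \<le> q" "q - p < e" "lo \<le> p" "q \<le> hi" for p q s t
    proof -
      have near: "c y \<in> chart_dom \<phi>" "chart_map \<phi> (c y) \<in> ball (chart_map \<phi> (c x)) r" if "y \<in> {p..q}" for y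
        using e(3)[rule_format, of y] that pq by auto
      have "Z1 t \<phi> = Z2 t \<phi>"
      proof (rule linearized_solution_unique[where y = "\<lambda>t. chart_map \<phi> (c t)"])
        fix y assume y: "y \<in> {p..q}"
        then have "y \<in> {lo..hi}" using pq by auto
        then have "linearized_at Z1 \<phi> y" "linearized_at Z2 \<phi> y"
          using Z1 Z2 near[OF y] \<phi>_in unfolding linearized_on_def by blast+
        then show "((\<lambda>t. Z1 t \<phi>) has_vector_derivative field_deriv X \<phi> (chart_map \<phi> (c y)) (Z1 y \<phi>)) (at y within {p..q})"
          "((\<lambda>t. Z2 t \<phi>) has_vector_derivative field_deriv X \<phi> (chart_map \<phi> (c y)) (Z2 y \<phi>)) (at y within {p..q})"
          unfolding linearized_at_def using has_vector_derivative_at_within by blast+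
        show "chart_map \<phi> (c y) \<in> cball (chart_map \<phi> (c x)) (2 * r)"
          using near(2)[OF y] r_pos by auto
      qed (use st pq e in auto)
      then show ?thesis
        using tangent_vector_eqI[OF _ _ \<phi>_in near(1)[OF st(2)]] Z1 Z2 unfolding linearized_on_def by blast
    qed
    have "(Z1 x = Z2 x) = (Z1 y = Z2 y)" if y: "y \<in> {lo..hi}" "dist y x < e" for y
      using agree[of x "min x y" "max x y" y] agree[of y "min x y" "max x y" x] x y by (auto simp: dist_real_def)
    then show "\<forall>\<^sub>F y in at x within {lo..hi}. (Z1 x = Z2 x) = (Z1 y = Z2 y)"
      unfolding eventually_at using e(1) by (intro exI[of _ e]) auto
  qed
  then show ?thesis using s(2) by simp
qed

text \<open>The solution is given by the resolvent started at \<open>c s\<close>. The radius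
  \<open>e\<close> does not depend on the starting time \<open>s\<close>, as the bisection in
  \<open>linearized_on_Icc_exists\<close> requires.\<close>

lemma linearized_on_exists_local:
  "\<exists>e>0. \<forall>s v. \<bar>s - x\<bar> < e \<longrightarrow> v \<in> tangent_space A (c s) \<longrightarrow>
    (\<exists>Z. Z s = v \<and> linearized_on Z {t. \<bar>t - x\<bar> < e})"
proof -
  obtain \<phi> r a L N B e where box: "flow_chart A X \<phi> (chart_map \<phi> (c x)) r a L N B" and "c x \<in> chart_dom \<phi>"
    and e: "e > 0" "2 * e \<le> a"
    and near': "\<forall>s. \<bar>s - x\<bar> < e \<longrightarrow> c s \<in> chart_dom \<phi> \<and> chart_map \<phi> (c s) \<in> ball (chart_map \<phi> (c x)) r"
    by (rule flow_chart_near[where x = x])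
  note near = near'[rule_format]
  interpret flow_chart A X \<phi> "chart_map \<phi> (c x)" r a L N B by (rule box)
  have "\<exists>Z. Z s = v \<and> linearized_on Z {t. \<bar>t - x\<bar> < e}"
    if s: "\<bar>s - x\<bar> < e" and v: "v \<in> tangent_space A (c s)" for s v
  proof -
    let ?y = "chart_map \<phi> (c s)"
    have y: "c s \<in> chart_dom \<phi>" "?y \<in> cball (chart_map \<phi> (c x)) r" using near[OF s] by auto
    \<comment> \<open>The value 0 away from \<open>x\<close> keeps \<open>Z\<close> tangent at all
      times.\<close>
    define Z where "Z t = (if \<bar>t - x\<bar> < e then tangent_vector \<phi> (c t) (W ?y (t - s) (v \<phi>)) else 0)" for t
    have Zt: "Z t \<in> tangent_space A (c t)" for t
      using near[of t] tangent_vector_in[OF \<phi>_in] subspace_0[OF subspace_tangent_space] by (auto simp: Z_def)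
    have Z\<phi>: "Z t \<phi> = W ?y (t - s) (v \<phi>)" if "\<bar>t - x\<bar> < e" for t
      using that near[OF that] tangent_vector_chart[OF \<phi>_in] by (simp add: Z_def)
    have "Z s = v"
      using Z\<phi>[OF s] W_0[OF y(2)] by (intro tangent_vector_eqI[OF Zt v \<phi>_in y(1)]) simp
    moreover have "linearized_on Z {t. \<bar>t - x\<bar> < e}"
    proof (rule linearized_onI[OF Zt])
      fix t assume "t \<in> {t. \<bar>t - x\<bar> < e}"
      then have t: "\<bar>t - x\<bar> < e" by simp
      then have ts: "t - s \<in> {-a<..<a}" using s e by auto
      have "((\<lambda>t. W ?y t (v \<phi>)) has_vector_derivative field_deriv X \<phi> (u ?y (t - s)) (W ?y (t - s) (v \<phi>))) (at (t - s))"
        using W_deriv[OF y(2), of "t - s" "v \<phi>"] ts by (simp add: at_within_Icc_at)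
      then have "((\<lambda>t. W ?y (t - s) (v \<phi>)) has_vector_derivative field_deriv X \<phi> (u ?y (t - s)) (W ?y (t - s) (v \<phi>))) (at t)"
        using has_vector_derivative_shift[where g = "\<lambda>t. W ?y t (v \<phi>)" and t = "- s" and r = t] by simp
      then have "((\<lambda>t. Z t \<phi>) has_vector_derivative field_deriv X \<phi> (u ?y (t - s)) (W ?y (t - s) (v \<phi>))) (at t)"
        by (rule has_vector_derivative_transform_within_open[where S = "ball x e"])
          (use t Z\<phi> in \<open>auto simp: dist_real_def abs_minus_commute\<close>)
      then have "linearized_at Z \<phi> t"
        unfolding linearized_at_def using integral_curve_u(2)[OF c y ts] Z\<phi>[OF t] by simp
      then show "\<exists>\<phi>\<in>A. c t \<in> chart_dom \<phi> \<and> linearized_at Z \<phi> t" using \<phi>_in near[OF t] by blast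
    qed
    ultimately show ?thesis by blast
  qed
  then show ?thesis using e(1) by blast
qed

text \<open>Each piece satisfies the equation at \<open>b\<close> with a two-sided derivative. As
  the values at \<open>b\<close> coincide, so do the derivatives, and the glued field is
  differentiable there.\<close>

lemma linearized_on_glue:
  assumes Z1: "linearized_on Z1 {a..b}" and Z2: "linearized_on Z2 {b..e}" and eq: "Z1 b = Z2 b"
    and ab: "a \<le> b" "b \<le> e"
  shows "linearized_on (\<lambda>t. if t \<le> b then Z1 t else Z2 t) {a..e}"
  unfolding linearized_on_def
proof (intro conjI allI ballI impI)
  let ?Z = "\<lambda>t. if t \<le> b then Z1 t else Z2 t"
  show "?Z t \<in> tangent_space A (c t)" for t using Z1 Z2 by (simp add: linearized_on_def)
  fix t \<phi> assume t: "t \<in> {a..e}" and \<phi>: "\<phi> \<in> A" "c t \<in> chart_dom \<phi>"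
  let ?D = "field_deriv X \<phi> (chart_map \<phi> (c t))"
  have 1: "((\<lambda>s. Z1 s \<phi>) has_vector_derivative ?D (Z1 t \<phi>)) (at t within S)" if "t \<le> b" for S
    using Z1 t \<phi> that has_vector_derivative_at_within unfolding linearized_on_def linearized_at_def by fastforce
  have 2: "((\<lambda>s. Z2 s \<phi>) has_vector_derivative ?D (Z2 t \<phi>)) (at t within S)" if "b \<le> t" for S
    using Z2 t \<phi> that has_vector_derivative_at_within unfolding linearized_on_def linearized_at_def by fastforce
  have "((\<lambda>s. if s \<in> {..b} then Z1 s \<phi> else Z2 s \<phi>) has_vector_derivative
      (if t \<in> {..b} then ?D (Z1 t \<phi>) else ?D (Z2 t \<phi>))) (at t within UNIV)"
    by (rule has_vector_derivative_If_within_closures[where T = "{b<..}" and f' = "\<lambda>_. ?D (Z1 t \<phi>)" and g' = "\<lambda>_. ?D (Z2 t \<phi>)"])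
      (use 1 2 eq in auto)
  then show "linearized_at ?Z \<phi> t"
    by (simp add: linearized_at_def if_distrib[of "\<lambda>v. v \<phi>"] if_distrib[of ?D] cong: if_cong)
qed

lemma linearized_on_Icc_exists:
  assumes "lo \<le> hi" "s \<in> {lo..hi}" "v \<in> tangent_space A (c s)"
  shows "\<exists>Z. Z s = v \<and> linearized_on Z {lo..hi}"
proof -
  define E where "E a b \<longleftrightarrow> (\<forall>s\<in>{a..b}. \<forall>v\<in>tangent_space A (c s). \<exists>Z. Z s = v \<and> linearized_on Z {a..b})" for a b
  from \<open>lo \<le> hi\<close> have "E lo hi"
  proof (induct rule: Bolzano)
    case (trans a b e)
    show ?case
      unfolding E_def
    proof (intro ballI)
      fix s v assume s: "s \<in> {a..e}" and v: "v \<in> tangent_space A (c s)"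
      show "\<exists>Z. Z s = v \<and> linearized_on Z {a..e}"
      proof (cases "s \<le> b")
        case True
        then have "s \<in> {a..b}" using s by simp
        then obtain Z1 where Z1: "Z1 s = v" "linearized_on Z1 {a..b}"
          using trans(1) v unfolding E_def by blast
        have "Z1 b \<in> tangent_space A (c b)" using Z1(2) by (simp add: linearized_on_def)
        moreover have "b \<in> {b..e}" using trans(4) by simp
        ultimately obtain Z2 where Z2: "Z2 b = Z1 b" "linearized_on Z2 {b..e}"
          using trans(2) unfolding E_def by blast
        show ?thesis
          using linearized_on_glue[OF Z1(2) Z2(2) Z2(1)[symmetric] trans(3,4)] True Z1(1)
          by (intro exI[of _ "\<lambda>t. if t \<le> b then Z1 t else Z2 t"]) simp
      next
        case False
        then have "s \<in> {b..e}" using s by simp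
        then obtain Z2 where Z2: "Z2 s = v" "linearized_on Z2 {b..e}"
          using trans(2) v unfolding E_def by blast
        have "Z2 b \<in> tangent_space A (c b)" using Z2(2) by (simp add: linearized_on_def)
        moreover have "b \<in> {a..b}" using trans(3) by simp
        ultimately obtain Z1 where Z1: "Z1 b = Z2 b" "linearized_on Z1 {a..b}"
          using trans(1) unfolding E_def by blast
        show ?thesis
          using linearized_on_glue[OF Z1(2) Z2(2) Z1(1) trans(3,4)] False Z2(1)
          by (intro exI[of _ "\<lambda>t. if t \<le> b then Z1 t else Z2 t"]) simp
      qed
    qed
  next
    case (local x)
    obtain e where e: "e > 0" "\<And>s v. \<bar>s - x\<bar> < e \<Longrightarrow> v \<in> tangent_space A (c s) \<Longrightarrow>
        \<exists>Z. Z s = v \<and> linearized_on Z {t. \<bar>t - x\<bar> < e}"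
      using linearized_on_exists_local[of x] by blast
    have "E p q" if pq: "p \<le> x" "x \<le> q" "q - p < e" for p q
      unfolding E_def
    proof (intro ballI)
      fix s v assume s: "s \<in> {p..q}" and v: "v \<in> tangent_space A (c s)"
      have sub: "{p..q} \<subseteq> {t. \<bar>t - x\<bar> < e}" using pq by auto
      have "\<bar>s - x\<bar> < e" using s sub by blast
      then obtain Z where "Z s = v" "linearized_on Z {t. \<bar>t - x\<bar> < e}"
        using e(2)[OF _ v] by blast
      then show "\<exists>Z. Z s = v \<and> linearized_on Z {p..q}"
        using linearized_on_subset[OF _ sub] by blast
    qed
    then show ?case using e(1) by blast
  qed
  then show ?thesis using assms unfolding E_def by blast
qed

lemma linearized_on_exists:
  assumes v: "v \<in> tangent_space A (c 0)"
  shows "\<exists>Z. Z 0 = v \<and> linearized_on Z UNIV"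
proof -
  have "\<exists>Z. Z 0 = v \<and> linearized_on Z {-T..T}" if "0 \<le> T" for T
    using that v by (intro linearized_on_Icc_exists) auto
  then obtain F where F: "\<And>T. 0 \<le> T \<Longrightarrow> F T 0 = v" "\<And>T. 0 \<le> T \<Longrightarrow> linearized_on (F T) {-T..T}"
    by metis
  \<comment> \<open>By uniqueness the fields \<open>F T\<close> are restrictions of one another, so
    the value at \<open>t\<close> may be taken from any interval that contains
    \<open>t\<close>.\<close>
  define Z where "Z t = F (\<bar>t\<bar> + 1) t" for t
  have eq: "Z s = F T s" if "\<bar>s\<bar> + 1 \<le> T" for s T
    unfolding Z_def
  proof (rule linearized_on_unique[where ?Z1.0 = "F (\<bar>s\<bar> + 1)" and ?Z2.0 = "F T" and t = s and s = 0 and lo = "- (\<bar>s\<bar> + 1)" and hi = "\<bar>s\<bar> + 1"])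
    show "linearized_on (F (\<bar>s\<bar> + 1)) {- (\<bar>s\<bar> + 1)..\<bar>s\<bar> + 1}" by (rule F) simp
    show "linearized_on (F T) {- (\<bar>s\<bar> + 1)..\<bar>s\<bar> + 1}"
      by (rule linearized_on_subset[OF F(2)[of T]]) (use that in auto)
  qed (use F(1) that in auto)
  have "linearized_at Z \<phi> t" if \<phi>: "\<phi> \<in> A" "c t \<in> chart_dom \<phi>" for t \<phi>
  proof -
    have "\<forall>\<^sub>F s in nhds t. s \<in> ball t 1"
      by (intro eventually_nhds_in_open) auto
    \<comment> \<open>Times within 1 of \<open>t\<close> satisfy
      \<open>\<bar>s\<bar> + 1 \<le> \<bar>t\<bar> + 2\<close>, so a single \<open>F\<close>
      describes \<open>Z\<close> near \<open>t\<close>.\<close>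
    then have "\<forall>\<^sub>F s in nhds t. Z s = F (\<bar>t\<bar> + 2) s"
      by eventually_elim (rule eq, auto simp: dist_real_def)
    moreover have "t \<in> {- (\<bar>t\<bar> + 2)..\<bar>t\<bar> + 2}" by auto
    then have "linearized_at (F (\<bar>t\<bar> + 2)) \<phi> t"
      using F(2)[of "\<bar>t\<bar> + 2"] \<phi> unfolding linearized_on_def by (meson abs_ge_zero add_nonneg_nonneg zero_le_numeral)
    ultimately show ?thesis using linearized_at_cong by blast
  qed
  moreover have "Z t \<in> tangent_space A (c t)" for t
    using F(2)[of "\<bar>t\<bar> + 1"] by (simp add: Z_def linearized_on_def)
  moreover have "Z 0 = v" using F(1) by (simp add: Z_def)
  ultimately show ?thesis unfolding linearized_on_def by blast
qed

lemma linearized_on_UNIV_unique: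
  assumes "linearized_on Z1 UNIV" "linearized_on Z2 UNIV" "Z1 s = Z2 s"
  shows "Z1 t = Z2 t"
  by (rule linearized_on_unique[where lo = "min s t" and hi = "max s t" and s = s])
    (use assms linearized_on_subset[OF _ subset_UNIV] in auto)

text \<open>The pair of base point and image vector is locally constant on the line. They are
  treated together because two image vectors can be compared in one chart only after their base
  points are known to coincide.\<close>

lemma first_integral_transported:
  assumes B: "differentiable_atlas B" and F: "smooth_map A B F"
    and zero: "\<And>p. p \<in> carrier_of A \<Longrightarrow> tangent_map A B F p (X p) = 0"
    and Z: "linearized_on Z UNIV"
  shows "F (c t) = F (c s) \<and> tangent_map A B F (c t) (Z t) = tangent_map A B F (c s) (Z s)"
proof -
  interpret B: differentiable_atlas B by (rule B)
  let ?g = "\<lambda>t. (F (c t), tangent_map A B F (c t) (Z t))"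
  have cont: "continuous_map (atlas_topology A) (atlas_topology B) F"
    using F by (simp add: smooth_map_def)
  have "?g t = ?g s"
  proof (rule connected_local_const[where f = ?g, OF connected_UNIV UNIV_I UNIV_I], rule ballI)
    fix x :: real
    obtain \<phi> where \<phi>: "\<phi> \<in> A" "c x \<in> chart_dom \<phi>" by (rule c_chart)
    have "F (c x) \<in> carrier_of B"
      using continuous_map_image_subset_topspace[OF cont] c_carrier by auto
    then obtain \<psi> where \<psi>: "\<psi> \<in> B" "F (c x) \<in> chart_dom \<psi>" by (auto simp: carrier_of_def)
    obtain V where V: "open V" "chart_map \<phi> (c x) \<in> V" "V \<subseteq> chart_range \<phi>"
      and FV: "\<And>y. y \<in> V \<Longrightarrow> F (chart_inv \<phi> y) \<in> chart_dom \<psi>"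
      using continuous_map_chart_near[OF cont \<phi> B.openin_chart_dom[OF \<psi>(1)] \<psi>(2)] by blast
    obtain r a L N B' where box: "flow_chart A X \<phi> (chart_map \<phi> (c x)) r a L N B'"
      and sub: "cball (chart_map \<phi> (c x)) (2 * r) \<subseteq> V"
      by (rule flow_chart_at[OF \<phi> V])
    interpret flow_chart A X \<phi> "chart_map \<phi> (c x)" r a L N B' by (rule box)
    let ?x = "chart_map \<phi> (c x)"
    have x: "?x \<in> cball ?x r" "?x \<in> ball ?x r" using r_pos by auto
    let ?G = "local_rep \<phi> \<psi> F"
    let ?G' = "\<lambda>y. frechet_derivative ?G (at y)"
    have G: "(?G has_derivative ?G' y) (at y)" "?G' y (field_rep X \<phi> y) = 0" if y: "y \<in> cball ?x (2 * r)" for y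
    proof -
      let ?p = "chart_inv \<phi> y"
      have p: "?p \<in> chart_dom \<phi>" "chart_map \<phi> ?p = y"
        using chart_map_chart_inv[of y \<phi> "chart_dom \<phi>"] subsetD[OF V(3) subsetD[OF sub y]] by blast+
      have Fp: "F ?p \<in> chart_dom \<psi>" using FV y sub by blast
      have pA: "?p \<in> carrier_of A" using p \<phi> by (auto simp: carrier_of_def)
      show "(?G has_derivative ?G' y) (at y)"
        using tangent_map_smooth(1)[OF F \<phi>(1) p(1) \<psi>(1) Fp] by (simp add: p(2))
      show "?G' y (field_rep X \<phi> y) = 0"
        using tangent_map_smooth(2)[OF F \<phi>(1) p(1) \<psi>(1) Fp X_tangent[OF pA]] zero[OF pA]
        by (simp add: p(2) field_rep_def)
    qed
    \<comment> \<open>Uniqueness for the linearized equation identifies the given field with the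
      resolvent, to which \<open>first_integral_derivative\<close> applies.\<close>
    have Z_W: "Z (x + \<epsilon>) \<phi> = W ?x \<epsilon> (Z x \<phi>)" if \<epsilon>: "\<bar>\<epsilon>\<bar> < a" for \<epsilon>
    proof (rule linearized_solution_unique[where v = "\<lambda>\<epsilon>. Z (x + \<epsilon>) \<phi>" and w = "\<lambda>\<epsilon>. W ?x \<epsilon> (Z x \<phi>)"
        and t = \<epsilon> and p = "-\<bar>\<epsilon>\<bar>" and q = "\<bar>\<epsilon>\<bar>" and y = "u ?x" and s = 0])
      fix y assume y: "y \<in> {-\<bar>\<epsilon>\<bar>..\<bar>\<epsilon>\<bar>}"
      then have ya: "x + y - x \<in> {-a<..<a}" "y \<in> {-a..a}" using \<epsilon> by auto
      note cy = integral_curve_u[OF c \<phi>(2) x(1) ya(1)]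
      show "u ?x y \<in> cball ?x (2 * r)" by (rule u_in[OF x(1) ya(2)])
      have "linearized_at Z \<phi> (x + y)" using Z \<phi>(1) cy(1) by (simp add: linearized_on_def)
      then have "((\<lambda>s. Z s \<phi>) has_vector_derivative field_deriv X \<phi> (u ?x y) (Z (x + y) \<phi>)) (at (x + y))"
        unfolding linearized_at_def using cy(2) by simp
      then show "((\<lambda>\<epsilon>. Z (x + \<epsilon>) \<phi>) has_vector_derivative field_deriv X \<phi> (u ?x y) (Z (x + y) \<phi>)) (at y within {-\<bar>\<epsilon>\<bar>..\<bar>\<epsilon>\<bar>})"
        using has_vector_derivative_shift[where g = "\<lambda>s. Z s \<phi>" and t = x and r = y] has_vector_derivative_at_within by blast
      have "{-\<bar>\<epsilon>\<bar>..\<bar>\<epsilon>\<bar>} \<subseteq> {-a..a}" using \<epsilon> by auto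
      then show "((\<lambda>\<epsilon>. W ?x \<epsilon> (Z x \<phi>)) has_vector_derivative field_deriv X \<phi> (u ?x y) (W ?x y (Z x \<phi>))) (at y within {-\<bar>\<epsilon>\<bar>..\<bar>\<epsilon>\<bar>})"
        using W_deriv[OF x(1) ya(2)] has_vector_derivative_within_subset by blast
    qed (use \<epsilon> W_0[OF x(1)] in auto)
    have "?g x = ?g y" if y: "y - x \<in> {-a<..<a}" for y
    proof -
      note cy = integral_curve_u[OF c \<phi>(2) x(1) y]
      let ?u = "u ?x (y - x)"
      have ya: "y - x \<in> {-a..a}" using y by auto
      have eq: "chart_inv \<phi> ?u = c y" "chart_inv \<phi> ?x = c x"
        using chart_inv_chart_map[OF \<phi>(1) cy(1)] chart_inv_chart_map[OF \<phi>] by (simp_all add: cy(2))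
      have Fy: "F (c y) \<in> chart_dom \<psi>" using FV[of ?u] u_in[OF x(1) ya] sub eq by auto
      have "?G ?u = ?G ?x" by (rule first_integral[OF G x(1) ya])
      then have Feq: "F (c y) = F (c x)"
        using eq B.chart_inj[OF \<psi>(1)] Fy \<psi>(2) by (simp add: inj_on_eq_iff)
      have Zt: "Z y \<in> tangent_space A (c y)" "Z x \<in> tangent_space A (c x)"
        using Z by (simp_all add: linearized_on_def)
      have "tangent_map A B F (c y) (Z y) \<psi> = ?G' ?u (Z y \<phi>)"
        using tangent_map_smooth(2)[OF F \<phi>(1) cy(1) \<psi>(1) Fy Zt(1)] cy(2) by simp
      also have "Z y \<phi> = W ?x (y - x) (Z x \<phi>)" using Z_W[of "y - x"] y by auto
      also have "?G' ?u (W ?x (y - x) (Z x \<phi>)) = ?G' ?x (Z x \<phi>)"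
        by (rule first_integral_derivative[OF G x(2) ya])
      also have "\<dots> = tangent_map A B F (c x) (Z x) \<psi>"
        using tangent_map_smooth(2)[OF F \<phi> \<psi> Zt(2)] by simp
      finally have "tangent_map A B F (c y) (Z y) \<psi> = tangent_map A B F (c x) (Z x) \<psi>" .
      moreover have "tangent_map A B F (c y) (Z y) \<in> tangent_space B (F (c x))"
        "tangent_map A B F (c x) (Z x) \<in> tangent_space B (F (c x))"
        using tangent_map_smooth_in[OF differentiable_atlas_axioms B F c_carrier Zt(1)]
          tangent_map_smooth_in[OF differentiable_atlas_axioms B F c_carrier Zt(2)] by (simp_all add: Feq)
      ultimately show ?thesis using Feq B.tangent_vector_eqI[OF _ _ \<psi>] by simp
    qed
    moreover have "\<forall>\<^sub>F y in at x. y - x \<in> {-a<..<a}"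
      unfolding eventually_at using a_pos by (intro exI[of _ a]) (auto simp: dist_real_def)
    ultimately show "\<forall>\<^sub>F y in at x. ?g x = ?g y"
      by (simp add: eventually_mono)
  qed
  then show ?thesis by simp
qed

end

subsection \<open>The slit tangent bundle\<close>

text \<open>The flow of \<Delta> in coordinates. Being linear it is its own derivative, so it acts
  both on points and on the coordinates of tangent vectors.\<close>

definition fibre_scale :: "real \<Rightarrow> 'a \<times> 'b::real_vector \<Rightarrow> 'a \<times> 'b" where
  "fibre_scale s z = (fst z, exp s *\<^sub>R snd z)"

lemma fibre_scale_Pair [simp]: "fibre_scale s (x, y) = (x, exp s *\<^sub>R y)"
  by (simp add: fibre_scale_def)

lemma fst_fibre_scale [simp]: "fst (fibre_scale s z) = fst z"
  and snd_fibre_scale [simp]: "snd (fibre_scale s z) = exp s *\<^sub>R snd z"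
  by (simp_all add: fibre_scale_def)

lemma fibre_scale_0 [simp]: "fibre_scale 0 z = z"
  by (simp add: fibre_scale_def)

lemma bounded_linear_fibre_scale:
  "bounded_linear (fibre_scale s :: 'a::real_normed_vector \<times> 'b::real_normed_vector \<Rightarrow> 'a \<times> 'b)"
  unfolding fibre_scale_def[abs_def]
  by (intro bounded_linear_Pair bounded_linear_fst bounded_linear_const_scaleR bounded_linear_snd)

lemma fibre_scale_has_vector_derivative:
  "((\<lambda>s. fibre_scale s z) has_vector_derivative (0, exp s *\<^sub>R snd z)) (at s)"
  for z :: "'a::real_normed_vector \<times> 'b::real_normed_vector"
  unfolding fibre_scale_def[abs_def] by (auto intro!: derivative_eq_intros)

locale base_manifold =
  fixes M :: "('m, 'e::euclidean_space) atlas"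
  assumes smooth_M: "smooth_manifold M"

sublocale base_manifold \<subseteq> M: differentiable_atlas M
  using smooth_M by (intro smooth_atlas_differentiable_atlas) (simp add: smooth_manifold_def)

context base_manifold
begin

abbreviation T :: "('m \<times> ('m, 'e) tangent, 'e \<times> 'e) atlas" where
  "T \<equiv> slit_tangent_bundle M"

abbreviation slit :: "('m, 'e) chart \<Rightarrow> ('m \<times> ('m, 'e) tangent, 'e \<times> 'e) chart" where
  "slit \<equiv> slit_chart M"

abbreviation \<Delta> :: "'m \<times> ('m, 'e) tangent \<Rightarrow> ('m, 'e) slit_tangent" where
  "\<Delta> \<equiv> liouville_field M"

lemma slit_chart_in: "\<phi> \<in> M \<Longrightarrow> slit \<phi> \<in> T"
  by (simp add: slit_tangent_bundle_def)

lemma T_cases: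
  assumes "\<psi> \<in> T"
  obtains \<phi> where "\<phi> \<in> M" "\<psi> = slit \<phi>"
  using assms by (auto simp: slit_tangent_bundle_def)

lemma slit_dom_iff:
  "u \<in> chart_dom (slit \<phi>) \<longleftrightarrow>
    fst u \<in> chart_dom \<phi> \<and> snd u \<in> tangent_space M (fst u) \<and> snd u \<noteq> 0"
  by (cases u) (simp add: slit_chart_def)

lemma slit_map: "chart_map (slit \<phi>) u = (chart_map \<phi> (fst u), snd u \<phi>)"
  by (cases u) (simp add: slit_chart_def)

lemma carrier_T_iff:
  "u \<in> carrier_of T \<longleftrightarrow> fst u \<in> carrier_of M \<and> snd u \<in> tangent_space M (fst u) \<and> snd u \<noteq> 0"
  by (auto simp: carrier_of_def slit_tangent_bundle_def slit_dom_iff)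

lemma slit_dom_if_carrier: "u \<in> carrier_of T \<Longrightarrow> fst u \<in> chart_dom \<phi> \<Longrightarrow> u \<in> chart_dom (slit \<phi>)"
  by (simp add: carrier_T_iff slit_dom_iff)

lemma tangent_eq_0_iff:
  assumes "v \<in> tangent_space M p" "\<phi> \<in> M" "p \<in> chart_dom \<phi>"
  shows "v = 0 \<longleftrightarrow> v \<phi> = 0"
  using M.tangent_vector_eqI[OF assms(1) subspace_0[OF M.subspace_tangent_space] assms(2,3)] by auto

lemma slit_inj:
  assumes "\<phi> \<in> M"
  shows "inj_on (chart_map (slit \<phi>)) (chart_dom (slit \<phi>))"
proof (rule inj_onI)
  fix u w assume u: "u \<in> chart_dom (slit \<phi>)" and w: "w \<in> chart_dom (slit \<phi>)"
    and eq: "chart_map (slit \<phi>) u = chart_map (slit \<phi>) w"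
  then have 1: "fst u = fst w"
    using M.chart_inj[OF assms] by (auto simp: slit_map slit_dom_iff dest: inj_onD)
  have "snd u = snd w"
    using u w eq 1 assms by (intro M.tangent_vector_eqI[of _ "fst u" _ \<phi>]) (auto simp: slit_map slit_dom_iff)
  with 1 show "u = w" by (rule prod_eqI)
qed

lemma slit_image:
  assumes \<phi>: "\<phi> \<in> M"
  shows "chart_map (slit \<phi>) ` (chart_dom (slit \<phi>) \<inter> {u. fst u \<in> U}) =
    chart_map \<phi> ` (chart_dom \<phi> \<inter> U) \<times> (- {0 :: 'e})"
proof (intro equalityI subsetI)
  fix z assume "z \<in> chart_map (slit \<phi>) ` (chart_dom (slit \<phi>) \<inter> {u. fst u \<in> U})"
  then show "z \<in> chart_map \<phi> ` (chart_dom \<phi> \<inter> U) \<times> (- {0 :: 'e})"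
    using tangent_eq_0_iff \<phi> by (auto simp: slit_map slit_dom_iff)
next
  fix z assume "z \<in> chart_map \<phi> ` (chart_dom \<phi> \<inter> U) \<times> (- {0 :: 'e})"
  then obtain p y where z: "z = (chart_map \<phi> p, y)" and p: "p \<in> chart_dom \<phi>" "p \<in> U" and y: "y \<noteq> 0" by auto
  let ?v = "M.tangent_vector \<phi> p y"
  have v: "?v \<in> tangent_space M p" "?v \<phi> = y"
    using M.tangent_vector_in[OF \<phi> p(1)] M.tangent_vector_chart[OF \<phi> p(1)] by auto
  then have "?v \<noteq> 0" using y by auto
  then show "z \<in> chart_map (slit \<phi>) ` (chart_dom (slit \<phi>) \<inter> {u. fst u \<in> U})"
    using v p by (intro image_eqI[of _ _ "(p, ?v)"]) (auto simp: z slit_map slit_dom_iff)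
qed

lemma slit_overlap:
  "chart_dom (slit \<phi>) \<inter> chart_dom (slit \<psi>) =
    chart_dom (slit \<phi>) \<inter> {u. fst u \<in> chart_dom \<psi>}"
  by (auto simp: slit_dom_iff)

lemma slit_overlap_open:
  assumes "\<phi> \<in> M" "\<psi> \<in> M"
  shows "open (chart_map (slit \<phi>) ` (chart_dom (slit \<phi>) \<inter> chart_dom (slit \<psi>)))"
  unfolding slit_overlap slit_image[OF assms(1)]
  using M.overlap_open[OF assms] by (intro open_Times) auto

lemma slit_chart_inv:
  assumes "\<phi> \<in> M" "u \<in> chart_dom (slit \<phi>)"
  shows "chart_inv (slit \<phi>) (chart_map (slit \<phi>) u) = u"
  unfolding chart_inv_def by (rule inv_into_f_f[OF slit_inj[OF assms(1)] assms(2)])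

lemma slit_transition:
  assumes \<phi>: "\<phi> \<in> M" and \<psi>: "\<psi> \<in> M"
    and u: "u \<in> chart_dom (slit \<phi>)" "u \<in> chart_dom (slit \<psi>)"
  shows "chart_map (slit \<psi>) u =
    ((transition \<phi> \<psi>) (fst (chart_map (slit \<phi>) u)),
     frechet_derivative (transition \<phi> \<psi>) (at (fst (chart_map (slit \<phi>) u))) (snd (chart_map (slit \<phi>) u)))"
  using u M.tangent_space_chart_change[of "snd u" "fst u" \<phi> \<psi>] \<phi> \<psi>
  by (simp add: slit_map slit_dom_iff M.chart_inv_chart_map)

text \<open>The fibre part of the transition map is the derivative of the base transition at x,
  applied to y. Expanding y in the basis reduces joint differentiability in (x, y) to that of the
  directional derivatives, which \<open>Ck_on\<close> provides.\<close>

lemma slit_transition_differentiable: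
  assumes \<phi>: "\<phi> \<in> M" and \<psi>: "\<psi> \<in> M"
    and u: "u \<in> chart_dom (slit \<phi>)" "u \<in> chart_dom (slit \<psi>)"
  shows "(transition (slit \<phi>) (slit \<psi>)) differentiable (at (chart_map (slit \<phi>) u))"
proof -
  let ?\<tau> = "transition \<phi> \<psi>"
  let ?D = "\<lambda>x. frechet_derivative ?\<tau> (at x)"
  let ?z = "chart_map (slit \<phi>) u"
  let ?x = "chart_map \<phi> (fst u)"
  let ?S = "chart_map (slit \<phi>) ` (chart_dom (slit \<phi>) \<inter> chart_dom (slit \<psi>))"
  have p: "fst u \<in> chart_dom \<phi>" "fst u \<in> chart_dom \<psi>" using u by (auto simp: slit_dom_iff)
  have "Ck_on (Suc (Suc 0)) (chart_map \<phi> ` (chart_dom \<phi> \<inter> chart_dom \<psi>)) ?\<tau>"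
    using smooth_M \<phi> \<psi> unfolding smooth_manifold_def smooth_atlas_def smooth_on_def by blast
  then have "(\<lambda>x. ?D x b) differentiable (at ?x)" for b
    using p by auto
  then obtain E where E: "\<And>b. ((\<lambda>x. ?D x b) has_derivative E b) (at ?x)"
    unfolding differentiable_def by metis
  have fst_z: "fst ?z = ?x" by (simp add: slit_map)
  have "((\<lambda>z. \<Sum>b\<in>Basis. (snd z \<bullet> b) *\<^sub>R ?D (fst z) b) has_derivative
      (\<lambda>h. \<Sum>b\<in>Basis. (snd ?z \<bullet> b) *\<^sub>R E b (fst h) + (snd h \<bullet> b) *\<^sub>R ?D (fst ?z) b)) (at ?z)"
  proof (intro has_derivative_sum has_derivative_scaleR)
    fix b :: 'e
    show "((\<lambda>z. snd z \<bullet> b) has_derivative (\<lambda>h. snd h \<bullet> b)) (at ?z)"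
      by (auto intro!: derivative_eq_intros)
    show "((\<lambda>z. ?D (fst z) b) has_derivative (\<lambda>h. E b (fst h))) (at ?z)"
      by (rule has_derivative_compose[where f = fst and g = "\<lambda>x. ?D x b", OF has_derivative_fst[OF has_derivative_ident]])
        (unfold fst_z, rule E)
  qed
  moreover have "((\<lambda>z. ?\<tau> (fst z)) has_derivative (\<lambda>h. ?D ?x (fst h))) (at ?z)"
    by (rule has_derivative_compose[where f = fst and g = ?\<tau>, OF has_derivative_fst[OF has_derivative_ident]])
      (unfold fst_z, rule M.transition_has_derivative[OF \<phi> \<psi> p])
  ultimately have "((\<lambda>z. (?\<tau> (fst z), \<Sum>b\<in>Basis. (snd z \<bullet> b) *\<^sub>R ?D (fst z) b)) has_derivative
      (\<lambda>h. (?D ?x (fst h), \<Sum>b\<in>Basis. (snd ?z \<bullet> b) *\<^sub>R E b (fst h) + (snd h \<bullet> b) *\<^sub>R ?D (fst ?z) b))) (at ?z)"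
    by (intro has_derivative_Pair)
  then have "(transition (slit \<phi>) (slit \<psi>) has_derivative
      (\<lambda>h. (?D ?x (fst h), \<Sum>b\<in>Basis. (snd ?z \<bullet> b) *\<^sub>R E b (fst h) + (snd h \<bullet> b) *\<^sub>R ?D (fst ?z) b))) (at ?z)"
  proof (rule has_derivative_transform_within_open)
    show "open ?S" by (rule slit_overlap_open[OF \<phi> \<psi>])
    show "?z \<in> ?S" using u by blast
    fix z assume "z \<in> ?S"
    then obtain w where w: "w \<in> chart_dom (slit \<phi>)" "w \<in> chart_dom (slit \<psi>)"
      "z = chart_map (slit \<phi>) w" by auto
    have "linear (?D (fst z))"
      using M.transition_has_derivative[OF \<phi> \<psi>, of "fst w"] w has_derivative_linear
      by (auto simp: slit_dom_iff slit_map)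
    then have "?D (fst z) (snd z) = (\<Sum>b\<in>Basis. (snd z \<bullet> b) *\<^sub>R ?D (fst z) b)"
      using linear_sum[of "?D (fst z)" "\<lambda>b. (snd z \<bullet> b) *\<^sub>R b" Basis] linear_scale[of "?D (fst z)"]
      by (simp add: euclidean_representation)
    then show "(?\<tau> (fst z), \<Sum>b\<in>Basis. (snd z \<bullet> b) *\<^sub>R ?D (fst z) b) =
        (transition (slit \<phi>) (slit \<psi>)) z"
      using slit_transition[OF \<phi> \<psi> w(1,2)] slit_chart_inv[OF \<phi> w(1)] w(3) by simp
  qed
  then show ?thesis by (rule differentiableI)
qed

lemma T_differentiable_atlas: "differentiable_atlas T"
proof
  show "inj_on (chart_map \<psi>) (chart_dom \<psi>)" if "\<psi> \<in> T" for \<psi>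
    using that slit_inj by (auto simp: slit_tangent_bundle_def)
  show "open (chart_map \<psi> ` (chart_dom \<psi> \<inter> chart_dom \<psi>'))" if "\<psi> \<in> T" "\<psi>' \<in> T" for \<psi> \<psi>'
    using that slit_overlap_open by (auto simp: slit_tangent_bundle_def)
  show "(transition \<psi> \<psi>') differentiable (at (chart_map \<psi> u))"
    if \<psi>: "\<psi> \<in> T" "\<psi>' \<in> T" and u: "u \<in> chart_dom \<psi>" "u \<in> chart_dom \<psi>'" for \<psi> \<psi>' u
  proof -
    obtain \<phi> \<phi>' where "\<phi> \<in> M" "\<psi> = slit \<phi>" "\<phi>' \<in> M" "\<psi>' = slit \<phi>'"
      using T_cases \<psi> by metis
    with u show ?thesis using slit_transition_differentiable by blast
  qed
qed

end

sublocale base_manifold \<subseteq> T: differentiable_atlas "slit_tangent_bundle M"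
  by (rule T_differentiable_atlas)

context base_manifold
begin

lemma openin_T_fst_preimage:
  assumes "openin (atlas_topology M) U"
  shows "openin (atlas_topology T) {u \<in> carrier_of T. fst u \<in> U}"
  unfolding T.openin_iff
proof (intro conjI ballI)
  fix \<psi> assume "\<psi> \<in> T"
  then obtain \<phi> where \<phi>: "\<phi> \<in> M" "\<psi> = slit \<phi>" by (rule T_cases)
  have "chart_dom \<psi> \<inter> {u \<in> carrier_of T. fst u \<in> U} = chart_dom \<psi> \<inter> {u. fst u \<in> U}"
    using \<open>\<psi> \<in> T\<close> by (auto simp: carrier_of_def)
  moreover have "open (chart_map \<phi> ` (chart_dom \<phi> \<inter> U))"
    using assms \<phi> by (simp add: M.openin_iff)
  ultimately show "open (chart_map \<psi> ` (chart_dom \<psi> \<inter> {u \<in> carrier_of T. fst u \<in> U}))"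
    using \<phi> by (auto simp: slit_image intro!: open_Times)
qed auto

text \<open>Vectors over different base points are separated by preimages of open sets of
  \<open>M\<close>; vectors over the same point lie in one slit chart.\<close>

lemma T_Hausdorff: "Hausdorff_space (atlas_topology T)"
  unfolding Hausdorff_space_def
proof (intro allI impI, elim conjE)
  fix u w assume u: "u \<in> topspace (atlas_topology T)" and w: "w \<in> topspace (atlas_topology T)" and "u \<noteq> w"
  show "\<exists>U V. openin (atlas_topology T) U \<and> openin (atlas_topology T) V \<and> u \<in> U \<and> w \<in> V \<and> disjnt U V"
  proof (cases "fst u = fst w")
    case False
    have "Hausdorff_space (atlas_topology M)" using smooth_M by (simp add: smooth_manifold_def)
    then obtain U V where UV: "openin (atlas_topology M) U" "openin (atlas_topology M) V"
      "fst u \<in> U" "fst w \<in> V" "disjnt U V"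
      using u w False unfolding Hausdorff_space_def by (metis M.topspace_atlas T.topspace_atlas carrier_T_iff)
    show ?thesis
      using openin_T_fst_preimage[OF UV(1)] openin_T_fst_preimage[OF UV(2)] UV(3-5) u w
      by (intro exI[of _ "{u \<in> carrier_of T. fst u \<in> U}"] exI[of _ "{u \<in> carrier_of T. fst u \<in> V}"])
        (auto simp: disjnt_iff)
  next
    case True
    obtain \<phi> where \<phi>: "\<phi> \<in> M" "fst u \<in> chart_dom \<phi>"
      using u by (auto simp: carrier_T_iff carrier_of_def[of M])
    let ?\<psi> = "slit \<phi>"
    have d: "u \<in> chart_dom ?\<psi>" "w \<in> chart_dom ?\<psi>"
      using u w \<phi> True by (auto intro: slit_dom_if_carrier)
    then have "chart_map ?\<psi> u \<noteq> chart_map ?\<psi> w"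
      using slit_inj[OF \<phi>(1)] \<open>u \<noteq> w\<close> by (auto dest: inj_onD)
    then obtain U V where UV: "open U" "open V" "chart_map ?\<psi> u \<in> U" "chart_map ?\<psi> w \<in> V" "U \<inter> V = {}"
      by (rule hausdorff[THEN exE]) blast
    show ?thesis
      using T.openin_chart_preimage[OF slit_chart_in[OF \<phi>(1)] UV(1)] T.openin_chart_preimage[OF slit_chart_in[OF \<phi>(1)] UV(2)]
        UV(3-5) d
      by (intro exI[of _ "{p \<in> chart_dom ?\<psi>. chart_map ?\<psi> p \<in> U}"] exI[of _ "{p \<in> chart_dom ?\<psi>. chart_map ?\<psi> p \<in> V}"])
        (auto simp: disjnt_iff)
  qed
qed

lemma tangent_map_fst:
  assumes u: "u \<in> carrier_of T" and \<phi>: "\<phi> \<in> M" "fst u \<in> chart_dom \<phi>" and v: "v \<in> tangent_space T u"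
  shows "tangent_map T M fst u v \<phi> = fst (v (slit \<phi>))"
proof (rule T.tangent_map_chart[where f = fst, OF slit_chart_in[OF \<phi>(1)] slit_dom_if_carrier[OF u \<phi>(2)] \<phi> _ v])
  let ?S = "chart_range (slit \<phi>)"
  show "(local_rep (slit \<phi>) \<phi> fst has_derivative fst) (at (chart_map (slit \<phi>) u))"
  proof (rule has_derivative_transform_within_open[OF has_derivative_fst[OF has_derivative_ident]])
    show "open ?S" by (rule T.chart_image_open[OF slit_chart_in[OF \<phi>(1)]])
    show "chart_map (slit \<phi>) u \<in> ?S" using slit_dom_if_carrier[OF u \<phi>(2)] by blast
    show "fst z = (local_rep (slit \<phi>) \<phi> fst) z" if "z \<in> ?S" for z
      using that slit_chart_inv[OF \<phi>(1)] by (auto simp: slit_map)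
  qed
qed

section \<open>Dilations and the Liouville field\<close>

text \<open>The factor \<open>exp s\<close> makes scaling an additive flow with generator \<Delta>
  and preserves nonzero vectors; \<open>leaf_point\<close> is the dilated lift of the
  geodesic.\<close>

definition dilate :: "real \<Rightarrow> 'm \<times> ('m, 'e) tangent \<Rightarrow> 'm \<times> ('m, 'e) tangent" where
  "dilate s u = (fst u, exp s *\<^sub>R snd u)"

lemma dilate_0 [simp]: "dilate 0 u = u"
  by (simp add: dilate_def)

lemma dilate_dom_iff: "\<psi> \<in> T \<Longrightarrow> dilate s u \<in> chart_dom \<psi> \<longleftrightarrow> u \<in> chart_dom \<psi>"
  using subspace_scale[OF M.subspace_tangent_space, of "snd u" "fst u" "exp s"]
    subspace_scale[OF M.subspace_tangent_space, of "exp s *\<^sub>R snd u" "fst u" "exp (- s)"]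
  by (auto simp: slit_tangent_bundle_def slit_dom_iff dilate_def simp flip: exp_add)

lemma dilate_carrier: "dilate s u \<in> carrier_of T \<longleftrightarrow> u \<in> carrier_of T"
  by (auto simp: carrier_of_def dilate_dom_iff)

lemma dilate_map: "\<psi> \<in> T \<Longrightarrow> chart_map \<psi> (dilate s u) = fibre_scale s (chart_map \<psi> u)"
  by (auto simp: slit_tangent_bundle_def slit_map dilate_def scaleR_fun_apply)

lemma fibre_scale_image:
  assumes "\<psi> \<in> T" "z \<in> chart_range \<psi>"
  shows "fibre_scale s z \<in> chart_range \<psi>"
    and "chart_inv \<psi> (fibre_scale s z) = dilate s (chart_inv \<psi> z)"
proof -
  obtain u where u: "u \<in> chart_dom \<psi>" "z = chart_map \<psi> u" using assms(2) by blast
  have d: "dilate s u \<in> chart_dom \<psi>" using u assms(1) dilate_dom_iff by blast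
  show "fibre_scale s z \<in> chart_range \<psi>"
    using d dilate_map[OF assms(1), of s u] by (auto simp: u(2) intro: image_eqI[of _ _ "dilate s u"])
  show "chart_inv \<psi> (fibre_scale s z) = dilate s (chart_inv \<psi> z)"
    using T.chart_inv_chart_map[OF assms(1) d] T.chart_inv_chart_map[OF assms(1) u(1)] dilate_map[OF assms(1), of s u]
    by (simp add: u(2))
qed

lemma dilate_has_derivative:
  assumes "\<psi> \<in> T" "u \<in> chart_dom \<psi>"
  shows "(local_rep \<psi> \<psi> (dilate s) has_derivative fibre_scale s) (at (chart_map \<psi> u))"
proof (rule has_derivative_transform_within_open[OF bounded_linear_imp_has_derivative[OF bounded_linear_fibre_scale]])
  show "open (chart_range \<psi>)" by (rule T.chart_image_open[OF assms(1)])
  show "chart_map \<psi> u \<in> chart_range \<psi>" using assms(2) by blast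
  show "fibre_scale s z = (local_rep \<psi> \<psi> (dilate s)) z" if "z \<in> chart_range \<psi>" for z
    using fibre_scale_image[OF assms(1) that] chart_map_chart_inv(1)[OF that] dilate_map[OF assms(1)] by simp
qed

lemma dilate_tangent_map:
  assumes u: "u \<in> carrier_of T" and v: "v \<in> tangent_space T u"
  shows "tangent_map T T (dilate s) u v \<in> tangent_space T (dilate s u)"
    and "\<psi> \<in> T \<Longrightarrow> u \<in> chart_dom \<psi> \<Longrightarrow> tangent_map T T (dilate s) u v \<psi> = fibre_scale s (v \<psi>)"
proof -
  show "tangent_map T T (dilate s) u v \<psi> = fibre_scale s (v \<psi>)" if "\<psi> \<in> T" "u \<in> chart_dom \<psi>" for \<psi>
    by (rule T.tangent_map_chart[where f = "dilate s", OF that that(1) _ dilate_has_derivative[OF that] v])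
      (use that dilate_dom_iff in blast)
  obtain \<psi> where \<psi>: "\<psi> \<in> T" "u \<in> chart_dom \<psi>" using u by (auto simp: carrier_of_def)
  have "dilate s u \<in> chart_dom \<psi>" using \<psi> dilate_dom_iff by blast
  then show "tangent_map T T (dilate s) u v \<in> tangent_space T (dilate s u)"
  proof (rule tangent_map_in_tangent_space[where f = "dilate s", OF T_differentiable_atlas T_differentiable_atlas \<psi> \<psi>(1) _
        dilate_has_derivative[OF \<psi>] _ v])
    fix \<psi>' assume \<psi>': "\<psi>' \<in> T" "dilate s u \<in> chart_dom \<psi>'"
    let ?S = "chart_map \<psi> ` (chart_dom \<psi> \<inter> chart_dom \<psi>')"
    have "u \<in> chart_dom \<psi>'" using \<psi>' dilate_dom_iff by blast
    then have "\<forall>\<^sub>F x in nhds (chart_map \<psi> u). x \<in> ?S"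
      using \<psi> T.overlap_open[OF \<psi>(1) \<psi>'(1)] by (intro eventually_nhds_in_open) auto
    then show "\<forall>\<^sub>F x in nhds (chart_map \<psi> u). dilate s (chart_inv \<psi> x) \<in> chart_dom \<psi> \<inter> chart_dom \<psi>'"
    proof eventually_elim
      case (elim x)
      have "chart_inv \<psi> x \<in> chart_dom \<psi> \<inter> chart_dom \<psi>'"
        by (rule T.chart_inv_in[OF \<psi>(1) elim]) simp
      then show ?case using dilate_dom_iff[OF \<psi>(1)] dilate_dom_iff[OF \<psi>'(1)] by simp
    qed
  qed
qed

lemma dilate_continuous: "continuous_map (atlas_topology T) (atlas_topology T) (dilate s)"
  unfolding continuous_map_def
proof (intro conjI allI impI)
  show "dilate s \<in> topspace (atlas_topology T) \<rightarrow> topspace (atlas_topology T)"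
    using dilate_carrier by auto
  fix U assume U: "openin (atlas_topology T) U"
  show "openin (atlas_topology T) {u \<in> topspace (atlas_topology T). dilate s u \<in> U}"
    unfolding T.openin_iff
  proof (intro conjI ballI)
    fix \<psi> assume \<psi>: "\<psi> \<in> T"
    have "chart_map \<psi> ` (chart_dom \<psi> \<inter> {u \<in> topspace (atlas_topology T). dilate s u \<in> U}) =
        fibre_scale s -` (chart_map \<psi> ` (chart_dom \<psi> \<inter> U))" (is "?L = ?R")
    proof (intro equalityI subsetI)
      fix z assume "z \<in> ?L"
      then obtain u where u: "u \<in> chart_dom \<psi>" "dilate s u \<in> U" "z = chart_map \<psi> u" by auto
      then show "z \<in> ?R"
        using dilate_map[OF \<psi>, of s u] dilate_dom_iff[OF \<psi>, of s u] by (auto intro!: image_eqI[of _ _ "dilate s u"])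
    next
      fix z assume "z \<in> ?R"
      then obtain w where w: "w \<in> chart_dom \<psi>" "w \<in> U" "fibre_scale s z = chart_map \<psi> w" by auto
      have "dilate s (dilate (- s) w) = w" by (simp add: dilate_def flip: exp_add)
      moreover have "chart_map \<psi> (dilate (- s) w) = fibre_scale (- s) (fibre_scale s z)"
        using dilate_map[OF \<psi>] w by simp
      then have "chart_map \<psi> (dilate (- s) w) = z" by (simp add: fibre_scale_def flip: exp_add)
      moreover have "dilate (- s) w \<in> chart_dom \<psi>" using w dilate_dom_iff[OF \<psi>] by blast
      ultimately show "z \<in> ?L"
        using w \<psi> by (intro image_eqI[of _ _ "dilate (- s) w"]) (auto simp: carrier_of_def)
    qed
    moreover have "open (chart_map \<psi> ` (chart_dom \<psi> \<inter> U))" using U \<psi> by (simp add: T.openin_iff)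
    ultimately show "open (chart_map \<psi> ` (chart_dom \<psi> \<inter> {u \<in> topspace (atlas_topology T). dilate s u \<in> U}))"
      using continuous_open_vimage[of _ "fibre_scale s"] linear_continuous_at[OF bounded_linear_fibre_scale] by metis
  qed auto
qed

end

context base_manifold
begin

lemma liouville_chart: "\<psi> \<in> T \<Longrightarrow> u \<in> chart_dom \<psi> \<Longrightarrow> \<Delta> u \<psi> = (0, snd (chart_map \<psi> u))"
  by (simp add: liouville_field_def)

text \<open>The transition maps commute with \<^term>\<open>fibre_scale s\<close>; the derivative at \<open>s = 0\<close> of this relation
  is the transformation law of the field.\<close>

lemma liouville_tangent:
  assumes u: "u \<in> carrier_of T"
  shows "\<Delta> u \<in> tangent_space T u"
proof (rule T.tangent_spaceI)
  show "\<Delta> u \<psi> = 0" if "\<not> (\<psi> \<in> T \<and> u \<in> chart_dom \<psi>)" for \<psi>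
    using that by (auto simp: liouville_field_def)
  fix \<phi> \<psi> assume \<phi>: "\<phi> \<in> T" "u \<in> chart_dom \<phi>" and \<psi>: "\<psi> \<in> T" "u \<in> chart_dom \<psi>"
  let ?\<sigma> = "transition \<phi> \<psi>"
  let ?z = "chart_map \<phi> u"
  have "(?\<sigma> has_derivative frechet_derivative ?\<sigma> (at ?z)) (at (fibre_scale 0 ?z) within range (\<lambda>s. fibre_scale s ?z))"
    using T.transition_has_derivative[OF \<phi>(1) \<psi>(1) \<phi>(2) \<psi>(2)] by (simp add: has_derivative_at_withinI)
  from vector_derivative_diff_chain_within[OF fibre_scale_has_vector_derivative this]
  have "((\<lambda>s. ?\<sigma> (fibre_scale s ?z)) has_vector_derivative frechet_derivative ?\<sigma> (at ?z) (0, snd ?z)) (at 0)"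
    by (simp add: comp_def)
  also have "(\<lambda>s. ?\<sigma> (fibre_scale s ?z)) = (\<lambda>s. fibre_scale s (chart_map \<psi> u))"
    using fibre_scale_image(2)[OF \<phi>(1), of ?z] \<phi> dilate_map[OF \<psi>(1)] T.chart_inv_chart_map[OF \<phi>] by simp
  finally have "((\<lambda>s. fibre_scale s (chart_map \<psi> u)) has_vector_derivative
      frechet_derivative ?\<sigma> (at ?z) (0, snd ?z)) (at 0)" .
  moreover have "((\<lambda>s. fibre_scale s (chart_map \<psi> u)) has_vector_derivative (0, snd (chart_map \<psi> u))) (at 0)"
    using fibre_scale_has_vector_derivative[of "chart_map \<psi> u" 0] by simp
  ultimately have "frechet_derivative ?\<sigma> (at ?z) (0, snd ?z) = (0, snd (chart_map \<psi> u))"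
    by (rule vector_derivative_unique_at)
  then show "\<Delta> u \<psi> = frechet_derivative ?\<sigma> (at ?z) (\<Delta> u \<phi>)"
    by (simp add: liouville_chart \<phi> \<psi>)
qed

lemma liouville_rep:
  assumes "\<psi> \<in> T" "z \<in> chart_range \<psi>"
  shows "field_rep \<Delta> \<psi> z = (0, snd z)"
  using chart_map_chart_inv[OF assms(2)] liouville_chart[OF assms(1)] by (simp add: field_rep_def)

lemma liouville_rep_has_derivative:
  assumes "\<psi> \<in> T" "z \<in> chart_range \<psi>"
  shows "(field_rep \<Delta> \<psi> has_derivative (\<lambda>w. (0, snd w))) (at z)"
proof (rule has_derivative_transform_within_open[OF _ T.chart_image_open[OF assms(1)] assms(2)])
  show "((\<lambda>z. (0, snd z)) has_derivative (\<lambda>w. (0, snd w))) (at z)"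
    by (auto intro!: derivative_eq_intros)
  show "(0, snd x) = field_rep \<Delta> \<psi> x" if "x \<in> chart_range \<psi>" for x
    using liouville_rep[OF assms(1) that] by simp
qed

lemma liouville_deriv:
  assumes "\<psi> \<in> T" "z \<in> chart_range \<psi>"
  shows "field_deriv \<Delta> \<psi> z = (\<lambda>w. (0, snd w))"
  unfolding field_deriv_def
  using frechet_derivative_at[OF liouville_rep_has_derivative[OF assms]] by simp

lemma liouville_vector_field: "vector_field T \<Delta>"
proof
  show "Hausdorff_space (atlas_topology T)" by (rule T_Hausdorff)
  show "\<Delta> u \<in> tangent_space T u" if "u \<in> carrier_of T" for u
    by (rule liouville_tangent[OF that])
  fix \<psi> assume \<psi>: "\<psi> \<in> T"
  let ?S = "chart_range \<psi>"
  show "C11_on ?S (field_rep \<Delta> \<psi>) (field_deriv \<Delta> \<psi>)"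
    unfolding C11_on_def
  proof (intro conjI ballI)
    fix z assume z: "z \<in> ?S"
    show "(field_rep \<Delta> \<psi> has_derivative field_deriv \<Delta> \<psi> z) (at z)"
      using liouville_rep_has_derivative[OF \<psi> z] liouville_deriv[OF \<psi> z] by simp
    obtain e where e: "e > 0" "cball z e \<subseteq> ?S"
      using T.chart_image_open[OF \<psi>] z open_contains_cball by blast
    have "norm (field_deriv \<Delta> \<psi> x w - field_deriv \<Delta> \<psi> y w) \<le> 0 * norm (x - y) * norm w"
      if "x \<in> cball z e" "y \<in> cball z e" for x y w
      using liouville_deriv[OF \<psi> subsetD[OF e(2) that(1)]] liouville_deriv[OF \<psi> subsetD[OF e(2) that(2)]] by simp
    then show "\<exists>e>0. \<exists>N\<ge>0. cball z e \<subseteq> ?S \<and> (\<forall>x\<in>cball z e. \<forall>y\<in>cball z e. \<forall>w.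
        norm (field_deriv \<Delta> \<psi> x w - field_deriv \<Delta> \<psi> y w) \<le> N * norm (x - y) * norm w)"
      using e by (intro exI[of _ e] exI[of _ 0] conjI) blast+
  qed
qed

lemma dilate_integral_curve:
  assumes u: "u \<in> carrier_of T"
  shows "integral_curve T \<Delta> UNIV (\<lambda>s. dilate s u)"
  unfolding integral_curve_def
proof (intro conjI ballI impI)
  obtain \<psi> where \<psi>: "\<psi> \<in> T" "u \<in> chart_dom \<psi>" using u by (auto simp: carrier_of_def)
  have "continuous_on UNIV (\<lambda>s. fibre_scale s (chart_map \<psi> u))"
    using fibre_scale_has_vector_derivative has_vector_derivative_continuous
    by (intro continuous_at_imp_continuous_on) blast
  then show "continuous_map (top_of_set UNIV) (atlas_topology T) (\<lambda>s. dilate s u)"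
    using \<psi> by (intro T.continuous_map_in_chartI[OF \<psi>(1)]) (simp_all add: dilate_dom_iff dilate_map)
  fix s \<psi> assume "\<psi> \<in> T" "dilate s u \<in> chart_dom \<psi>"
  then show "((chart_map \<psi> \<circ> (\<lambda>s. dilate s u)) has_vector_derivative \<Delta> (dilate s u) \<psi>) (at s)"
    using fibre_scale_has_vector_derivative[of "chart_map \<psi> u" s]
    by (simp add: liouville_chart comp_def dilate_map)
qed auto

end

sublocale base_manifold \<subseteq> \<Delta>: vector_field "slit_tangent_bundle M" "liouville_field M"
  by (rule liouville_vector_field)

section \<open>Sprays and their homogeneity\<close>

locale spray_manifold = base_manifold M
  for M :: "('m, 'e::euclidean_space) atlas" +
  fixes \<Gamma> :: "'m \<times> ('m, 'e) tangent \<Rightarrow> ('m, 'e) slit_tangent"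
  assumes spray: "spray M \<Gamma>"
begin

lemma spray_vector_field: "vector_field T \<Gamma>"
proof
  have \<Gamma>: "smooth_vector_field T \<Gamma>" using spray by (simp add: spray_def)
  show "Hausdorff_space (atlas_topology T)" by (rule T_Hausdorff)
  show "\<Gamma> u \<in> tangent_space T u" if "u \<in> carrier_of T" for u
    using \<Gamma> that unfolding smooth_vector_field_def by blast
  fix \<psi> assume \<psi>: "\<psi> \<in> T"
  then have "Ck_on (Suc (Suc 0)) (chart_range \<psi>) (field_rep \<Gamma> \<psi>)"
    using \<Gamma> unfolding smooth_vector_field_def smooth_on_def field_rep_def[abs_def] by blast
  then show "C11_on (chart_range \<psi>) (field_rep \<Gamma> \<psi>) (field_deriv \<Gamma> \<psi>)"
    using C11_on_if_Ck_on_2[OF T.chart_image_open[OF \<psi>]] unfolding field_deriv_def[abs_def] by blast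
qed

end

sublocale spray_manifold \<subseteq> \<Gamma>: vector_field "slit_tangent_bundle M" \<Gamma>
  by (rule spray_vector_field)

context spray_manifold
begin

lemma fst_spray_chart: "\<psi> \<in> T \<Longrightarrow> u \<in> chart_dom \<psi> \<Longrightarrow> fst (\<Gamma> u \<psi>) = snd (chart_map \<psi> u)"
  using spray by (auto simp: spray_def)

lemma fst_spray_rep:
  assumes "\<psi> \<in> T" "z \<in> chart_range \<psi>"
  shows "fst (field_rep \<Gamma> \<psi> z) = snd z"
  using chart_map_chart_inv[OF assms(2)] fst_spray_chart[OF assms(1)] by (simp add: field_rep_def)

text \<open>For a solution of the linearized equation this says that the time derivative of the base
  part is the fibre part.\<close>

lemma fst_spray_deriv:
  assumes \<psi>: "\<psi> \<in> T" and z: "z \<in> chart_range \<psi>"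
  shows "fst (field_deriv \<Gamma> \<psi> z w) = snd w"
proof -
  have "((\<lambda>z. fst (field_rep \<Gamma> \<psi> z)) has_derivative (\<lambda>w. fst (field_deriv \<Gamma> \<psi> z w))) (at z)"
    by (rule has_derivative_fst[OF \<Gamma>.X_deriv[OF \<psi> z]])
  moreover have "((\<lambda>z. fst (field_rep \<Gamma> \<psi> z)) has_derivative snd) (at z)"
    by (rule has_derivative_transform_within_open[OF has_derivative_snd[OF has_derivative_ident]
          T.chart_image_open[OF \<psi>] z]) (simp add: fst_spray_rep[OF \<psi>])
  ultimately have "(\<lambda>w. fst (field_deriv \<Gamma> \<psi> z w)) = snd" by (rule has_derivative_unique)
  then show ?thesis by (rule fun_cong)
qed

text \<open>Euler's relation. As the derivative of \<Delta> is
  \<open>\<lambda>w. (0, snd w)\<close>, the bracket condition makes the base part of \<Gamma> of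
  degree 1 and the fibre part of degree 2 in y, infinitesimally.\<close>

lemma spray_euler:
  assumes \<psi>: "\<psi> \<in> T" and z: "z \<in> chart_range \<psi>"
  shows "field_deriv \<Gamma> \<psi> z (0, snd z) = field_rep \<Gamma> \<psi> z + (0, snd (field_rep \<Gamma> \<psi> z))"
proof -
  obtain u where u: "u \<in> chart_dom \<psi>" "z = chart_map \<psi> u" using z by blast
  then have "u \<in> carrier_of T" using \<psi> by (auto simp: carrier_of_def)
  then have "lie_bracket T \<Delta> \<Gamma> u \<psi> = \<Gamma> u \<psi>"
    using spray by (simp add: spray_def)
  then have "field_deriv \<Gamma> \<psi> z (\<Delta> u \<psi>) - field_deriv \<Delta> \<psi> z (\<Gamma> u \<psi>) = \<Gamma> u \<psi>"
    using \<psi> u unfolding lie_bracket_def field_deriv_def field_rep_def[abs_def] by simp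
  then show ?thesis
    using \<Gamma>.X_chart[OF \<psi> u(1)] liouville_chart[OF \<psi> u(1)] liouville_deriv[OF \<psi> z] u(2)
    by (simp add: algebra_simps)
qed

text \<open>This is \<open>\<Gamma>\<^sup>i(x, e\<^sup>s y) = e\<^sup>2\<^sup>s \<Gamma>\<^sup>i(x, y)\<close>, obtained from the infinitesimal relation by integrating
  along the rays.\<close>

lemma spray_homogeneous:
  assumes \<psi>: "\<psi> \<in> T" and z: "z \<in> chart_range \<psi>"
  shows "field_rep \<Gamma> \<psi> (fibre_scale s z) = exp s *\<^sub>R fibre_scale s (field_rep \<Gamma> \<psi> z)"
proof -
  let ?f = "field_rep \<Gamma> \<psi>"
  \<comment> \<open>The factor \<open>exp (- 2 * s)\<close> compensates degree 2 of the fibre part,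
    so \<open>?g\<close> is constant along the ray. The base part is y itself and scales
    directly.\<close>
  let ?g = "\<lambda>s. exp (- 2 * s) *\<^sub>R snd (?f (fibre_scale s z))"
  have in_S: "fibre_scale s z \<in> chart_range \<psi>" for s
    by (rule fibre_scale_image(1)[OF \<psi> z])
  have der: "(?g has_vector_derivative 0) (at s within S)" for s S
  proof -
    let ?w = "fibre_scale s z"
    have "(?f has_derivative field_deriv \<Gamma> \<psi> ?w) (at ?w within range (\<lambda>s. fibre_scale s z))"
      using \<Gamma>.X_deriv[OF \<psi> in_S] by (rule has_derivative_at_withinI)
    from vector_derivative_diff_chain_within[OF fibre_scale_has_vector_derivative this]
    have "((\<lambda>s. ?f (fibre_scale s z)) has_vector_derivative field_deriv \<Gamma> \<psi> ?w (0, snd ?w)) (at s)"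
      by (simp add: comp_def)
    from bounded_linear.has_vector_derivative[OF bounded_linear_snd this]
    have "((\<lambda>s. snd (?f (fibre_scale s z))) has_vector_derivative 2 *\<^sub>R snd (?f ?w)) (at s)"
      unfolding spray_euler[OF \<psi> in_S[of s]] by (simp add: scaleR_2)
    moreover have "((\<lambda>s. exp (- 2 * s)) has_field_derivative exp (- 2 * s) * (- 2)) (at s)"
      by (auto intro!: derivative_eq_intros)
    ultimately have "(?g has_vector_derivative exp (- 2 * s) *\<^sub>R (2 *\<^sub>R snd (?f ?w)) +
        (exp (- 2 * s) * (- 2)) *\<^sub>R snd (?f ?w)) (at s)"
      by (intro has_vector_derivative_scaleR)
    then have "(?g has_vector_derivative 0) (at s)" by (simp flip: scaleR_add_left)
    then show ?thesis by (rule has_vector_derivative_at_within)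
  qed
  have "norm (?g s - ?g 0) \<le> 0 * \<bar>s - 0\<bar>"
    by (rule has_vector_derivative_bound[where p = "- \<bar>s\<bar>" and q = "\<bar>s\<bar>", OF der]) auto
  then have g: "?g s = snd (?f z)" by simp
  have "snd (?f (fibre_scale s z)) = exp (2 * s) *\<^sub>R ?g s"
    by (simp flip: exp_add)
  also have "\<dots> = exp (2 * s) *\<^sub>R snd (?f z)" unfolding g ..
  also have "exp (2 * s) = exp s * exp s"
    by (simp flip: exp_add)
  finally have "snd (?f (fibre_scale s z)) = exp s *\<^sub>R exp s *\<^sub>R snd (?f z)" by simp
  moreover have "fst (?f (fibre_scale s z)) = exp s *\<^sub>R fst (?f z)"
    using fst_spray_rep[OF \<psi> in_S[of s]] fst_spray_rep[OF \<psi> z] by simp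
  ultimately show ?thesis by (simp add: prod_eq_iff)
qed

text \<open>Differentiates \<open>spray_homogeneous\<close> in \<open>z\<close>. It shows that a
  dilated transported field satisfies the linearized equation along the dilated curve.\<close>

lemma spray_deriv_homogeneous:
  assumes \<psi>: "\<psi> \<in> T" and z: "z \<in> chart_range \<psi>"
  shows "field_deriv \<Gamma> \<psi> (fibre_scale s z) (fibre_scale s w) = exp s *\<^sub>R fibre_scale s (field_deriv \<Gamma> \<psi> z w)"
proof -
  have bl: "bounded_linear (\<lambda>w. exp s *\<^sub>R fibre_scale s w :: 'e \<times> 'e)"
    by (intro bounded_linear_intros bounded_linear_compose[OF bounded_linear_scaleR_right bounded_linear_fibre_scale])
  have "(field_rep \<Gamma> \<psi> \<circ> fibre_scale s has_derivative field_deriv \<Gamma> \<psi> (fibre_scale s z) \<circ> fibre_scale s) (at z)"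
    by (rule diff_chain_at[OF bounded_linear_imp_has_derivative[OF bounded_linear_fibre_scale]
          \<Gamma>.X_deriv[OF \<psi> fibre_scale_image(1)[OF \<psi> z]]])
  moreover have "(field_rep \<Gamma> \<psi> \<circ> fibre_scale s has_derivative
      (\<lambda>w. exp s *\<^sub>R fibre_scale s w) \<circ> field_deriv \<Gamma> \<psi> z) (at z)"
  proof (rule has_derivative_transform_within_open[OF _ T.chart_image_open[OF \<psi>] z])
    show "((\<lambda>w. exp s *\<^sub>R fibre_scale s w) \<circ> field_rep \<Gamma> \<psi> has_derivative
        (\<lambda>w. exp s *\<^sub>R fibre_scale s w) \<circ> field_deriv \<Gamma> \<psi> z) (at z)"
      by (rule diff_chain_at[OF \<Gamma>.X_deriv[OF \<psi> z] bounded_linear_imp_has_derivative[OF bl]])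
    show "((\<lambda>w. exp s *\<^sub>R fibre_scale s w) \<circ> field_rep \<Gamma> \<psi>) x = (field_rep \<Gamma> \<psi> \<circ> fibre_scale s) x"
      if "x \<in> chart_range \<psi>" for x
      using spray_homogeneous[OF \<psi> that] by simp
  qed
  ultimately have "field_deriv \<Gamma> \<psi> (fibre_scale s z) \<circ> fibre_scale s = (\<lambda>w. exp s *\<^sub>R fibre_scale s w) \<circ> field_deriv \<Gamma> \<psi> z"
    by (rule has_derivative_unique)
  then show ?thesis by (metis comp_apply)
qed

end

subsection \<open>Jacobi fields and the leaf of a geodesic\<close>

locale spray_geodesic = spray_manifold M \<Gamma>
  for M :: "('m, 'e::euclidean_space) atlas" and \<Gamma> +
  fixes c :: "real \<Rightarrow> 'm \<times> ('m, 'e) tangent"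
  assumes integral_c: "integral_curve T \<Gamma> UNIV c"

sublocale spray_geodesic \<subseteq> C: complete_curve "slit_tangent_bundle M" \<Gamma> c
  by unfold_locales (rule integral_c)

context spray_geodesic
begin

abbreviation \<gamma> :: "real \<Rightarrow> 'm" where
  "\<gamma> \<equiv> fst \<circ> c"

abbreviation transported :: "(real \<Rightarrow> ('m, 'e) slit_tangent) \<Rightarrow> bool" where
  "transported Z \<equiv> C.linearized_on Z UNIV"

abbreviation projection :: "(real \<Rightarrow> ('m, 'e) slit_tangent) \<Rightarrow> real \<Rightarrow> ('m, 'e) tangent" where
  "projection \<equiv> base_projection M \<gamma>"

lemma c_slit_dom: "\<phi> \<in> M \<Longrightarrow> fst (c t) \<in> chart_dom \<phi> \<Longrightarrow> c t \<in> chart_dom (slit \<phi>)"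
  by (rule slit_dom_if_carrier[OF C.c_carrier])

lemma c_image: "\<psi> \<in> T \<Longrightarrow> c t \<in> chart_dom \<psi> \<Longrightarrow> chart_map \<psi> (c t) \<in> chart_range \<psi>"
  by blast

text \<open>The base part of \<Gamma> is y, so the velocity of the base curve is the fibre component
  of the integral curve. Hence \<open>c\<close> is recovered from \<open>\<gamma>\<close> as its
  natural lift.\<close>

lemma velocity_eq: "velocity M \<gamma> t = snd (c t)"
proof
  fix \<phi>
  have v: "snd (c t) \<in> tangent_space M (fst (c t))"
    using C.c_carrier[of t] by (simp add: carrier_T_iff)
  show "velocity M \<gamma> t \<phi> = snd (c t) \<phi>"
  proof (cases "\<phi> \<in> M \<and> fst (c t) \<in> chart_dom \<phi>")
    case True
    let ?\<psi> = "slit \<phi>"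
    have \<psi>: "?\<psi> \<in> T" "c t \<in> chart_dom ?\<psi>" using True c_slit_dom slit_chart_in by auto
    have "((\<lambda>t. fst (chart_map ?\<psi> (c t))) has_vector_derivative fst (field_rep \<Gamma> ?\<psi> (chart_map ?\<psi> (c t)))) (at t)"
      by (rule bounded_linear.has_vector_derivative[OF bounded_linear_fst C.c_deriv[OF \<psi>]])
    then have "((chart_map \<phi> \<circ> \<gamma>) has_vector_derivative snd (c t) \<phi>) (at t)"
      using fst_spray_rep[OF \<psi>(1) c_image[OF \<psi>]] by (simp add: slit_map comp_def)
    then show ?thesis using True by (simp add: velocity_def vector_derivative_at)
  next
    case False
    then show ?thesis using M.tangent_space_outside[OF v] by (auto simp: velocity_def)
  qed
qed

lemma natural_lift_eq: "natural_lift M \<gamma> = c"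
  by (rule ext) (simp add: natural_lift_def velocity_eq)

lemma leaf_point_eq: "leaf_point M \<gamma> s t = dilate s (c t)"
  by (simp add: leaf_point_def dilate_def velocity_eq)

lemma lie_transported_iff: "lie_transported M \<Gamma> \<gamma> Z \<longleftrightarrow> transported Z"
  by (simp add: lie_transported_def natural_lift_eq C.linearized_on_UNIV_iff)

lemma base_projection_chart:
  assumes "C.linearized_on Z S" "\<phi> \<in> M" "fst (c t) \<in> chart_dom \<phi>"
  shows "projection Z t \<phi> = fst (Z t (slit \<phi>))"
  using assms tangent_map_fst[OF C.c_carrier] by (simp add: base_projection_def natural_lift_eq C.linearized_on_def)

lemma base_projection_outside:
  "\<not> (\<phi> \<in> M \<and> fst (c t) \<in> chart_dom \<phi>) \<Longrightarrow> projection Z t \<phi> = 0"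
  by (simp add: base_projection_def natural_lift_eq T.tangent_map_outside)

text \<open>In a chart the fibre component of a transported field is the time derivative of the base
  component.\<close>

lemma base_projection_inj:
  assumes Z: "transported Z" and Z': "transported Z'"
    and eq: "projection Z = projection Z'"
  shows "Z = Z'"
proof
  fix t
  obtain \<psi> where \<psi>: "\<psi> \<in> T" "c t \<in> chart_dom \<psi>" by (rule C.c_chart)
  then obtain \<phi> where \<phi>: "\<phi> \<in> M" "\<psi> = slit \<phi>" using T_cases by blast
  have fst_eq: "fst (Z s \<psi>) = fst (Z' s \<psi>)" if "c s \<in> chart_dom \<psi>" for s
    using that base_projection_chart[OF Z \<phi>(1), of s] base_projection_chart[OF Z' \<phi>(1), of s] eq \<phi>(2)
    by (simp add: slit_dom_iff)
  have der: "((\<lambda>s. fst (V s \<psi>)) has_vector_derivative snd (V t \<psi>)) (at t)" if "transported V" for V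
  proof -
    have "C.linearized_at V \<psi> t" using that \<psi> by (simp add: C.linearized_on_def)
    then have "((\<lambda>s. fst (V s \<psi>)) has_vector_derivative fst (field_deriv \<Gamma> \<psi> (chart_map \<psi> (c t)) (V t \<psi>))) (at t)"
      unfolding C.linearized_at_def by (rule bounded_linear.has_vector_derivative[OF bounded_linear_fst])
    then show ?thesis by (simp add: fst_spray_deriv[OF \<psi>(1) c_image[OF \<psi>]])
  qed
  have "\<forall>\<^sub>F s in nhds t. c s \<in> chart_dom \<psi>"
    by (rule C.c_eventually[OF T.openin_chart_dom[OF \<psi>(1)] \<psi>(2)])
  then have "\<forall>\<^sub>F s in nhds t. s \<in> UNIV \<longrightarrow> fst (Z s \<psi>) = fst (Z' s \<psi>)"
    by eventually_elim (simp add: fst_eq)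
  then have "((\<lambda>s. fst (Z s \<psi>)) has_vector_derivative snd (Z' t \<psi>)) (at t)"
    using has_vector_derivative_cong_ev[where x = t and S = UNIV and f = "\<lambda>s. fst (Z s \<psi>)" and g = "\<lambda>s. fst (Z' s \<psi>)"] fst_eq[OF \<psi>(2)] der[OF Z']
    by blast
  then have "snd (Z t \<psi>) = snd (Z' t \<psi>)"
    using der[OF Z] vector_derivative_unique_at by blast
  then have "Z t \<psi> = Z' t \<psi>" using fst_eq[OF \<psi>(2)] by (simp add: prod_eq_iff)
  then show "Z t = Z' t"
    using Z Z' by (intro T.tangent_vector_eqI[OF _ _ \<psi>]) (simp_all add: C.linearized_on_def)
qed

section \<open>Linear structure of transported fields and the two tangential ones\<close>

lemma linearized_on_add:
  assumes Z: "C.linearized_on Z S" and Z': "C.linearized_on Z' S"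
  shows "C.linearized_on (Z + Z') S"
  unfolding C.linearized_on_def
proof (intro conjI allI ballI impI)
  show "(Z + Z') t \<in> tangent_space T (c t)" for t
    using Z Z' subspace_add[OF T.subspace_tangent_space] by (simp add: C.linearized_on_def)
  fix t \<psi> assume t: "t \<in> S" and \<psi>: "\<psi> \<in> T" "c t \<in> chart_dom \<psi>"
  have "linear (field_deriv \<Gamma> \<psi> (chart_map \<psi> (c t)))"
    by (rule has_derivative_linear[OF \<Gamma>.X_deriv[OF \<psi>(1) c_image[OF \<psi>]]])
  then show "C.linearized_at (Z + Z') \<psi> t"
    using Z Z' t \<psi> has_vector_derivative_add[of "\<lambda>s. Z s \<psi>" _ "at t" "\<lambda>s. Z' s \<psi>"]
    by (simp add: C.linearized_on_def C.linearized_at_def linear_add)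
qed

lemma linearized_on_scaleR:
  assumes Z: "C.linearized_on Z S"
  shows "C.linearized_on (r *\<^sub>R Z) S"
  unfolding C.linearized_on_def
proof (intro conjI allI ballI impI)
  show "(r *\<^sub>R Z) t \<in> tangent_space T (c t)" for t
    using Z subspace_scale[OF T.subspace_tangent_space] by (simp add: C.linearized_on_def scaleR_fun_apply)
  fix t \<psi> assume t: "t \<in> S" and \<psi>: "\<psi> \<in> T" "c t \<in> chart_dom \<psi>"
  have "linear (field_deriv \<Gamma> \<psi> (chart_map \<psi> (c t)))"
    by (rule has_derivative_linear[OF \<Gamma>.X_deriv[OF \<psi>(1) c_image[OF \<psi>]]])
  then show "C.linearized_at (r *\<^sub>R Z) \<psi> t"
    using Z t \<psi> bounded_linear.has_vector_derivative[OF bounded_linear_scaleR_right, of "\<lambda>s. Z s \<psi>" _ "at t" r]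
    by (simp add: C.linearized_on_def C.linearized_at_def linear_scale scaleR_fun_apply)
qed

lemma base_projection_add:
  assumes Z: "transported Z" and Z': "transported Z'"
  shows "projection (Z + Z') = projection Z + projection Z'"
proof (intro ext)
  fix t \<phi>
  show "projection (Z + Z') t \<phi> = (projection Z + projection Z') t \<phi>"
    using base_projection_chart[OF Z] base_projection_chart[OF Z'] base_projection_chart[OF linearized_on_add[OF Z Z']]
      base_projection_outside[of \<phi> t]
    by (cases "\<phi> \<in> M \<and> fst (c t) \<in> chart_dom \<phi>") simp_all
qed

lemma base_projection_scaleR:
  assumes Z: "transported Z"
  shows "projection (r *\<^sub>R Z) = r *\<^sub>R projection Z"
proof (intro ext)
  fix t \<phi>
  show "projection (r *\<^sub>R Z) t \<phi> = (r *\<^sub>R projection Z) t \<phi>"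
    using base_projection_chart[OF Z] base_projection_chart[OF linearized_on_scaleR[OF Z]]
      base_projection_outside[of \<phi> t]
    by (cases "\<phi> \<in> M \<and> fst (c t) \<in> chart_dom \<phi>") (simp_all add: scaleR_fun_apply)
qed

text \<open>The time derivative of a solution of an autonomous equation solves its
  linearization.\<close>

lemma spray_field_transported: "transported (\<lambda>t. \<Gamma> (c t))"
  unfolding C.linearized_on_def
proof (intro conjI allI ballI impI)
  show "\<Gamma> (c t) \<in> tangent_space T (c t)" for t by (rule \<Gamma>.X_tangent[OF C.c_carrier])
  fix t \<psi> assume \<psi>: "\<psi> \<in> T" "c t \<in> chart_dom \<psi>"
  let ?z = "\<lambda>t. chart_map \<psi> (c t)"
  have "((\<lambda>s. field_rep \<Gamma> \<psi> (?z s)) has_vector_derivative field_deriv \<Gamma> \<psi> (?z t) (field_rep \<Gamma> \<psi> (?z t))) (at t)"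
    using vector_derivative_diff_chain_within[OF C.c_deriv[OF \<psi>] has_derivative_at_withinI[OF \<Gamma>.X_deriv[OF \<psi>(1) c_image[OF \<psi>]]]]
    by (simp add: comp_def)
  moreover have "\<forall>\<^sub>F s in nhds t. s \<in> UNIV \<longrightarrow> field_rep \<Gamma> \<psi> (?z s) = \<Gamma> (c s) \<psi>"
    using C.c_eventually[OF T.openin_chart_dom[OF \<psi>(1)] \<psi>(2)] by eventually_elim (simp add: \<Gamma>.X_chart[OF \<psi>(1)])
  ultimately show "C.linearized_at (\<lambda>t. \<Gamma> (c t)) \<psi> t"
    unfolding C.linearized_at_def
    using has_vector_derivative_cong_ev[where x = t and S = UNIV and f = "\<lambda>s. field_rep \<Gamma> \<psi> (?z s)" and g = "\<lambda>s. \<Gamma> (c s) \<psi>"] \<Gamma>.X_chart[OF \<psi>] by simp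
qed

text \<open>By \<open>spray_euler\<close> the linearization sends \<Delta> = (0, y) to \<Gamma> plus
  the time derivative of (0, y). The excess \<Gamma> is exactly what differentiating the factor
  \<open>t\<close> contributes on the other side.\<close>

lemma liouville_spray_field_transported: "transported (\<lambda>t. \<Delta> (c t) + t *\<^sub>R \<Gamma> (c t))"
  unfolding C.linearized_on_def
proof (intro conjI allI ballI impI)
  show "\<Delta> (c t) + t *\<^sub>R \<Gamma> (c t) \<in> tangent_space T (c t)" for t
    by (intro subspace_add[OF T.subspace_tangent_space] subspace_scale[OF T.subspace_tangent_space]
        \<Gamma>.X_tangent \<Delta>.X_tangent C.c_carrier)
  fix t \<psi> assume \<psi>: "\<psi> \<in> T" "c t \<in> chart_dom \<psi>"
  let ?z = "\<lambda>t. chart_map \<psi> (c t)"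
  let ?f = "field_rep \<Gamma> \<psi> (?z t)" and ?D = "field_deriv \<Gamma> \<psi> (?z t)"
  have "((\<lambda>s. \<Gamma> (c s) \<psi>) has_vector_derivative ?D ?f) (at t)"
    using spray_field_transported \<psi> by (simp add: C.linearized_on_def C.linearized_at_def \<Gamma>.X_chart)
  moreover have "((\<lambda>s. s) has_vector_derivative 1) (at t)" by (rule has_vector_derivative_id)
  ultimately have "((\<lambda>s. s *\<^sub>R \<Gamma> (c s) \<psi>) has_vector_derivative t *\<^sub>R ?D ?f + ?f) (at t)"
    by (auto intro!: derivative_eq_intros simp: \<Gamma>.X_chart[OF \<psi>] has_real_derivative_iff_has_vector_derivative)
  moreover have "((\<lambda>s. (0, snd (?z s))) has_vector_derivative (0, snd ?f)) (at t)"
    by (rule bounded_linear.has_vector_derivative[where f = "\<lambda>z. (0, snd z)" and g = ?z, OF _ C.c_deriv[OF \<psi>]])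
      (intro bounded_linear_intros)
  ultimately have "((\<lambda>s. (0, snd (?z s)) + s *\<^sub>R \<Gamma> (c s) \<psi>) has_vector_derivative (0, snd ?f) + (t *\<^sub>R ?D ?f + ?f)) (at t)"
    by (intro has_vector_derivative_add)
  moreover have "\<forall>\<^sub>F s in nhds t. s \<in> UNIV \<longrightarrow>
      (0, snd (?z s)) + s *\<^sub>R \<Gamma> (c s) \<psi> = (\<Delta> (c s) + s *\<^sub>R \<Gamma> (c s)) \<psi>"
    using C.c_eventually[OF T.openin_chart_dom[OF \<psi>(1)] \<psi>(2)]
    by eventually_elim (simp add: liouville_chart[OF \<psi>(1)] scaleR_fun_apply)
  moreover have "(0, snd ?f) + (t *\<^sub>R ?D ?f + ?f) = ?D ((\<Delta> (c t) + t *\<^sub>R \<Gamma> (c t)) \<psi>)"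
  proof -
    have lin: "linear ?D" by (rule has_derivative_linear[OF \<Gamma>.X_deriv[OF \<psi>(1) c_image[OF \<psi>]]])
    show ?thesis
      using spray_euler[OF \<psi>(1) c_image[OF \<psi>]]
      by (simp add: liouville_chart[OF \<psi>] scaleR_fun_apply linear_add[OF lin] linear_scale[OF lin] \<Gamma>.X_chart[OF \<psi>])
  qed
  ultimately show "C.linearized_at (\<lambda>t. \<Delta> (c t) + t *\<^sub>R \<Gamma> (c t)) \<psi> t"
    unfolding C.linearized_at_def
    using has_vector_derivative_cong_ev[where x = t and S = UNIV and f = "\<lambda>s. (0, snd (?z s)) + s *\<^sub>R \<Gamma> (c s) \<psi>"
        and g = "\<lambda>s. (\<Delta> (c s) + s *\<^sub>R \<Gamma> (c s)) \<psi>"] liouville_chart[OF \<psi>]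
    by (simp add: scaleR_fun_apply)
qed

lemma base_projection_spray_field: "projection (\<lambda>t. \<Gamma> (c t)) = velocity M \<gamma>"
proof (intro ext)
  fix t \<phi>
  have v: "snd (c t) \<in> tangent_space M (fst (c t))"
    using C.c_carrier[of t] by (simp add: carrier_T_iff)
  show "projection (\<lambda>t. \<Gamma> (c t)) t \<phi> = velocity M \<gamma> t \<phi>"
  proof (cases "\<phi> \<in> M \<and> fst (c t) \<in> chart_dom \<phi>")
    case True
    then show ?thesis
      using base_projection_chart[OF spray_field_transported] fst_spray_chart[OF slit_chart_in c_slit_dom]
      by (simp add: velocity_eq slit_map)
  next
    case False
    then show ?thesis using base_projection_outside M.tangent_space_outside[OF v] by (simp add: velocity_eq)
  qed
qed

lemma base_projection_liouville_spray_field: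
  "projection (\<lambda>t. \<Delta> (c t) + t *\<^sub>R \<Gamma> (c t)) = (\<lambda>t. t *\<^sub>R velocity M \<gamma> t)"
proof (intro ext)
  fix t \<phi>
  have v: "snd (c t) \<in> tangent_space M (fst (c t))"
    using C.c_carrier[of t] by (simp add: carrier_T_iff)
  show "projection (\<lambda>t. \<Delta> (c t) + t *\<^sub>R \<Gamma> (c t)) t \<phi> = (t *\<^sub>R velocity M \<gamma> t) \<phi>"
  proof (cases "\<phi> \<in> M \<and> fst (c t) \<in> chart_dom \<phi>")
    case True
    then show ?thesis
      using base_projection_chart[OF liouville_spray_field_transported] fst_spray_chart[OF slit_chart_in c_slit_dom]
        liouville_chart[OF slit_chart_in c_slit_dom]
      by (simp add: velocity_eq slit_map scaleR_fun_apply)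
  next
    case False
    then show ?thesis
      using base_projection_outside M.tangent_space_outside[OF v] by (simp add: velocity_eq scaleR_fun_apply)
  qed
qed

section \<open>Extension of a transported field over the leaf\<close>

text \<open>By homogeneity \<Gamma> at the dilated point is the dilated \<Gamma> times
  \<open>exp s\<close>; this extra factor is produced by the time change
  \<open>exp s * \<tau>\<close>.\<close>

lemma dilated_integral_curve: "integral_curve T \<Gamma> UNIV (\<lambda>\<tau>. dilate s (c (exp s * \<tau>)))"
  unfolding integral_curve_def
proof (intro conjI ballI impI)
  have "continuous_map euclidean (atlas_topology T) (dilate s \<circ> (c \<circ> (\<lambda>\<tau>. exp s * \<tau>)))"
    using integral_c dilate_continuous[of s]
    by (intro continuous_map_compose[of _ "atlas_topology T"] continuous_map_compose[of _ euclidean])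
      (auto simp: integral_curve_def continuous_map_iff_continuous2 intro!: continuous_intros)
  then show "continuous_map (top_of_set UNIV) (atlas_topology T) (\<lambda>\<tau>. dilate s (c (exp s * \<tau>)))"
    by (simp add: comp_def)
  fix \<tau> \<psi> assume \<psi>: "\<psi> \<in> T" and "dilate s (c (exp s * \<tau>)) \<in> chart_dom \<psi>"
  then have dom: "c (exp s * \<tau>) \<in> chart_dom \<psi>" "dilate s (c (exp s * \<tau>)) \<in> chart_dom \<psi>"
    using dilate_dom_iff by auto
  let ?z = "chart_map \<psi> (c (exp s * \<tau>))"
  have "((\<lambda>\<tau>. exp s * \<tau>) has_vector_derivative exp s) (at \<tau>)"
    by (auto intro!: derivative_eq_intros)
  from vector_diff_chain_at[OF this C.c_deriv[OF \<psi> dom(1)]]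
  have "((\<lambda>\<tau>. chart_map \<psi> (c (exp s * \<tau>))) has_vector_derivative exp s *\<^sub>R field_rep \<Gamma> \<psi> ?z) (at \<tau>)"
    by (simp add: comp_def)
  from bounded_linear.has_vector_derivative[OF bounded_linear_fibre_scale this, of s]
  have "((\<lambda>\<tau>. chart_map \<psi> (dilate s (c (exp s * \<tau>)))) has_vector_derivative
      exp s *\<^sub>R fibre_scale s (field_rep \<Gamma> \<psi> ?z)) (at \<tau>)"
    by (simp add: dilate_map[OF \<psi>] bounded_linear.linear[OF bounded_linear_fibre_scale] linear_scale)
  moreover have "\<Gamma> (dilate s (c (exp s * \<tau>))) \<psi> = exp s *\<^sub>R fibre_scale s (field_rep \<Gamma> \<psi> ?z)"
    using \<Gamma>.X_chart[OF \<psi> dom(2)] spray_homogeneous[OF \<psi> c_image[OF \<psi> dom(1)], of s] by (simp add: dilate_map[OF \<psi>])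
  ultimately show "((chart_map \<psi> \<circ> (\<lambda>\<tau>. dilate s (c (exp s * \<tau>)))) has_vector_derivative
      \<Gamma> (dilate s (c (exp s * \<tau>))) \<psi>) (at \<tau>)"
    by (simp add: comp_def)
qed auto

text \<open>The flow of \<Delta> consists of dilations, so pushing \<open>Z\<close> forward by their
  differentials gives invariance under \<Delta>.\<close>

definition extension :: "(real \<Rightarrow> ('m, 'e) slit_tangent) \<Rightarrow> real \<Rightarrow> real \<Rightarrow> ('m, 'e) slit_tangent" where
  "extension Z s t = tangent_map T T (dilate s) (c t) (Z t)"

lemma
  assumes "transported Z"
  shows extension_tangent: "extension Z s t \<in> tangent_space T (dilate s (c t))"
    and extension_chart: "\<psi> \<in> T \<Longrightarrow> c t \<in> chart_dom \<psi> \<Longrightarrow> extension Z s t \<psi> = fibre_scale s (Z t \<psi>)"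
  using dilate_tangent_map[OF C.c_carrier] assms by (auto simp: extension_def C.linearized_on_def)

lemma extension_0:
  assumes Z: "transported Z"
  shows "extension Z 0 t = Z t"
proof -
  obtain \<psi> where \<psi>: "\<psi> \<in> T" "c t \<in> chart_dom \<psi>" by (rule C.c_chart)
  show ?thesis
    using extension_tangent[OF Z, of 0 t] extension_chart[OF Z \<psi>, of 0] Z
    by (intro T.tangent_vector_eqI[OF _ _ \<psi>]) (simp_all add: C.linearized_on_def)
qed

lemma ray_complete_curve: "complete_curve T \<Delta> (\<lambda>\<sigma>. dilate \<sigma> (c t))"
  by unfold_locales (rule dilate_integral_curve[OF C.c_carrier])

lemma extension_along_ray:
  assumes Z: "transported Z"
  shows "complete_curve.linearized_on T \<Delta> (\<lambda>\<sigma>. dilate \<sigma> (c t)) (\<lambda>\<sigma>. extension Z \<sigma> t) UNIV"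
proof -
  interpret R: complete_curve "slit_tangent_bundle M" "\<Delta>" "\<lambda>\<sigma>. dilate \<sigma> (c t)"
    by (rule ray_complete_curve)
  show ?thesis
    unfolding R.linearized_on_def
  proof (intro conjI allI ballI impI)
    show "extension Z \<sigma> t \<in> tangent_space T (dilate \<sigma> (c t))" for \<sigma> by (rule extension_tangent[OF Z])
    fix \<sigma> \<psi> assume \<psi>: "\<psi> \<in> T" and "dilate \<sigma> (c t) \<in> chart_dom \<psi>"
    then have dom: "c t \<in> chart_dom \<psi>" using dilate_dom_iff by auto
    have "chart_map \<psi> (dilate \<sigma> (c t)) \<in> chart_range \<psi>"
      using \<open>dilate \<sigma> (c t) \<in> chart_dom \<psi>\<close> by blast
    then show "R.linearized_at (\<lambda>\<sigma>. extension Z \<sigma> t) \<psi> \<sigma>"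
      unfolding R.linearized_at_def
      using fibre_scale_has_vector_derivative[of "Z t \<psi>" \<sigma>]
      by (simp add: extension_chart[OF Z \<psi> dom] liouville_deriv[OF \<psi>])
  qed
qed

text \<open>Invariance under \<Delta> is built into the construction. For \<Gamma>, the time change
  contributes a factor \<open>exp s\<close>, and \<open>spray_deriv_homogeneous\<close> absorbs it
  together with \<open>fibre_scale s\<close> into the linearization at the dilated point.\<close>

lemma leaf_extension_exists:
  assumes Z: "transported Z"
  shows "leaf_extension M \<Gamma> \<gamma> Z (extension Z)"
  unfolding leaf_extension_def leaf_point_eq
proof (intro conjI allI)
  show "extension Z s t \<in> tangent_space T (dilate s (c t))" for s t by (rule extension_tangent[OF Z])
  show "extension Z 0 t = Z t" for t by (rule extension_0[OF Z])
  show "has_lie_derivative T \<Delta> (\<lambda>\<sigma>. dilate \<sigma> (c t)) (\<lambda>\<sigma>. extension Z \<sigma> t) s 0" for s t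
  proof -
    interpret R: complete_curve "slit_tangent_bundle M" "\<Delta>" "\<lambda>\<sigma>. dilate \<sigma> (c t)"
      by (rule ray_complete_curve)
    show ?thesis using extension_along_ray[OF Z, of t] R.linearized_on_UNIV_iff by blast
  qed
  show "has_lie_derivative T \<Gamma> (\<lambda>\<tau>. dilate s (c (exp s * \<tau>))) (\<lambda>\<tau>. extension Z s (exp s * \<tau>)) \<tau> 0" for s \<tau>
  proof -
    interpret D: complete_curve "slit_tangent_bundle M" \<Gamma> "\<lambda>\<tau>. dilate s (c (exp s * \<tau>))"
      by unfold_locales (rule dilated_integral_curve)
    have "D.linearized_on (\<lambda>\<tau>. extension Z s (exp s * \<tau>)) UNIV"
      unfolding D.linearized_on_def
    proof (intro conjI allI ballI impI)
      show "extension Z s (exp s * \<tau>) \<in> tangent_space T (dilate s (c (exp s * \<tau>)))" for \<tau>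
        by (rule extension_tangent[OF Z])
      fix \<tau> \<psi> assume \<psi>: "\<psi> \<in> T" and "dilate s (c (exp s * \<tau>)) \<in> chart_dom \<psi>"
      then have dom: "c (exp s * \<tau>) \<in> chart_dom \<psi>" using dilate_dom_iff by auto
      let ?t = "exp s * \<tau>"
      let ?z = "chart_map \<psi> (c ?t)"
      have "((\<lambda>\<tau>. exp s * \<tau>) has_vector_derivative exp s) (at \<tau>)"
        by (auto intro!: derivative_eq_intros)
      moreover have "((\<lambda>t. Z t \<psi>) has_vector_derivative field_deriv \<Gamma> \<psi> ?z (Z ?t \<psi>)) (at ?t)"
        using Z \<psi> dom by (simp add: C.linearized_on_def C.linearized_at_def)
      ultimately have "((\<lambda>\<tau>. Z (exp s * \<tau>) \<psi>) has_vector_derivative exp s *\<^sub>R field_deriv \<Gamma> \<psi> ?z (Z ?t \<psi>)) (at \<tau>)"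
        using vector_diff_chain_at[of "\<lambda>\<tau>. exp s * \<tau>" "exp s" \<tau> "\<lambda>t. Z t \<psi>"] by (simp add: comp_def)
      from bounded_linear.has_vector_derivative[OF bounded_linear_fibre_scale this, of s]
      have der: "((\<lambda>\<tau>. fibre_scale s (Z (exp s * \<tau>) \<psi>)) has_vector_derivative
          field_deriv \<Gamma> \<psi> (fibre_scale s ?z) (fibre_scale s (Z ?t \<psi>))) (at \<tau>)"
        by (simp add: spray_deriv_homogeneous[OF \<psi> c_image[OF \<psi> dom]]
            bounded_linear.linear[OF bounded_linear_fibre_scale] linear_scale)
      have "\<forall>\<^sub>F r in nhds \<tau>. dilate s (c (exp s * r)) \<in> chart_dom \<psi>"
        using D.c_eventually[OF T.openin_chart_dom[OF \<psi>]] \<open>dilate s (c (exp s * \<tau>)) \<in> chart_dom \<psi>\<close> by blast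
      then have "\<forall>\<^sub>F r in nhds \<tau>. r \<in> UNIV \<longrightarrow> fibre_scale s (Z (exp s * r) \<psi>) = extension Z s (exp s * r) \<psi>"
        by eventually_elim (simp add: dilate_dom_iff[OF \<psi>] extension_chart[OF Z \<psi>])
      from has_vector_derivative_cong_ev[OF this] der
      show "D.linearized_at (\<lambda>\<tau>. extension Z s (exp s * \<tau>)) \<psi> \<tau>"
        unfolding D.linearized_at_def by (simp add: extension_chart[OF Z \<psi> dom] dilate_map[OF \<psi>])
    qed
    then show ?thesis using D.linearized_on_UNIV_iff by blast
  qed
qed

end

subsection \<open>The map to the path space\<close>

text \<open>The first isomorphism theorem for spaces given as subsets, with cosets as elements of
  the quotient.\<close>

lemma induced_quotient_isomorphism:
  fixes V K :: "'a::real_vector set" and W :: "'b::real_vector set"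
  assumes lin: "linear_map_on V W j" and K: "subspace K" "K \<subseteq> V"
    and ker: "\<And>x. x \<in> V \<Longrightarrow> j x = 0 \<longleftrightarrow> x \<in> K" and surj: "j ` V = W"
  shows "\<exists>j0. (\<forall>x\<in>V. j0 (coset K x) = j x) \<and> linear_map_on_quotient V K W j0 \<and>
    bij_betw j0 (quotient_space V K) W"
proof -
  have V: "subspace V" and W: "subspace W" and add: "\<And>x y. x \<in> V \<Longrightarrow> y \<in> V \<Longrightarrow> j (x + y) = j x + j y"
    and scale: "\<And>r x. x \<in> V \<Longrightarrow> j (r *\<^sub>R x) = r *\<^sub>R j x" and jW: "\<And>x. x \<in> V \<Longrightarrow> j x \<in> W"
    using lin by (auto simp: linear_map_on_def)
  \<comment> \<open>Any representative serves, since two of them differ by an element of the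
    kernel.\<close>
  define j0 where "j0 A = j (SOME x. x \<in> A)" for A
  have j0: "j0 (coset K x) = j x" if x: "x \<in> V" for x
  proof -
    have "x \<in> coset K x" using subspace_0[OF K(1)] by (force simp: coset_def)
    then have "(SOME y. y \<in> coset K x) \<in> coset K x" by (rule someI)
    then obtain k where "k \<in> K" "(SOME y. y \<in> coset K x) = x + k" by (auto simp: coset_def)
    then show ?thesis using add[OF x, of k] ker[of k] K(2) by (auto simp: j0_def)
  qed
  have coset_add: "coset K x + coset K y = coset K (x + y)" for x y
  proof (intro equalityI subsetI)
    fix z assume "z \<in> coset K x + coset K y"
    then obtain k l where kl: "k \<in> K" "l \<in> K" and z: "z = (x + k) + (y + l)"
      by (auto simp: coset_def set_plus_def)
    have "z = (x + y) + (k + l)" by (simp add: z algebra_simps)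
    then show "z \<in> coset K (x + y)" using subspace_add[OF K(1) kl] unfolding coset_def by blast
  next
    fix z assume "z \<in> coset K (x + y)"
    then obtain k where k: "k \<in> K" and z: "z = (x + 0) + (y + k)"
      by (auto simp: coset_def algebra_simps)
    then show "z \<in> coset K x + coset K y"
      using subspace_0[OF K(1)] unfolding z by (intro set_plus_intro) (auto simp: coset_def)
  qed
  have coset_scale: "(\<lambda>x. r *\<^sub>R x) ` coset K x + K = coset K (r *\<^sub>R x)" for r x
  proof (intro equalityI subsetI)
    fix z assume "z \<in> (\<lambda>x. r *\<^sub>R x) ` coset K x + K"
    then obtain k l where kl: "k \<in> K" "l \<in> K" and z: "z = r *\<^sub>R (x + k) + l"
      by (auto simp: coset_def set_plus_def)
    have "z = r *\<^sub>R x + (r *\<^sub>R k + l)" by (simp add: z algebra_simps)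
    then show "z \<in> coset K (r *\<^sub>R x)"
      using subspace_add[OF K(1) subspace_scale[OF K(1) kl(1)] kl(2)] unfolding coset_def by blast
  next
    fix z assume "z \<in> coset K (r *\<^sub>R x)"
    then obtain k where k: "k \<in> K" and z: "z = r *\<^sub>R x + k" by (auto simp: coset_def)
    have "x \<in> coset K x" using subspace_0[OF K(1)] by (force simp: coset_def)
    then show "z \<in> (\<lambda>x. r *\<^sub>R x) ` coset K x + K"
      unfolding z using k by (intro set_plus_intro imageI)
  qed
  have "linear_map_on_quotient V K W j0"
    unfolding linear_map_on_quotient_def quotient_space_def
    using V K W jW by (auto simp: j0 coset_add coset_scale add scale subspace_add subspace_scale)
  moreover have "bij_betw j0 (quotient_space V K) W"
    unfolding bij_betw_def
  proof
    show "inj_on j0 (quotient_space V K)"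
    proof (rule inj_onI)
      fix A B assume "A \<in> quotient_space V K" "B \<in> quotient_space V K" and eq: "j0 A = j0 B"
      then obtain x y where x: "x \<in> V" "A = coset K x" and y: "y \<in> V" "B = coset K y"
        by (auto simp: quotient_space_def)
      have "j (x - y) = j x - j y"
        using add[of x "- y"] scale[of y "- 1"] x y subspace_neg[OF V] by simp
      then have "x - y \<in> K" using ker[of "x - y"] subspace_diff[OF V] x y eq j0 by simp
      \<comment> \<open>The coset of any element of \<open>K\<close> is \<open>K\<close> itself.
        Adding \<open>coset K y\<close> to both sides of this equation gives
        \<open>A = B\<close>.\<close>
      then have "coset K (x - y) = coset K 0"
      proof -
        have "coset K k \<subseteq> K" "K \<subseteq> coset K k" if "k \<in> K" for k
        proof -
          show "coset K k \<subseteq> K" using that subspace_add[OF K(1)] by (auto simp: coset_def)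
          show "K \<subseteq> coset K k"
          proof
            fix l assume "l \<in> K"
            then have "l - k \<in> K" using that subspace_diff[OF K(1)] by blast
            moreover have "l = k + (l - k)" by simp
            ultimately show "l \<in> coset K k" unfolding coset_def by blast
          qed
        qed
        then show ?thesis using \<open>x - y \<in> K\<close> subspace_0[OF K(1)] by (metis antisym)
      qed
      then show "A = B"
        using coset_add[of y "x - y"] coset_add[of y 0] x y by simp
    qed
    show "j0 ` quotient_space V K = W"
      using surj j0 by (auto simp: quotient_space_def image_image)
  qed
  ultimately show ?thesis using j0 by blast
qed

text \<open>A third independent kernel vector could be completed to a basis of the domain. The
  remaining basis vectors, fewer than \<open>DIM('b)\<close>, would then have images spanning the
  target.\<close>

lemma kernel_subset_span2:
  fixes G :: "'a::euclidean_space \<Rightarrow> 'b::euclidean_space"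
  assumes G: "linear G" "surj G" and dim: "DIM('a) \<le> DIM('b) + 2"
    and x: "G x = 0" "x \<noteq> 0" and y: "G y = 0" "y \<notin> span {x}" and w: "G w = 0"
  shows "w \<in> span {x, y}"
proof (rule ccontr)
  assume w': "w \<notin> span {x, y}"
  let ?S = "{w, y, x}"
  have ind: "independent ?S"
    using x y w' by (intro independent_insertI independent_empty) (auto simp: insert_commute)
  then obtain B where B: "?S \<subseteq> B" "independent B" "span B = UNIV"
    using maximal_independent_subset_extend[of ?S UNIV] by (metis span_UNIV span_eq subset_UNIV top.extremum_uniqueI)
  have fin: "finite B" and card: "card B = DIM('a)"
    using independent_imp_finite[OF B(2)] dim_span_eq_card_independent[OF B(2)] B(3) by simp_all
  have "w \<noteq> x" "w \<noteq> y" "y \<noteq> x"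
    using y w' span_base[of x "{x, y}"] span_base[of y "{x, y}"] span_base[of x "{x}"] by auto
  then have "card ?S = 3" by simp
  then have "card (B - ?S) = DIM('a) - 3"
    using card_Diff_subset[of ?S B] B(1) card by simp
  \<comment> \<open>This makes the natural-number subtraction \<open>DIM('a) - 3\<close>
    exact.\<close>
  moreover have "DIM('a) \<ge> 3"
    using card_mono[OF fin B(1)] \<open>card ?S = 3\<close> card by simp
  ultimately have small: "card (B - ?S) < DIM('b)" using dim by simp
  have "UNIV = span (G ` B)"
    using G B(3) linear_span_image[OF G(1), of B] by simp
  also have "\<dots> \<subseteq> span (G ` (B - ?S))"
  proof (rule span_minimal)
    show "G ` B \<subseteq> span (G ` (B - ?S))"
    proof
      fix z assume "z \<in> G ` B"
      then obtain b where b: "b \<in> B" "z = G b" by blast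
      show "z \<in> span (G ` (B - ?S))"
      proof (cases "b \<in> ?S")
        case True
        then have "z = 0" using b x y w by auto
        then show ?thesis by (simp add: span_zero)
      next
        case False
        then show ?thesis using b by (intro span_base) blast
      qed
    qed
  qed simp
  finally have "DIM('b) \<le> card (G ` (B - ?S))"
    using dim_le_card[of UNIV "G ` (B - ?S)"] fin by simp
  also have "\<dots> \<le> card (B - ?S)"
    using fin by (intro card_image_le) simp
  finally show False using small by simp
qed

section \<open>The differential of the projection to the path space\<close>

locale spray_path_space = spray_geodesic M \<Gamma> c
  for M :: "('m, 'e::euclidean_space) atlas" and \<Gamma> and c +
  fixes P :: "('p, 'q::euclidean_space) atlas"
    and \<pi> :: "'m \<times> ('m, 'e) tangent \<Rightarrow> 'p"
  assumes path_space: "path_space M \<Gamma> P \<pi>"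

sublocale spray_path_space \<subseteq> P: differentiable_atlas P
  using path_space by (intro smooth_atlas_differentiable_atlas) (simp add: path_space_def smooth_manifold_def)

context spray_path_space
begin

lemma smooth_\<pi>: "smooth_map T P \<pi>"
  using path_space by (simp add: path_space_def)

abbreviation d\<pi> :: "'m \<times> ('m, 'e) tangent \<Rightarrow> ('m, 'e) slit_tangent \<Rightarrow> ('p, 'q) tangent" where
  "d\<pi> \<equiv> tangent_map T P \<pi>"

lemma d\<pi>_image: "u \<in> carrier_of T \<Longrightarrow> d\<pi> u ` tangent_space T u = tangent_space P (\<pi> u)"
  using path_space by (simp add: path_space_def)

text \<open>The fibre through \<open>u\<close> is a leaf, hence an integral manifold \<open>B\<close> on which \<open>\<pi>\<close> is constant.\<close>

lemma d\<pi>_distribution: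
  assumes u: "u \<in> carrier_of T" and d: "d \<in> spray_distribution M \<Gamma> u"
  shows "d\<pi> u d = 0"
proof -
  let ?F = "{w \<in> carrier_of T. \<pi> w = \<pi> u}"
  have "\<pi> u \<in> carrier_of P" using path_space u unfolding path_space_def by blast
  then have "leaf T (spray_distribution M \<Gamma>) ?F"
    using path_space unfolding path_space_def by blast
  then obtain B where B: "connected_integral_manifold T (spray_distribution M \<Gamma>) B" "carrier_of B = ?F"
    unfolding leaf_def by blast
  interpret B: differentiable_atlas B
    using B(1) by (intro smooth_atlas_differentiable_atlas) (simp add: connected_integral_manifold_def smooth_manifold_def)
  let ?i = "\<lambda>w. w"
  have smooth_i: "smooth_map B T ?i"
    using B(1) by (simp add: connected_integral_manifold_def)
  then have cont: "continuous_map (atlas_topology B) (atlas_topology T) ?i" by (simp add: smooth_map_def)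
  have uB: "u \<in> carrier_of B" using u B(2) by simp
  have "d \<in> tangent_map B T ?i u ` tangent_space B u"
    using B(1) uB d unfolding connected_integral_manifold_def bij_betw_def by blast
  then obtain b where b: "b \<in> tangent_space B u" "d = tangent_map B T ?i u b" by blast
  have dT: "d \<in> tangent_space T u"
    using tangent_map_smooth_in[OF B.differentiable_atlas_axioms T_differentiable_atlas smooth_i uB b(1)] b(2) by simp
  obtain \<beta> where \<beta>: "\<beta> \<in> B" "u \<in> chart_dom \<beta>" using uB by (auto simp: carrier_of_def)
  obtain \<psi> where \<psi>: "\<psi> \<in> T" "u \<in> chart_dom \<psi>" using u by (auto simp: carrier_of_def)
  obtain V where V: "open V" "chart_map \<beta> u \<in> V" "V \<subseteq> chart_range \<beta>"
    and V\<psi>: "\<And>x. x \<in> V \<Longrightarrow> chart_inv \<beta> x \<in> chart_dom \<psi>"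
    using B.continuous_map_chart_near[OF cont \<beta> T.openin_chart_dom[OF \<psi>(1)] \<psi>(2)] by blast
  have "d\<pi> u d \<theta> = 0" for \<theta>
  proof (cases "\<theta> \<in> P \<and> \<pi> u \<in> chart_dom \<theta>")
    case True
    then have \<theta>: "\<theta> \<in> P" "\<pi> u \<in> chart_dom \<theta>" by auto
    let ?I = "local_rep \<beta> \<psi> ?i" and ?G = "local_rep \<psi> \<theta> \<pi>"
    let ?I' = "frechet_derivative ?I (at (chart_map \<beta> u))" and ?G' = "frechet_derivative ?G (at (chart_map \<psi> u))"
    have I: "(?I has_derivative ?I') (at (chart_map \<beta> u))"
      by (rule B.tangent_map_smooth(1)[OF smooth_i \<beta> \<psi>])
    have "(?G has_derivative ?G') (at (?I (chart_map \<beta> u)))"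
      using T.tangent_map_smooth(1)[OF smooth_\<pi> \<psi> \<theta>] by (simp add: B.chart_inv_chart_map[OF \<beta>])
    from diff_chain_at[OF I this]
    have "((\<lambda>x. chart_map \<theta> (\<pi> u)) has_derivative ?G' \<circ> ?I') (at (chart_map \<beta> u))"
    proof (rule has_derivative_transform_within_open[OF _ V(1,2)])
      fix x assume x: "x \<in> V"
      have "chart_inv \<beta> x \<in> carrier_of B"
        using chart_map_chart_inv(2)[of x \<beta> "chart_dom \<beta>"] V(3) x \<beta>(1) by (auto simp: carrier_of_def)
      then have "\<pi> (chart_inv \<beta> x) = \<pi> u" using B(2) by simp
      then show "(?G \<circ> ?I) x = chart_map \<theta> (\<pi> u)"
        using T.chart_inv_chart_map[OF \<psi>(1) V\<psi>[OF x]] by simp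
    qed
    then have "?G' \<circ> ?I' = (\<lambda>x. 0)"
      using has_derivative_unique[OF _ has_derivative_const] by blast
    then have "?G' (?I' (b \<beta>)) = 0" by (metis comp_apply)
    then show ?thesis
      using T.tangent_map_smooth(2)[OF smooth_\<pi> \<psi> \<theta> dT] B.tangent_map_smooth(2)[OF smooth_i \<beta> \<psi> b(1)] b(2) by simp
  next
    case False
    then show ?thesis by (rule T.tangent_map_outside)
  qed
  then show ?thesis by (simp add: fun_eq_iff)
qed

lemma d\<pi>_spray: "u \<in> carrier_of T \<Longrightarrow> d\<pi> u (\<Gamma> u) = 0"
  and d\<pi>_liouville: "u \<in> carrier_of T \<Longrightarrow> d\<pi> u (\<Delta> u) = 0"
  by (rule d\<pi>_distribution; simp add: spray_distribution_def span_base)+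

text \<open>Two steps through the leaf: along the dilation orbit to \<open>s = 0\<close>, then along
  \<open>c\<close> to time 0. The first uses that \<pi> is a first integral of \<Delta>, the second
  that it is one of \<Gamma>.\<close>

lemma d\<pi>_extension:
  assumes Z: "transported Z"
  shows "d\<pi> (dilate s (c t)) (extension Z s t) = d\<pi> (c 0) (Z 0)"
proof -
  interpret R: complete_curve "slit_tangent_bundle M" "\<Delta>" "\<lambda>\<sigma>. dilate \<sigma> (c t)"
    by (rule ray_complete_curve)
  have "d\<pi> (dilate s (c t)) (extension Z s t) = d\<pi> (dilate 0 (c t)) (extension Z 0 t)"
    using R.first_integral_transported[OF P.differentiable_atlas_axioms smooth_\<pi> d\<pi>_liouville extension_along_ray[OF Z]]
    by blast
  also have "\<dots> = d\<pi> (c 0) (Z 0)"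
    using C.first_integral_transported[OF P.differentiable_atlas_axioms smooth_\<pi> d\<pi>_spray Z, of t 0]
    by (simp add: extension_0[OF Z])
  finally show ?thesis .
qed

text \<open>\<open>extension\<close> supplies a witness. The value is unique because the projection
  determines \<open>Z\<close> and every admissible \<open>Y\<close> satisfies
  \<open>Y 0 0 = Z 0\<close>, so it can be read off at the parameters (0, 0).\<close>

lemma jacobi_to_path_space_eq:
  assumes Z: "transported Z"
  shows "jacobi_to_path_space M \<Gamma> P \<pi> \<gamma> (projection Z) = d\<pi> (c 0) (Z 0)"
  unfolding jacobi_to_path_space_def leaf_point_eq lie_transported_iff
proof (rule the_equality)
  show "\<exists>Z' Y. transported Z' \<and> projection Z' = projection Z \<and>
      leaf_extension M \<Gamma> \<gamma> Z' Y \<and> (\<forall>s t. d\<pi> (dilate s (c t)) (Y s t) = d\<pi> (c 0) (Z 0))"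
    using Z leaf_extension_exists[OF Z] d\<pi>_extension[OF Z] by blast
  fix w assume "\<exists>Z' Y. transported Z' \<and> projection Z' = projection Z \<and>
      leaf_extension M \<Gamma> \<gamma> Z' Y \<and> (\<forall>s t. d\<pi> (dilate s (c t)) (Y s t) = w)"
  then obtain Z' Y where Z': "transported Z'" "projection Z' = projection Z"
    and Y: "leaf_extension M \<Gamma> \<gamma> Z' Y" "\<And>s t. d\<pi> (dilate s (c t)) (Y s t) = w" by blast
  have "Z' = Z" by (rule base_projection_inj[OF Z'(1) Z Z'(2)])
  then have "Y 0 0 = Z 0" using Y(1) by (simp add: leaf_extension_def)
  then show "w = d\<pi> (c 0) (Z 0)" using Y(2)[of 0 0] by simp
qed

text \<open>The dimensions drop by 2, so two independent kernel vectors suffice. Both use that y is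
  nonzero off the zero section: \<Delta> = (0, y) is then a nonzero vertical vector, and \<Gamma>
  has base part y and is not vertical.\<close>

lemma d\<pi>_kernel:
  assumes u: "u \<in> carrier_of T" and v: "v \<in> tangent_space T u" and zero: "d\<pi> u v = 0"
  shows "\<exists>a b. v = a *\<^sub>R \<Delta> u + b *\<^sub>R \<Gamma> u"
proof -
  obtain \<psi> where \<psi>: "\<psi> \<in> T" "u \<in> chart_dom \<psi>" using u by (auto simp: carrier_of_def)
  have "\<pi> u \<in> carrier_of P" using path_space u unfolding path_space_def by blast
  then obtain \<theta> where \<theta>: "\<theta> \<in> P" "\<pi> u \<in> chart_dom \<theta>" by (auto simp: carrier_of_def)
  let ?G' = "frechet_derivative (local_rep \<psi> \<theta> \<pi>) (at (chart_map \<psi> u))"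
  note G' = T.tangent_map_smooth(2)[OF smooth_\<pi> \<psi> \<theta>, symmetric]
  let ?x = "\<Delta> u" and ?y = "\<Gamma> u"
  have xy: "?x \<in> tangent_space T u" "?y \<in> tangent_space T u"
    using \<Delta>.X_tangent[OF u] \<Gamma>.X_tangent[OF u] by auto
  have "v \<psi> \<in> span {?x \<psi>, ?y \<psi>}"
  proof (rule kernel_subset_span2[where G = ?G'])
    show "linear ?G'"
      by (rule has_derivative_linear[OF T.tangent_map_smooth(1)[OF smooth_\<pi> \<psi> \<theta>]])
    have "\<exists>x. w = ?G' x" for w
    proof -
      have "P.tangent_vector \<theta> (\<pi> u) w \<in> d\<pi> u ` tangent_space T u"
        using P.tangent_vector_in[OF \<theta>] by (simp add: d\<pi>_image[OF u])
      then obtain a where a: "P.tangent_vector \<theta> (\<pi> u) w = d\<pi> u a" "a \<in> tangent_space T u"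
        by (rule imageE)
      have "w = d\<pi> u a \<theta>" using P.tangent_vector_chart[OF \<theta>] a(1) by metis
      then show ?thesis using G'[OF a(2)] by metis
    qed
    then show "surj ?G'" by (simp add: surj_def)
    show "DIM('e \<times> 'e) \<le> DIM('q) + 2"
      using path_space by (simp add: path_space_def)
    show "?G' (?x \<psi>) = 0" "?G' (?y \<psi>) = 0" "?G' (v \<psi>) = 0"
      using G'[OF xy(1)] G'[OF xy(2)] G'[OF v] d\<pi>_liouville[OF u] d\<pi>_spray[OF u] zero by simp_all
    obtain \<phi> where \<phi>: "\<phi> \<in> M" "\<psi> = slit \<phi>" using T_cases[OF \<psi>(1)] by blast
    then have "snd (chart_map \<psi> u) \<noteq> 0"
      using \<psi>(2) tangent_eq_0_iff[of "snd u" "fst u" \<phi>] by (simp add: slit_map slit_dom_iff)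
    then show "?x \<psi> \<noteq> 0" "?y \<psi> \<notin> span {?x \<psi>}"
      using fst_spray_chart[OF \<psi>] by (auto simp: liouville_chart[OF \<psi>] span_singleton prod_eq_iff)
  qed
  then obtain a b where ab: "v \<psi> = a *\<^sub>R ?x \<psi> + b *\<^sub>R ?y \<psi>"
    by (auto simp: span_insert span_singleton algebra_simps)
  have "v = a *\<^sub>R ?x + b *\<^sub>R ?y"
  proof (rule T.tangent_vector_eqI[OF v _ \<psi>])
    show "a *\<^sub>R ?x + b *\<^sub>R ?y \<in> tangent_space T u"
      using xy by (intro subspace_add[OF T.subspace_tangent_space] subspace_scale[OF T.subspace_tangent_space])
    show "v \<psi> = (a *\<^sub>R ?x + b *\<^sub>R ?y) \<psi>" using ab by (simp add: scaleR_fun_apply)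
  qed
  then show ?thesis by blast
qed

lemma jacobi_fields_eq: "jacobi_fields M \<Gamma> \<gamma> = projection ` {Z. transported Z}"
  unfolding jacobi_fields_def lie_transported_iff by blast

section \<open>The induced isomorphism\<close>

text \<open>Through the projection, \<open>j\<close> becomes evaluation of a transported field at
  time 0 followed by the differential of \<pi> at \<open>c 0\<close>. Linearity, kernel and image
  are all computed for transported fields.\<close>

lemma jacobi_quotient_isomorphism:
  assumes p: "\<pi> (c 0) = p"
  defines "J \<equiv> jacobi_fields M \<Gamma> \<gamma>"
    and "K \<equiv> tangential_jacobi_fields M \<gamma>"
    and "j \<equiv> jacobi_to_path_space M \<Gamma> P \<pi> \<gamma>"
  shows "linear_map_on J (tangent_space P p) j \<and>
    (\<exists>j\<^sub>0. (\<forall>\<zeta>\<in>J. j\<^sub>0 (coset K \<zeta>) = j \<zeta>) \<and>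
      linear_map_on_quotient J K (tangent_space P p) j\<^sub>0 \<and>
      bij_betw j\<^sub>0 (quotient_space J K) (tangent_space P p))"
proof -
  let ?V = "{Z. transported Z}" and ?bp = "projection"
  let ?Z1 = "\<lambda>t. \<Gamma> (c t)" and ?Z2 = "\<lambda>t. \<Delta> (c t) + t *\<^sub>R \<Gamma> (c t)"
  have J: "J = ?bp ` ?V" by (simp add: J_def jacobi_fields_eq)
  have J_I: "?bp Z \<in> J" if "Z \<in> ?V" for Z
    unfolding J using that by (rule imageI)
  have J_E: thesis if "\<zeta> \<in> J" "\<And>Z. Z \<in> ?V \<Longrightarrow> \<zeta> = ?bp Z \<Longrightarrow> thesis" for \<zeta> thesis
    using that unfolding J by (elim imageE)
  have j: "j (?bp Z) = d\<pi> (c 0) (Z 0)" if "Z \<in> ?V" for Z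
    using that jacobi_to_path_space_eq by (simp add: j_def)
  have Zt: "Z t \<in> tangent_space T (c t)" if "Z \<in> ?V" for Z t
    using that by (simp add: C.linearized_on_def)
  have V12: "?Z1 \<in> ?V" "?Z2 \<in> ?V"
    using spray_field_transported liouville_spray_field_transported by auto
  have V_add: "Z + Z' \<in> ?V" if "Z \<in> ?V" "Z' \<in> ?V" for Z Z'
    using that linearized_on_add by simp
  have V_scale: "r *\<^sub>R Z \<in> ?V" if "Z \<in> ?V" for r Z
    using that linearized_on_scaleR by simp
  have bp_add: "?bp (Z + Z') = ?bp Z + ?bp Z'" if "Z \<in> ?V" "Z' \<in> ?V" for Z Z'
    using that base_projection_add by simp
  have bp_scale: "?bp (r *\<^sub>R Z) = r *\<^sub>R ?bp Z" if "Z \<in> ?V" for r Z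
    using that base_projection_scaleR by simp
  have K: "K = span {?bp ?Z1, ?bp ?Z2}"
    by (simp add: K_def tangential_jacobi_fields_def base_projection_spray_field base_projection_liouville_spray_field)
  have subJ: "subspace J"
  proof (rule subspaceI)
    have "?bp (0 *\<^sub>R ?Z1) = 0" using bp_scale[OF V12(1), of 0] by (simp only: scaleR_zero_left)
    then show "0 \<in> J" using J_I[OF V_scale[OF V12(1)], of 0] by (simp only:)
    fix x assume x: "x \<in> J"
    then obtain Z where Z: "Z \<in> ?V" "x = ?bp Z" by (rule J_E)
    show "r *\<^sub>R x \<in> J" for r
      using J_I[OF V_scale[OF Z(1)], of r] bp_scale[OF Z(1), of r] Z(2) by (simp only:)
    fix y assume "y \<in> J"
    then obtain Z' where Z': "Z' \<in> ?V" "y = ?bp Z'" by (rule J_E)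
    show "x + y \<in> J"
      using J_I[OF V_add[OF Z(1) Z'(1)]] bp_add[OF Z(1) Z'(1)] Z(2) Z'(2) by (simp only:)
  qed
  have lin: "linear_map_on J (tangent_space P p) j"
    unfolding linear_map_on_def
  proof (intro conjI ballI allI)
    show "subspace J" by (rule subJ)
    show "subspace (tangent_space P p)" by (rule P.subspace_tangent_space)
    show "j \<in> J \<rightarrow> tangent_space P p"
    proof
      fix \<zeta> assume "\<zeta> \<in> J"
      then obtain Z where Z: "Z \<in> ?V" "\<zeta> = ?bp Z" by (rule J_E)
      show "j \<zeta> \<in> tangent_space P p"
        using tangent_map_smooth_in[OF T_differentiable_atlas P.differentiable_atlas_axioms smooth_\<pi> C.c_carrier Zt[OF Z(1)], of 0]
          j[OF Z(1)] Z(2) p by simp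
    qed
    show "j (x + y) = j x + j y" if xy: "x \<in> J" "y \<in> J" for x y
    proof -
      obtain Z where Z: "Z \<in> ?V" "x = ?bp Z" by (rule J_E[OF xy(1)])
      obtain Z' where Z': "Z' \<in> ?V" "y = ?bp Z'" by (rule J_E[OF xy(2)])
      have "j (x + y) = d\<pi> (c 0) (Z 0 + Z' 0)"
        using j[OF V_add[OF Z(1) Z'(1)]] bp_add[OF Z(1) Z'(1)] Z(2) Z'(2) by simp
      then show ?thesis
        using T.tangent_map_smooth_linear(1)[OF smooth_\<pi> C.c_carrier Zt[OF Z(1)] Zt[OF Z'(1)]] j[OF Z(1)] j[OF Z'(1)] Z(2) Z'(2)
        by simp
    qed
    show "j (r *\<^sub>R x) = r *\<^sub>R j x" if x: "x \<in> J" for r x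
    proof -
      obtain Z where Z: "Z \<in> ?V" "x = ?bp Z" by (rule J_E[OF x])
      have "j (r *\<^sub>R x) = d\<pi> (c 0) (r *\<^sub>R Z 0)"
        using j[OF V_scale[OF Z(1)], of r] bp_scale[OF Z(1), of r] Z(2) by (simp add: scaleR_fun_apply)
      then show ?thesis
        using T.tangent_map_smooth_linear(2)[OF smooth_\<pi> C.c_carrier Zt[OF Z(1)] Zt[OF Z(1)]] j[OF Z(1)] Z(2) by simp
    qed
  qed
  have KJ: "K \<subseteq> J"
    unfolding K using J_I[OF V12(1)] J_I[OF V12(2)] subJ by (intro span_minimal) simp_all
  have K_zero: "j \<zeta> = 0" if \<zeta>: "\<zeta> \<in> K" for \<zeta>
  proof -
    obtain a b where ab: "\<zeta> = a *\<^sub>R ?bp ?Z1 + b *\<^sub>R ?bp ?Z2"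
      using \<zeta> unfolding K by (auto simp: span_insert span_singleton algebra_simps)
    note b12 = J_I[OF V12(1)] J_I[OF V12(2)]
    have "j (?bp ?Z1) = 0" "j (?bp ?Z2) = 0"
      using j[OF V12(1)] j[OF V12(2)] d\<pi>_spray[OF C.c_carrier] d\<pi>_liouville[OF C.c_carrier] by simp_all
    moreover have "j \<zeta> = a *\<^sub>R j (?bp ?Z1) + b *\<^sub>R j (?bp ?Z2)"
      using lin b12 subspace_scale[OF subJ] unfolding ab linear_map_on_def by simp
    ultimately show ?thesis by simp
  qed
  have ker: "j \<zeta> = 0 \<longleftrightarrow> \<zeta> \<in> K" if \<zeta>: "\<zeta> \<in> J" for \<zeta>
  proof
    assume zero: "j \<zeta> = 0"
    obtain Z where Z: "Z \<in> ?V" "\<zeta> = ?bp Z" by (rule J_E[OF \<zeta>])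
    obtain a b where ab: "Z 0 = a *\<^sub>R \<Delta> (c 0) + b *\<^sub>R \<Gamma> (c 0)"
      using d\<pi>_kernel[OF C.c_carrier Zt[OF Z(1)], of 0] zero j[OF Z(1)] Z(2) by auto
    \<comment> \<open>At time 0 the summand t\<Gamma> vanishes, so the coefficients of the initial
      value are those of the transported fields, and uniqueness of transport gives equality at all
      times.\<close>
    let ?Z = "a *\<^sub>R ?Z2 + b *\<^sub>R ?Z1"
    have "?Z \<in> ?V" by (intro V_add V_scale V12)
    moreover have "Z 0 = ?Z 0" using ab by (simp add: scaleR_fun_apply)
    ultimately have "Z t = ?Z t" for t
      using C.linearized_on_UNIV_unique[of Z ?Z 0 t] Z(1) by blast
    then have "Z = ?Z" by (rule ext)
    then have eq: "\<zeta> = a *\<^sub>R ?bp ?Z2 + b *\<^sub>R ?bp ?Z1"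
      using bp_add[OF V_scale[OF V12(2)] V_scale[OF V12(1)]] bp_scale[OF V12(1)] bp_scale[OF V12(2)] Z(2) by simp
    show "\<zeta> \<in> K"
      unfolding K eq by (intro span_add span_scale span_base) simp_all
  qed (rule K_zero)
  have "j ` J = tangent_space P p"
  proof
    show "j ` J \<subseteq> tangent_space P p" using lin unfolding linear_map_on_def by blast
    show "tangent_space P p \<subseteq> j ` J"
    proof
      fix w assume "w \<in> tangent_space P p"
      then have "w \<in> d\<pi> (c 0) ` tangent_space T (c 0)"
        using d\<pi>_image[OF C.c_carrier, of 0] p by simp
      then obtain v where v: "w = d\<pi> (c 0) v" "v \<in> tangent_space T (c 0)" by (rule imageE)
      \<comment> \<open>Global existence of transport turns every tangent vector at
        \<open>c 0\<close> into an initial value of a Jacobi field.\<close>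
      obtain Z where Z: "Z 0 = v" "Z \<in> ?V" using C.linearized_on_exists[OF v(2)] by blast
      then have "w = j (?bp Z)" using j v(1) by simp
      then show "w \<in> j ` J" using J_I[OF Z(2)] by blast
    qed
  qed
  then show ?thesis
    using lin induced_quotient_isomorphism[OF lin _ KJ ker] subspace_span K by blast
qed

end

theorem proposition1:
  fixes M :: "('m, 'e::euclidean_space) atlas"
    and \<Gamma> :: "'m \<times> ('m, 'e) tangent \<Rightarrow> ('m, 'e) slit_tangent"
    and P :: "('p, 'q::euclidean_space) atlas"
    and \<pi> :: "'m \<times> ('m, 'e) tangent \<Rightarrow> 'p"
    and \<gamma> :: "real \<Rightarrow> 'm"
    and L :: "('m \<times> ('m, 'e) tangent) set"
    and p :: 'p
  assumes "smooth_manifold M" "paracompact_space (atlas_topology M)" "DIM('e) \<ge> 3"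
    and "spray M \<Gamma>"
    and "path_space M \<Gamma> P \<pi>"
    and "geodesic M \<Gamma> \<gamma>"
    and "leaf (slit_tangent_bundle M) (spray_distribution M \<Gamma>) L"
    and "range (natural_lift M \<gamma>) \<subseteq> L"
    and "\<pi> ` L = {p}"
  defines "J \<equiv> jacobi_fields M \<Gamma> \<gamma>"
    and "K \<equiv> tangential_jacobi_fields M \<gamma>"
    and "j \<equiv> jacobi_to_path_space M \<Gamma> P \<pi> \<gamma>"
  shows "linear_map_on J (tangent_space P p) j \<and>
    (\<exists>j\<^sub>0. (\<forall>\<zeta>\<in>J. j\<^sub>0 (coset K \<zeta>) = j \<zeta>) \<and>
      linear_map_on_quotient J K (tangent_space P p) j\<^sub>0 \<and>
      bij_betw j\<^sub>0 (quotient_space J K) (tangent_space P p))"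
proof -
  obtain c where c: "integral_curve (slit_tangent_bundle M) \<Gamma> UNIV c" and \<gamma>: "\<gamma> = fst \<circ> c"
    using assms(6) by (auto simp: geodesic_def)
  interpret spray_path_space M \<Gamma> c P \<pi>
    by unfold_locales (use assms c in auto)
  \<comment> \<open>The natural lift of \<open>\<gamma>\<close> is \<open>c\<close>, so the
    condition on the leaf fixes the base point \<open>\<pi> (c 0)\<close>.\<close>
  have "c 0 \<in> L" using assms(8) natural_lift_eq by (auto simp: \<gamma>)
  then have "\<pi> (c 0) = p" using assms(9) by blast
  then show ?thesis
    unfolding J_def K_def j_def \<gamma> by (rule jacobi_quotient_isomorphism)
qed

end
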